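(* The problem Trivially Perfect Editing admits a kernel with $O(k^3)$ vertices. That is, there is an algorithm that, given an instance $(G,k)$ of Trivially Perfect Editing, runs in time polynomial in $|V(G)|$ and $k$ and outputs an instance $(G',k')$ of Trivially Perfect Editing such that $(G',k')$ is a yes-instance if and only if $(G,k)$ is a yes-instance, $|V(G')| = O(k^3)$, and $k' \le g(k)$ for some computable function $g$.
   Context: All graphs are finite, simple and undirected. A graph is trivially perfect if it contains neither $P_4$ (the path on 4 vertices) nor $C_4$ (the cycle on 4 vertices) as an induced subgraph. Trivially Perfect Editing: given a graph $G=(V,E)$ and an integer $k\in\mathbb{N}$, decide whether there is a set $F$ of unordered pairs of distinct vertices of $V$ with $|F|\le k$ such that $H=(V,E\triangle F)$ is trivially perfect, where $E\triangle F=(E\setminus F)\cup(F\setminus E)$. Such an $F$ is a $k$-edition of $G$; $(G,k)$ is a yes-instance if a $k$-edition exists. *)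

theory Defs
  imports Complex_Main "HOL-Library.Landau_Symbols" "HOL-Computational_Algebra.Polynomial"
begin

section \<open>Graphs and Trivially Perfect Editing\<close>

datatype 'a ugraph = UGraph (verts: "'a set") (edges: "'a set set")

definition vertex_pairs :: "'a set \<Rightarrow> 'a set set" where
  "vertex_pairs V = {e. e \<subseteq> V \<and> card e = 2}"

definition simple_graph :: "'a ugraph \<Rightarrow> bool" where
  "simple_graph G \<longleftrightarrow> finite (verts G) \<and> edges G \<subseteq> vertex_pairs (verts G)"

definition induced_subgraph :: "'a ugraph \<Rightarrow> 'a set \<Rightarrow> 'a ugraph" where
  "induced_subgraph G S = UGraph S {e \<in> edges G. e \<subseteq> S}"

definition isomorphic :: "'a ugraph \<Rightarrow> 'b ugraph \<Rightarrow> bool" where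
  "isomorphic G H \<longleftrightarrow>
     (\<exists>f. bij_betw f (verts G) (verts H) \<and>
          (\<forall>u\<in>verts G. \<forall>v\<in>verts G. {u, v} \<in> edges G \<longleftrightarrow> {f u, f v} \<in> edges H))"

definition contains_induced :: "'a ugraph \<Rightarrow> 'b ugraph \<Rightarrow> bool" where
  "contains_induced G H \<longleftrightarrow> (\<exists>S \<subseteq> verts G. isomorphic (induced_subgraph G S) H)"

definition P4 :: "nat ugraph" where
  "P4 = UGraph {0, 1, 2, 3} {{0, 1}, {1, 2}, {2, 3}}"

definition C4 :: "nat ugraph" where
  "C4 = UGraph {0, 1, 2, 3} {{0, 1}, {1, 2}, {2, 3}, {3, 0}}"

definition trivially_perfect :: "'a ugraph \<Rightarrow> bool" where
  "trivially_perfect G \<longleftrightarrow> \<not> contains_induced G P4 \<and> \<not> contains_induced G C4"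

definition edit :: "'a ugraph \<Rightarrow> 'a set set \<Rightarrow> 'a ugraph" where
  "edit G F = UGraph (verts G) ((edges G - F) \<union> (F - edges G))"

definition is_edition :: "'a ugraph \<Rightarrow> nat \<Rightarrow> 'a set set \<Rightarrow> bool" where
  "is_edition G k F \<longleftrightarrow>
     F \<subseteq> vertex_pairs (verts G) \<and> card F \<le> k \<and> trivially_perfect (edit G F)"

definition yes_instance :: "'a ugraph \<Rightarrow> nat \<Rightarrow> bool" where
  "yes_instance G k \<longleftrightarrow> (\<exists>F. is_edition G k F)"


section \<open>Model of computation\<close>

text \<open>
  Algorithms are programs of a unit-cost random access machine, presented as a structured
  language: registers and random-access memory hold natural numbers of unbounded size, and the
  only arithmetic is addition and truncated subtraction. The registers and the memory regions
  (two-dimensional arrays) carry names; a program mentions only finitely many of them, and array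
  indices may be computed. Every assignment and every test costs one step; as the expressions
  occurring in a fixed program have bounded size, charging for their operations
  would change the running time only by a constant factor. There is deliberately no multiplication:
  the bit length of all stored numbers and addresses then grows by at most a constant per step,
  so that running times are polynomially related to those of Turing machines.
\<close>

type_synonym vname = string

record state =
  reg :: "vname \<Rightarrow> nat"
  arr :: "vname \<Rightarrow> nat \<Rightarrow> nat \<Rightarrow> nat"

datatype aexp =
    Const nat
  | Var vname
  | Read vname aexp aexp
  | Add aexp aexp
  | Sub aexp aexp

datatype bexp =
    Lt aexp aexp
  | Eq aexp aexp
  | Neg bexp
  | Conj bexp bexp

datatype com =
    Skip
  | Assign vname aexp
  | Store vname aexp aexp aexp
  | Seq com com
  | Cond bexp com com
  | While bexp com

primrec aval :: "aexp \<Rightarrow> state \<Rightarrow> nat" where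
  "aval (Const c) s = c"
| "aval (Var x) s = reg s x"
| "aval (Read A a b) s = arr s A (aval a s) (aval b s)"
| "aval (Add a b) s = aval a s + aval b s"
| "aval (Sub a b) s = aval a s - aval b s"

primrec bval :: "bexp \<Rightarrow> state \<Rightarrow> bool" where
  "bval (Lt a b) s \<longleftrightarrow> aval a s < aval b s"
| "bval (Eq a b) s \<longleftrightarrow> aval a s = aval b s"
| "bval (Neg b) s \<longleftrightarrow> \<not> bval b s"
| "bval (Conj b c) s \<longleftrightarrow> bval b s \<and> bval c s"

definition set_reg :: "vname \<Rightarrow> nat \<Rightarrow> state \<Rightarrow> state" where
  "set_reg x v s = s\<lparr>reg := (reg s)(x := v)\<rparr>"

definition set_arr :: "vname \<Rightarrow> nat \<Rightarrow> nat \<Rightarrow> nat \<Rightarrow> state \<Rightarrow> state" where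
  "set_arr A i j v s = s\<lparr>arr := (arr s)(A := (arr s A)(i := (arr s A i)(j := v)))\<rparr>"

text \<open>\<open>exec c s t s'\<close>: started in \<open>s\<close>, the program \<open>c\<close> halts after exactly \<open>t\<close> steps in \<open>s'\<close>.\<close>

inductive exec :: "com \<Rightarrow> state \<Rightarrow> nat \<Rightarrow> state \<Rightarrow> bool" where
  exec_Skip: "exec Skip s 1 s"
| exec_Assign: "exec (Assign x a) s 1 (set_reg x (aval a s) s)"
| exec_Store: "exec (Store A a b e) s 1 (set_arr A (aval a s) (aval b s) (aval e s) s)"
| exec_Seq: "exec c s t s' \<Longrightarrow> exec d s' u s'' \<Longrightarrow> exec (Seq c d) s (t + u) s''"
| exec_CondTrue: "bval b s \<Longrightarrow> exec c s t s' \<Longrightarrow> exec (Cond b c d) s (t + 1) s'"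
| exec_CondFalse: "\<not> bval b s \<Longrightarrow> exec d s t s' \<Longrightarrow> exec (Cond b c d) s (t + 1) s'"
| exec_WhileFalse: "\<not> bval b s \<Longrightarrow> exec (While b c) s 1 s"
| exec_WhileTrue:
    "bval b s \<Longrightarrow> exec c s t s' \<Longrightarrow> exec (While b c) s' u s'' \<Longrightarrow>
     exec (While b c) s (t + u + 1) s''"

inductive_cases exec_SkipE: "exec Skip s t s'"
inductive_cases exec_AssignE: "exec (Assign x a) s t s'"
inductive_cases exec_StoreE: "exec (Store A a b e) s t s'"
inductive_cases exec_SeqE: "exec (Seq c d) s t s'"
inductive_cases exec_CondE: "exec (Cond b c d) s t s'"
inductive_cases exec_WhileE: "exec (While b c) s t s'"

text \<open>A program has at most one halting run from each state, so the existence of a run with given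
  properties is a statement about the run.\<close>

lemma exec_deterministic:
  "exec c s t s' \<Longrightarrow> exec c s u s'' \<Longrightarrow> u = t \<and> s'' = s'"
proof (induction arbitrary: u s'' rule: exec.induct)
  case (exec_Seq c s t s' d v s1)
  from exec_Seq.prems obtain t1 r t2
    where u: "u = t1 + t2" "exec c s t1 r" "exec d r t2 s''"
    by (rule exec_SeqE)
  with exec_Seq.IH(1)[OF u(2)] exec_Seq.IH(2)[of t2 s''] show ?case by simp
next
  case (exec_CondTrue b s c t s' d)
  from exec_CondTrue.prems obtain t1 where u: "u = t1 + 1" "exec c s t1 s''"
    by (rule exec_CondE) (use exec_CondTrue.hyps in auto)
  with exec_CondTrue.IH[OF u(2)] show ?case by simp
next
  case (exec_CondFalse b s d t s' c)
  from exec_CondFalse.prems obtain t1 where u: "u = t1 + 1" "exec d s t1 s''"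
    by (rule exec_CondE) (use exec_CondFalse.hyps in auto)
  with exec_CondFalse.IH[OF u(2)] show ?case by simp
next
  case (exec_WhileFalse b s c)
  from exec_WhileFalse.prems show ?case
    by (rule exec_WhileE) (use exec_WhileFalse.hyps in auto)
next
  case (exec_WhileTrue b s c t s' v s1)
  from exec_WhileTrue.prems obtain t1 r t2
    where u: "u = t1 + t2 + 1" "exec c s t1 r" "exec (While b c) r t2 s''"
    by (rule exec_WhileE) (use exec_WhileTrue.hyps in auto)
  with exec_WhileTrue.IH(1)[OF u(2)] exec_WhileTrue.IH(2)[of t2 s''] show ?case by simp
qed (erule exec_SkipE exec_AssignE exec_StoreE, simp)+

definition blank :: state where
  "blank = \<lparr>reg = (\<lambda>_. 0), arr = (\<lambda>_ _ _. 0)\<rparr>"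

definition computable :: "(nat \<Rightarrow> nat) \<Rightarrow> bool" where
  "computable g \<longleftrightarrow>
     (\<exists>P. \<forall>x. \<exists>t s. exec P (set_reg ''x'' x blank) t s \<and> reg s ''y'' = g x)"


section \<open>Instances as machine states\<close>

text \<open>
  An instance \<open>(G, k)\<close> is presented by the number of vertices, \<open>k\<close> and the adjacency matrix
  of \<open>G\<close> with respect to an enumeration \<open>vs\<close> of its vertices. Vertices are natural numbers,
  so every finite graph is covered up to renaming, by one and the same program. An input contains
  nothing else; an output may leave scratch data elsewhere in memory.
\<close>

definition enumerates :: "nat list \<Rightarrow> nat ugraph \<Rightarrow> bool" where
  "enumerates vs G \<longleftrightarrow> distinct vs \<and> set vs = verts G"

definition input_state :: "nat list \<Rightarrow> nat ugraph \<Rightarrow> nat \<Rightarrow> state" where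
  "input_state vs G k =
     \<lparr>reg = (\<lambda>_. 0)(''n'' := length vs, ''k'' := k),
      arr = (\<lambda>_ _ _. 0)(''adj'' := (\<lambda>i j.
        if i < length vs \<and> j < length vs \<and> {vs ! i, vs ! j} \<in> edges G then 1 else 0))\<rparr>"

definition output_instance :: "state \<Rightarrow> nat ugraph \<Rightarrow> nat \<Rightarrow> bool" where
  "output_instance s G k \<longleftrightarrow>
     simple_graph G \<and> reg s ''k'' = k \<and>
     (\<exists>vs. enumerates vs G \<and> reg s ''n'' = length vs \<and>
        (\<forall>i<length vs. \<forall>j<length vs.
           arr s ''adj'' i j = (if {vs ! i, vs ! j} \<in> edges G then 1 else 0)))"

end

theory Submission
  imports Defs
begin

text \<open>
  A graph is trivially perfect iff the closed neighbourhoods of any two adjacent vertices are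
  nested, so that its vertices form a forest in which adjacency is comparability. The kernel deletes
  one vertex at a time: a vertex with more than \<open>2 * k\<close> true twins; a vertex of a large trivially
  perfect module whose neighbourhood has many pairwise nonadjacent common neighbours, which force it
  to become a clique; or a vertex in the middle of a long comb. An edition of the smaller
  graph affects at most \<open>2 * k\<close> vertices, so each rule provides an unaffected witness, and the
  deleted vertex can be put back with its original neighbourhood at no cost.

  If no rule applies, take the forest of an edited graph. The sets of affected vertices below the
  vertices form a laminar family, so at most \<open>4 * k\<close> of them are nonempty. The unaffected vertices
  with a given nonempty set form a chain of \<open>O(k)\<close> twin classes of size \<open>O(k)\<close>, and the unaffected
  subtrees hanging off this chain have \<open>O(k\<^sup>2)\<close> vertices in total. This gives \<open>O(k\<^sup>3)\<close> vertices.

  The rules are first-order definable with counting, and such definitions turn into nested bounded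
  loops, which makes the running time polynomial.
\<close>


section \<open>Reflexive graphs with nested neighbourhoods\<close>

type_synonym 'a adjacency = "'a \<Rightarrow> 'a \<Rightarrow> bool"

locale reflexive_graph =
  fixes V :: "'a set" and A :: "'a adjacency"
  assumes finite_verts: "finite V"
    and refl: "u \<in> V \<Longrightarrow> A u u"
    and sym: "u \<in> V \<Longrightarrow> v \<in> V \<Longrightarrow> A u v \<Longrightarrow> A v u"
begin

lemma commute: "u \<in> V \<Longrightarrow> v \<in> V \<Longrightarrow> A u v \<longleftrightarrow> A v u"
  using sym by blast

lemma reflexive_graph_subset: "U \<subseteq> V \<Longrightarrow> reflexive_graph U A"
  using finite_subset[OF _ finite_verts] refl sym by unfold_locales (simp_all add: subset_iff)

end

definition nbhd_le :: "'a set \<Rightarrow> 'a adjacency \<Rightarrow> 'a \<Rightarrow> 'a \<Rightarrow> bool" where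
  "nbhd_le V A u v \<longleftrightarrow> (\<forall>z\<in>V. A z u \<longrightarrow> A z v)"

definition nbhd_less :: "'a set \<Rightarrow> 'a adjacency \<Rightarrow> 'a \<Rightarrow> 'a \<Rightarrow> bool" where
  "nbhd_less V A u v \<longleftrightarrow> nbhd_le V A u v \<and> \<not> nbhd_le V A v u"

definition twin :: "'a set \<Rightarrow> 'a adjacency \<Rightarrow> 'a \<Rightarrow> 'a \<Rightarrow> bool" where
  "twin V A u v \<longleftrightarrow> nbhd_le V A u v \<and> nbhd_le V A v u"

definition nested :: "'a set \<Rightarrow> 'a adjacency \<Rightarrow> bool" where
  "nested V A \<longleftrightarrow> (\<forall>u\<in>V. \<forall>v\<in>V. A u v \<longrightarrow> nbhd_le V A u v \<or> nbhd_le V A v u)"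

lemma nbhd_leI: "(\<And>z. z \<in> V \<Longrightarrow> A z u \<Longrightarrow> A z v) \<Longrightarrow> nbhd_le V A u v"
  by (simp add: nbhd_le_def)

lemma nbhd_leD: "nbhd_le V A u v \<Longrightarrow> z \<in> V \<Longrightarrow> A z u \<Longrightarrow> A z v"
  by (simp add: nbhd_le_def)

lemma nbhd_le_refl: "nbhd_le V A u u"
  by (simp add: nbhd_le_def)

lemma nbhd_le_trans: "nbhd_le V A u v \<Longrightarrow> nbhd_le V A v w \<Longrightarrow> nbhd_le V A u w"
  by (simp add: nbhd_le_def)

lemma nbhd_less_trans: "nbhd_less V A u v \<Longrightarrow> nbhd_less V A v w \<Longrightarrow> nbhd_less V A u w"
  unfolding nbhd_less_def using nbhd_le_trans[of V A] by blast

lemma nbhd_le_subset: "nbhd_le V A u v \<Longrightarrow> U \<subseteq> V \<Longrightarrow> nbhd_le U A u v"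
  by (auto simp: nbhd_le_def)

lemma (in reflexive_graph) adj_if_nbhd_le: "u \<in> V \<Longrightarrow> nbhd_le V A u v \<Longrightarrow> A u v"
  by (rule nbhd_leD) (auto intro: refl)

lemma twin_sym: "twin V A u v \<Longrightarrow> twin V A v u"
  by (simp add: twin_def)

lemma twin_equivalence:
  "reflp_on W (twin V A)" "symp_on W (twin V A)" "transp_on W (twin V A)"
  using nbhd_le_trans by (auto simp: reflp_on_def symp_on_def transp_on_def twin_def nbhd_le_refl)

lemma nested_subset: "nested V A \<Longrightarrow> U \<subseteq> V \<Longrightarrow> nested U A"
  unfolding nested_def nbhd_le_def by (meson subsetD)

lemma nbhd_le_if_private_neighbour:
  assumes "nested V A" "{x, u, w} \<subseteq> V" "A u w" "A x u" "\<not> A x w"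
  shows "nbhd_le V A w u"
  using assms nbhd_leD[of V A u w x] by (auto simp: nested_def)

lemma nested_chord:
  assumes "nested V A" "{a, b, c, d} \<subseteq> V" "A b c" "A a b" "\<not> A a c" "A d c"
  shows "A d b"
  using nbhd_leD[OF nbhd_le_if_private_neighbour[of V A a b c]] assms by simp

lemma nested_vimage:
  assumes "nested W B" "f ` V \<subseteq> W"
  shows "nested V (\<lambda>u v. B (f u) (f v))"
  using assms unfolding nested_def nbhd_le_def image_subset_iff by meson

lemma reflexive_graph_vimage:
  assumes "reflexive_graph W B" "f ` V \<subseteq> W" "finite V"
  shows "reflexive_graph V (\<lambda>u v. B (f u) (f v))"
  using assms by (simp add: reflexive_graph_def image_subset_iff)


section \<open>Editions\<close>

definition disagreements :: "'a set \<Rightarrow> 'a adjacency \<Rightarrow> 'a adjacency \<Rightarrow> 'a set set" where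
  "disagreements V A B = {{u, v} | u v. u \<in> V \<and> v \<in> V \<and> A u v \<noteq> B u v}"

definition affected :: "'a set \<Rightarrow> 'a adjacency \<Rightarrow> 'a adjacency \<Rightarrow> 'a set" where
  "affected V A B = {u \<in> V. \<exists>w\<in>V. A u w \<noteq> B u w}"

definition editable :: "'a set \<Rightarrow> 'a adjacency \<Rightarrow> nat \<Rightarrow> bool" where
  "editable V A k \<longleftrightarrow> (\<exists>B. reflexive_graph V B \<and> nested V B \<and> card (disagreements V A B) \<le> k)"

lemma disagreements_subset: "disagreements V A B \<subseteq> Pow V"
  by (auto simp: disagreements_def)

lemma finite_disagreements: "finite V \<Longrightarrow> finite (disagreements V A B)"
  by (rule finite_subset[OF disagreements_subset]) simp

lemma affected_subset: "affected V A B \<subseteq> V"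
  by (auto simp: affected_def)

lemma affected_subset_Union: "affected V A B \<subseteq> \<Union>(disagreements V A B)"
  by (auto simp: affected_def disagreements_def)

lemma unaffectedD: "u \<in> V - affected V A B \<Longrightarrow> w \<in> V \<Longrightarrow> A u w \<longleftrightarrow> B u w"
  by (auto simp: affected_def)

lemma card_affected_le:
  assumes "finite V" "card (disagreements V A B) \<le> k"
  shows "card (affected V A B) \<le> 2 * k"
proof -
  have "card (affected V A B) \<le> card (\<Union>(disagreements V A B))"
    by (rule card_mono[OF finite_subset[OF _ assms(1)] affected_subset_Union])
      (use disagreements_subset in blast)
  also have "\<dots> \<le> sum card (disagreements V A B)"
    by (rule card_Union_le_sum_card)
  also have "\<dots> \<le> (\<Sum>e\<in>disagreements V A B. 2)"
    by (rule sum_mono) (auto simp: disagreements_def card_insert_if split: if_splits)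
  also have "\<dots> \<le> 2 * k"
    using assms(2) by simp
  finally show ?thesis .
qed

lemma card_le_card_Diff:
  assumes "finite X" "card X \<le> m"
  shows "card W \<le> card (W - X) + m"
  using assms card_Diff_subset_Int[of W X] diff_card_le_card_Diff[OF assms(1), of W] by linarith

lemma editable_vimage:
  assumes ed: "editable W B k" and inj: "inj_on f V" and f: "f ` V \<subseteq> W"
    and AB: "\<And>u v. u \<in> V \<Longrightarrow> v \<in> V \<Longrightarrow> A u v \<longleftrightarrow> B (f u) (f v)"
  shows "editable V A k"
proof -
  obtain B' where B': "reflexive_graph W B'" "nested W B'" "card (disagreements W B B') \<le> k"
    using ed by (auto simp: editable_def)
  let ?A' = "\<lambda>u v. B' (f u) (f v)"
  have finW: "finite W" using B'(1) by (rule reflexive_graph.finite_verts)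
  have "card (disagreements V A ?A') \<le> card (disagreements W B B')"
  proof (rule card_inj_on_le)
    show "inj_on ((`) f) (disagreements V A ?A')"
      by (rule inj_on_subset[OF inj_on_image_Pow[OF inj] disagreements_subset])
    show "(`) f ` disagreements V A ?A' \<subseteq> disagreements W B B'"
      using f by (fastforce simp: disagreements_def AB)
  qed (rule finite_disagreements[OF finW])
  then have "card (disagreements V A ?A') \<le> k" using B'(3) by simp
  moreover have "reflexive_graph V ?A'"
    by (rule reflexive_graph_vimage[OF B'(1) f inj_on_finite[OF inj f finW]])
  moreover have "nested V ?A'" by (rule nested_vimage[OF B'(2) f])
  ultimately show ?thesis by (auto simp: editable_def)
qed

corollary editable_subset: "editable V A k \<Longrightarrow> U \<subseteq> V \<Longrightarrow> editable U A k"
  by (rule editable_vimage[where f = id]) auto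

corollary editable_cong_bij:
  assumes f: "bij_betw f V W"
    and AB: "\<And>u v. u \<in> V \<Longrightarrow> v \<in> V \<Longrightarrow> A u v \<longleftrightarrow> B (f u) (f v)"
  shows "editable V A k \<longleftrightarrow> editable W B k"
proof
  show "editable V A k" if "editable W B k"
    using that by (rule editable_vimage[where f = f]) (use f in \<open>auto simp: bij_betw_def AB\<close>)
  let ?g = "the_inv_into V f"
  have g: "bij_betw ?g W V" by (rule bij_betw_the_inv_into[OF f])
  have g_in: "?g u \<in> V" and f_g: "f (?g u) = u" if "u \<in> W" for u
    using that bij_betwE[OF g] f_the_inv_into_f_bij_betw[OF f] by auto
  show "editable W B k" if "editable V A k"
    using that by (rule editable_vimage[where f = ?g])
      (use g in \<open>auto simp: bij_betw_def AB g_in f_g\<close>)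
qed

locale vertex_deletion = reflexive_graph V A for V :: "'a::linorder set" and A +
  fixes v :: 'a and B :: "'a adjacency" and k :: nat
  assumes v_in_V: "v \<in> V" and reflexive_B: "reflexive_graph (V - {v}) B"
    and nested_B: "nested (V - {v}) B"
    and card_disagreements: "card (disagreements (V - {v}) A B) \<le> k"
begin

sublocale B: reflexive_graph "V - {v}" B
  by (rule reflexive_B)

abbreviation X :: "'a set" where
  "X \<equiv> affected (V - {v}) A B"

lemma card_le_card_unaffected: "card W \<le> card (W - X) + 2 * k"
  by (rule card_le_card_Diff[OF finite_subset[OF affected_subset B.finite_verts]
      card_affected_le[OF B.finite_verts card_disagreements]])

lemma ex_unaffected:
  assumes "2 * k < card W"
  obtains w where "w \<in> W - X"
proof -
  have "W - X \<noteq> {}" using card_le_card_unaffected[of W] assms by fastforce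
  then show thesis using that by blast
qed

lemma unaffected_adj:
  assumes "u \<in> V - {v} - X" "w \<in> V - {v}"
  shows "B u w \<longleftrightarrow> A u w" "B w u \<longleftrightarrow> A u w"
  using unaffectedD[OF assms] B.commute[of u w] assms by blast+

lemma editable_if_agree:
  assumes B': "reflexive_graph V B'" "nested V B'"
    and agree: "\<And>u w. u \<in> V \<Longrightarrow> w \<in> V \<Longrightarrow> A u w \<noteq> B' u w \<Longrightarrow> u \<noteq> v \<and> w \<noteq> v \<and> B' u w = B u w"
  shows "editable V A k"
proof -
  have "disagreements V A B' \<subseteq> disagreements (V - {v}) A B"
  proof
    fix e assume "e \<in> disagreements V A B'"
    then obtain u w where "e = {u, w}" "u \<in> V" "w \<in> V" "A u w \<noteq> B' u w"
      by (auto simp: disagreements_def)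
    then show "e \<in> disagreements (V - {v}) A B"
      using agree[of u w] by (auto simp: disagreements_def)
  qed
  then have "card (disagreements V A B') \<le> k"
    using card_mono[OF finite_disagreements[OF B.finite_verts]] card_disagreements order_trans by blast
  then show ?thesis using B' by (auto simp: editable_def)
qed

end


section \<open>Reinserting a well-attached set\<close>

definition glue :: "'a set \<Rightarrow> 'a adjacency \<Rightarrow> 'a adjacency \<Rightarrow> 'a adjacency" where
  "glue Z A B u v = (if u \<in> Z \<or> v \<in> Z then A u v else B u v)"

text \<open>In the forest of the glued graph, \<open>Z\<close> is a segment \<open>Chain\<close> of a root-leaf path together with
  the branches \<open>Z - Chain\<close> that leave the path at \<open>Chain\<close>; \<open>Up\<close> is the part of the path above
  \<open>Z\<close>, \<open>Down\<close> the part below \<open>Chain\<close>.\<close>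

locale gluing = A: reflexive_graph V A + B: reflexive_graph "V - Z" B
  for V Z :: "'a set" and A B +
  fixes Chain Up Down Away :: "'a set"
  assumes nested_B: "nested (V - Z) B" and nested_Z: "nested Z A"
    and Z_subset: "Z \<subseteq> V" and Chain_subset: "Chain \<subseteq> Z"
    and outside: "V - Z = Up \<union> Down \<union> Away"
    and Z_Up: "z \<in> Z \<Longrightarrow> u \<in> Up \<Longrightarrow> A z u"
    and Z_Down: "z \<in> Z \<Longrightarrow> u \<in> Down \<Longrightarrow> A z u \<longleftrightarrow> z \<in> Chain"
    and Z_Away: "z \<in> Z \<Longrightarrow> u \<in> Away \<Longrightarrow> \<not> A z u"
    and Chain_Chain: "c \<in> Chain \<Longrightarrow> d \<in> Chain \<Longrightarrow> A c d"
    and branch_le_Chain: "c \<in> Chain \<Longrightarrow> r \<in> Z - Chain \<Longrightarrow> A c r \<Longrightarrow> nbhd_le Z A r c"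
    and Up_Up: "u \<in> Up \<Longrightarrow> v \<in> Up \<Longrightarrow> B u v"
    and Up_Down: "u \<in> Up \<Longrightarrow> v \<in> Down \<Longrightarrow> B u v"
    and Down_Away: "u \<in> Down \<Longrightarrow> v \<in> Away \<Longrightarrow> \<not> B u v"
    and Away_le_Up: "u \<in> Up \<Longrightarrow> v \<in> Away \<Longrightarrow> B u v \<Longrightarrow> nbhd_le (V - Z) B v u"
begin

abbreviation comparable :: "'a \<Rightarrow> 'a \<Rightarrow> bool" where
  "comparable u v \<equiv> nbhd_le V (glue Z A B) u v \<or> nbhd_le V (glue Z A B) v u"

lemma nbhd_le_outside:
  assumes "u \<in> V - Z" "v \<in> V - Z" "nbhd_le (V - Z) B u v" "\<And>z. z \<in> Z \<Longrightarrow> A z u \<Longrightarrow> A z v"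
  shows "nbhd_le V (glue Z A B) u v"
  using assms by (auto simp: nbhd_le_def glue_def)

lemma nbhd_le_inside:
  assumes "u \<in> Z" "v \<in> Z" "nbhd_le Z A u v" "\<And>y. y \<in> V - Z \<Longrightarrow> A u y \<Longrightarrow> A v y"
  shows "nbhd_le V (glue Z A B) u v"
proof (rule nbhd_leI)
  fix y assume y: "y \<in> V" "glue Z A B y u"
  show "glue Z A B y v"
  proof (cases "y \<in> Z")
    case True
    then show ?thesis using y assms nbhd_leD[OF assms(3)] by (simp add: glue_def)
  next
    case False
    then show ?thesis using y assms A.commute[of y] Z_subset by (auto simp: glue_def)
  qed
qed

lemma Z_neighbour: "z \<in> Z \<Longrightarrow> y \<in> V - Z \<Longrightarrow> A z y \<Longrightarrow> y \<in> Up \<union> Down"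
  using Z_Away outside by blast

lemma Down_neighbour: "d \<in> Down \<Longrightarrow> y \<in> V - Z \<Longrightarrow> B y d \<Longrightarrow> y \<in> Up \<union> Down"
  using Down_Away[of d y] B.commute[of y d] outside by blast

lemma Up_adj: "u \<in> Up \<Longrightarrow> y \<in> Up \<union> Down \<Longrightarrow> B y u"
  using Up_Up Up_Down B.commute[of y u] outside by blast

lemma comparable_Up_Down:
  assumes "u \<in> Up" "d \<in> Down"
  shows "comparable d u"
proof -
  have "nbhd_le (V - Z) B d u"
    using assms Down_neighbour Up_adj by (blast intro: nbhd_leI)
  then show ?thesis using assms outside Z_Up nbhd_le_outside by blast
qed

lemma comparable_Z_Up:
  assumes "z \<in> Z" "u \<in> Up"
  shows "comparable z u"
proof -
  have "nbhd_le V (glue Z A B) z u"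
  proof (rule nbhd_leI)
    fix y assume y: "y \<in> V" "glue Z A B y z"
    show "glue Z A B y u"
    proof (cases "y \<in> Z")
      case True
      then show ?thesis using Z_Up assms by (simp add: glue_def)
    next
      case False
      then have "A z y" using y assms(1) A.commute[of y z] Z_subset by (auto simp: glue_def)
      then have "B y u" using Z_neighbour[of z y] Up_adj assms y(1) False by blast
      then show ?thesis using False assms(2) outside by (auto simp: glue_def)
    qed
  qed
  then show ?thesis ..
qed

lemma comparable_Down_Chain:
  assumes "d \<in> Down" "c \<in> Chain"
  shows "comparable d c"
proof -
  have c: "c \<in> Z" "c \<in> V" and d: "d \<notin> Z" using assms Chain_subset Z_subset outside by auto
  have "nbhd_le V (glue Z A B) d c"
  proof (rule nbhd_leI)
    fix y assume y: "y \<in> V" "glue Z A B y d"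
    have "A c y"
    proof (cases "y \<in> Z")
      case True
      then have "y \<in> Chain" using y(2) Z_Down assms(1) by (simp add: glue_def)
      then show ?thesis using Chain_Chain assms(2) by blast
    next
      case False
      then have "B y d" using y(2) d by (simp add: glue_def)
      then have "y \<in> Up \<union> Down" using Down_neighbour assms(1) y(1) False by blast
      then show ?thesis using Z_Up Z_Down c(1) assms(2) by blast
    qed
    then show "glue Z A B y c" using A.commute[of c y] c y(1) by (simp add: glue_def)
  qed
  then show ?thesis ..
qed

lemma comparable_inside:
  assumes uv: "u \<in> Z" "v \<in> Z" "A u v"
  shows "comparable u v"
proof (cases "u \<in> Chain \<longleftrightarrow> v \<in> Chain")
  case True
  have "A u y \<longleftrightarrow> A v y" if "y \<in> V - Z" for y
    using that True uv(1,2) Z_Up Z_Down Z_Away outside by blast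
  moreover have "nbhd_le Z A u v \<or> nbhd_le Z A v u"
    using nested_Z uv by (simp add: nested_def)
  ultimately show ?thesis using nbhd_le_inside uv by blast
next
  case False
  have branch: "nbhd_le V (glue Z A B) r c" if "c \<in> Chain" "r \<in> Z - Chain" "A c r" for c r
  proof (rule nbhd_le_inside[OF _ _ branch_le_Chain[OF that]])
    fix y assume y: "y \<in> V - Z" "A r y"
    then have "y \<in> Up" using Z_neighbour[of r y] Z_Down[of r y] that(2) by blast
    then show "A c y" using Z_Up that(1) Chain_subset by blast
  qed (use that Chain_subset in blast)+
  have "A v u" using A.sym uv Z_subset by blast
  then show ?thesis using False uv branch[of u v] branch[of v u] by blast
qed

lemma comparable_crossing:
  assumes "z \<in> Z" "u \<in> V - Z" "A z u"
  shows "comparable u z"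
  using Z_neighbour[OF assms] assms Z_Down comparable_Z_Up comparable_Down_Chain by blast

lemma comparable_outside:
  assumes uv: "u \<in> V - Z" "v \<in> V - Z" "B u v"
  shows "comparable u v"
proof -
  have B_comparable: "nbhd_le (V - Z) B u v \<or> nbhd_le (V - Z) B v u"
    using nested_B uv by (simp add: nested_def)
  have sameI: "comparable u v" if "\<And>z. z \<in> Z \<Longrightarrow> A z u \<longleftrightarrow> A z v"
    using that B_comparable nbhd_le_outside uv by blast
  have Away_Up: "comparable a w" if "w \<in> Up" "a \<in> Away" "B w a" for w a
    using Away_le_Up[OF that] that outside Z_Up nbhd_le_outside by blast
  have Bvu: "B v u" using B.sym uv by blast
  consider "u \<in> Up" "v \<in> Up" | "u \<in> Down" "v \<in> Down" | "u \<in> Away" "v \<in> Away"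
    | "u \<in> Up" "v \<in> Down" | "u \<in> Down" "v \<in> Up" | "u \<in> Up" "v \<in> Away" | "u \<in> Away" "v \<in> Up"
    using uv Bvu Down_Away outside by blast
  then show ?thesis
  proof cases
    case 1 then show ?thesis using sameI Z_Up by blast
  next
    case 2 then show ?thesis using sameI Z_Down by blast
  next
    case 3 then show ?thesis using sameI Z_Away by blast
  next
    case 4 then show ?thesis using comparable_Up_Down by blast
  next
    case 5 then show ?thesis using comparable_Up_Down by blast
  next
    case 6 then show ?thesis using Away_Up uv(3) by blast
  next
    case 7 then show ?thesis using Away_Up Bvu by blast
  qed
qed

theorem nested_glue: "nested V (glue Z A B)"
  unfolding nested_def
proof (intro ballI impI)
  fix u v assume uv: "u \<in> V" "v \<in> V" and adj: "glue Z A B u v"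
  consider "u \<in> Z" "v \<in> Z" "A u v" | "u \<in> Z" "v \<in> V - Z" "A u v"
    | "u \<in> V - Z" "v \<in> Z" "A u v" | "u \<in> V - Z" "v \<in> V - Z" "B u v"
    using uv adj by (auto simp: glue_def split: if_splits)
  then show "comparable u v"
  proof cases
    case 1 then show ?thesis by (rule comparable_inside)
  next
    case 2 then show ?thesis using comparable_crossing by blast
  next
    case 3
    then show ?thesis using A.sym uv comparable_crossing by blast
  next
    case 4 then show ?thesis by (rule comparable_outside)
  qed
qed

end

lemma (in vertex_deletion) editable_if_nested_glue:
  assumes "v \<in> Z" "Z \<subseteq> V" "nested V (glue Z A B)"
  shows "editable V A k"
proof (rule editable_if_agree[OF _ assms(3)])
  show "reflexive_graph V (glue Z A B)"
  proof
    show "glue Z A B w u" if "u \<in> V" "w \<in> V" "glue Z A B u w" for u w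
      using that sym B.sym[of u w] assms(1) by (cases "u \<in> Z \<or> w \<in> Z") (auto simp: glue_def)
  qed (use finite_verts refl B.refl assms(1) in \<open>auto simp: glue_def\<close>)
qed (use assms(1) in \<open>auto simp: glue_def split: if_splits\<close>)


section \<open>Representatives of classes\<close>

definition class_reps :: "'a::linorder set \<Rightarrow> ('a \<Rightarrow> 'a \<Rightarrow> bool) \<Rightarrow> 'a set" where
  "class_reps W E = {c \<in> W. \<forall>d\<in>W. d < c \<longrightarrow> \<not> E d c}"

lemma class_reps_subset: "class_reps W E \<subseteq> W"
  by (auto simp: class_reps_def)

lemma class_reps_eqI:
  assumes "c \<in> class_reps W E" "d \<in> class_reps W E" "E c d" "E d c"
  shows "c = d"
  using assms by (cases c d rule: linorder_cases) (auto simp: class_reps_def)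

lemma ex_class_rep:
  assumes "finite W" "reflp_on W E" "transp_on W E" "w \<in> W"
  obtains r where "r \<in> class_reps W E" "E r w"
proof
  let ?r = "Min {u \<in> W. E u w}"
  have r: "?r \<in> {u \<in> W. E u w}"
    using assms by (intro Min_in) (auto dest: reflp_onD)
  then show "E ?r w" by simp
  have "\<not> E d ?r" if "d \<in> W" "d < ?r" for d
  proof
    assume "E d ?r"
    then have "d \<in> {u \<in> W. E u w}"
      using r that(1) assms(4) transp_onD[OF assms(3), of d ?r w] by blast
    then have "?r \<le> d" using assms(1) by (intro Min_le) auto
    then show False using that(2) by simp
  qed
  then show "?r \<in> class_reps W E" using r by (simp add: class_reps_def)
qed

lemma card_independent_le_class_reps:
  assumes W: "finite W" "reflp_on W E" "symp_on W E" "transp_on W E"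
    and I: "I \<subseteq> W" "\<And>r s. r \<in> I \<Longrightarrow> s \<in> I \<Longrightarrow> E r s \<Longrightarrow> r = s"
  shows "card I \<le> card (class_reps W E)"
proof -
  have "\<forall>i\<in>I. \<exists>r\<in>class_reps W E. E r i"
    using ex_class_rep[OF W(1,2,4)] I(1) by blast
  then obtain rep where rep: "rep i \<in> class_reps W E" "E (rep i) i" if "i \<in> I" for i
    by metis
  have "inj_on rep I"
  proof (rule inj_onI)
    fix i j assume ij: "i \<in> I" "j \<in> I" "rep i = rep j"
    have mem: "rep i \<in> W" "i \<in> W" "j \<in> W"
      using rep(1)[OF ij(1)] ij I(1) class_reps_subset by blast+
    have "E i (rep i)" using symp_onD[OF W(3)] mem rep(2)[OF ij(1)] by blast
    then have "E i j" using transp_onD[OF W(4), of i "rep i" j] mem rep(2)[OF ij(2)] ij(3) by simp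
    then show "i = j" using I(2) ij by blast
  qed
  then show ?thesis
    using rep(1) finite_subset[OF class_reps_subset W(1)] by (intro card_inj_on_le) auto
qed


section \<open>Deletion rules\<close>

definition rule_twin :: "'a set \<Rightarrow> 'a adjacency \<Rightarrow> nat \<Rightarrow> 'a \<Rightarrow> bool" where
  "rule_twin V A k v \<longleftrightarrow> 2 * k + 1 \<le> card {u \<in> V. u \<noteq> v \<and> twin V A u v}"

definition common_nbhd :: "'a set \<Rightarrow> 'a adjacency \<Rightarrow> 'a \<Rightarrow> 'a \<Rightarrow> 'a set" where
  "common_nbhd V A x w = {z \<in> V. A z x \<and> A z w}"

definition attached :: "'a set \<Rightarrow> 'a adjacency \<Rightarrow> 'a set \<Rightarrow> 'a set" where
  "attached V A K = {y \<in> V - K. \<forall>z\<in>K. A z y}"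

definition simplicial_verts :: "'a set \<Rightarrow> 'a adjacency \<Rightarrow> 'a set" where
  "simplicial_verts V A = {r \<in> V. \<forall>z\<in>V. \<forall>y\<in>V. A z r \<longrightarrow> A y r \<longrightarrow> A z y}"

lemma attached_subset: "attached V A K \<subseteq> V"
  by (auto simp: attached_def)

lemma simplicial_verts_subset: "simplicial_verts V A \<subseteq> V"
  by (auto simp: simplicial_verts_def)

lemma (in reflexive_graph) simplicial_equivalence:
  assumes "T \<subseteq> V"
  shows "reflp_on (simplicial_verts T A) A" "symp_on (simplicial_verts T A) A"
    "transp_on (simplicial_verts T A) A"
proof -
  have "simplicial_verts T A \<subseteq> V" by (rule order_trans[OF simplicial_verts_subset assms])
  then show "reflp_on (simplicial_verts T A) A" "symp_on (simplicial_verts T A) A"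
    using refl sym by (auto simp: reflp_on_def symp_on_def subset_eq)
  show "transp_on (simplicial_verts T A) A"
  proof (rule transp_onI)
    fix r s t assume rst: "r \<in> simplicial_verts T A" "s \<in> simplicial_verts T A"
      "t \<in> simplicial_verts T A" "A r s" "A s t"
    then have mem: "r \<in> T" "s \<in> T" "t \<in> T" using simplicial_verts_subset[of T A] by auto
    then have "A t s" using sym[of s t] rst(5) assms by blast
    then show "A r t" using rst(2,4) mem unfolding simplicial_verts_def by blast
  qed
qed

definition is_module :: "'a set \<Rightarrow> 'a adjacency \<Rightarrow> 'a set \<Rightarrow> 'a set \<Rightarrow> bool" where
  "is_module V A K M \<longleftrightarrow> M \<subseteq> V - K \<and> (\<forall>z\<in>M. \<forall>y\<in>V - M. A z y \<longleftrightarrow> y \<in> K)"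

text \<open>The union of the components of \<open>V - K\<close> that are trivially perfect and completely joined to
  \<open>K\<close>. A connected trivially perfect graph has a universal vertex \<open>u\<close>, so such a component is the
  neighbourhood of \<open>u\<close> in \<open>V - K\<close>, which is a first-order condition.\<close>

definition module_over :: "'a set \<Rightarrow> 'a adjacency \<Rightarrow> 'a set \<Rightarrow> 'a set" where
  "module_over V A K =
     \<Union>{N. is_module V A K N \<and> nested N A \<and> (\<exists>u\<in>V - K. N = {z \<in> V - K. A z u})}"

definition rule_module :: "'a::linorder set \<Rightarrow> 'a adjacency \<Rightarrow> nat \<Rightarrow> 'a \<Rightarrow> bool" where
  "rule_module V A k v \<longleftrightarrow> (\<exists>x\<in>V. \<exists>w\<in>V. let K = common_nbhd V A x w in
     v \<in> module_over V A K \<and> 2 * k + 2 \<le> card (module_over V A K) \<and>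
     2 * k + 3 \<le> card (class_reps (simplicial_verts (attached V A K) A) A))"

text \<open>The picture behind a comb is a path in the forest from \<open>p\<close> down to \<open>q\<close>: the shaft consists of the
  path vertices below \<open>p\<close>, the teeth are the vertices in the branches that leave the path in between.\<close>

definition teeth :: "'a set \<Rightarrow> 'a adjacency \<Rightarrow> 'a \<Rightarrow> 'a \<Rightarrow> 'a set" where
  "teeth V A p q = {r \<in> V. A r p \<and> \<not> A r q}"

definition shaft :: "'a set \<Rightarrow> 'a adjacency \<Rightarrow> 'a \<Rightarrow> 'a \<Rightarrow> 'a set" where
  "shaft V A p q = {c \<in> V. nbhd_le V A q c \<and> nbhd_le V A c p \<and> (\<exists>r\<in>teeth V A p q. \<not> A r c)}"

definition comb :: "'a set \<Rightarrow> 'a adjacency \<Rightarrow> 'a \<Rightarrow> 'a \<Rightarrow> bool" where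
  "comb V A p q \<longleftrightarrow> p \<in> V \<and> q \<in> V \<and> nbhd_le V A q p \<and>
     (\<forall>c\<in>shaft V A p q. \<forall>d\<in>shaft V A p q. nbhd_le V A c d \<or> nbhd_le V A d c) \<and>
     (\<forall>y\<in>V. A y q \<and> y \<notin> shaft V A p q \<longrightarrow>
        (\<forall>r\<in>teeth V A p q. A r y) \<or> (\<forall>r\<in>teeth V A p q. \<not> A r y)) \<and>
     (\<forall>r\<in>teeth V A p q. nbhd_le V A r p) \<and>
     (\<forall>r\<in>teeth V A p q. \<forall>s\<in>teeth V A p q. A r s \<longrightarrow>
        (nbhd_le V A r s \<or> nbhd_le V A s r) \<and> (\<forall>c\<in>shaft V A p q. A r c \<longrightarrow> A s c))"

definition rule_comb :: "'a::linorder set \<Rightarrow> 'a adjacency \<Rightarrow> nat \<Rightarrow> 'a \<Rightarrow> bool" where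
  "rule_comb V A k v \<longleftrightarrow> (\<exists>p\<in>V. \<exists>q\<in>V. comb V A p q \<and> v \<in> shaft V A p q \<and>
     4 * k + 1 \<le> card {c \<in> class_reps (shaft V A p q) (twin V A). nbhd_less V A v c} \<and>
     2 * k + 1 \<le> card {c \<in> class_reps (shaft V A p q) (twin V A). nbhd_less V A c v})"

definition deletable :: "'a::linorder set \<Rightarrow> 'a adjacency \<Rightarrow> nat \<Rightarrow> 'a \<Rightarrow> bool" where
  "deletable V A k v \<longleftrightarrow> rule_twin V A k v \<or> rule_module V A k v \<or> rule_comb V A k v"


subsection \<open>Twins\<close>

text \<open>The deleted vertex becomes a twin of an unaffected twin in the edited graph.\<close>

lemma (in vertex_deletion) editable_if_rule_twin:
  assumes "rule_twin V A k v"
  shows "editable V A k"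
proof -
  obtain t where t: "t \<in> V" "t \<noteq> v" "twin V A t v" "t \<notin> X"
    using ex_unaffected[of "{u \<in> V. u \<noteq> v \<and> twin V A u v}"] assms
    by (auto simp: rule_twin_def Suc_le_eq)
  define f where "f = id(v := t)"
  have f: "f ` V \<subseteq> V - {v}" using t(1,2) by (auto simp: f_def)
  have twin_t: "A u v \<longleftrightarrow> A u t" if "u \<in> V" for u
    using that t(3) by (auto simp: twin_def nbhd_le_def)
  have A_v: "A v u \<longleftrightarrow> B t u" if "u \<in> V - {v}" for u
    using that twin_t[of u] unaffected_adj[of t u] commute[of v u] commute[of t u] t v_in_V by simp
  have "A v v" "B t t" using refl[OF v_in_V] B.refl t by auto
  then have agree: "A u w \<longleftrightarrow> B (f u) (f w)"
    if "u \<in> V" "w \<in> V" "u = v \<or> w = v" for u w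
    using that A_v[of u] A_v[of w] commute[of u v] B.commute[of u t] t v_in_V by (auto simp: f_def)
  show ?thesis
  proof (rule editable_if_agree)
    show "reflexive_graph V (\<lambda>u w. B (f u) (f w))"
      by (rule reflexive_graph_vimage[OF reflexive_B f finite_verts])
    show "nested V (\<lambda>u w. B (f u) (f w))"
      by (rule nested_vimage[OF nested_B f])
    show "u \<noteq> v \<and> w \<noteq> v \<and> B (f u) (f w) = B u w"
      if "u \<in> V" "w \<in> V" "A u w \<noteq> B (f u) (f w)" for u w
      using that agree[of u w] by (auto simp: f_def)
  qed
qed


subsection \<open>Modules\<close>

lemma module_overE:
  assumes "y \<in> module_over V A K"
  obtains N where "y \<in> N" "N \<subseteq> module_over V A K" "is_module V A K N" "nested N A"
proof -
  obtain N u where "y \<in> N" "is_module V A K N" "nested N A" "u \<in> V - K" "N = {z \<in> V - K. A z u}"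
    using assms by (auto simp: module_over_def)
  then show thesis using that[of N] by (auto simp: module_over_def)
qed

lemma is_module_module_over: "is_module V A K (module_over V A K)"
  unfolding is_module_def
proof (intro conjI ballI subsetI)
  show "y \<in> V - K" if "y \<in> module_over V A K" for y
    using that by (auto simp: module_over_def)
  fix z y assume "z \<in> module_over V A K" and y: "y \<in> V - module_over V A K"
  then obtain N where "z \<in> N" "N \<subseteq> module_over V A K" "is_module V A K N"
    using module_overE by metis
  then show "A z y \<longleftrightarrow> y \<in> K" using y unfolding is_module_def by blast
qed

lemma (in reflexive_graph) nested_module_over: "nested (module_over V A K) A"
  unfolding nested_def
proof (intro ballI impI)
  let ?M = "module_over V A K"
  fix y z assume yz: "y \<in> ?M" "z \<in> ?M" "A y z"
  obtain N where N: "y \<in> N" "N \<subseteq> ?M" "is_module V A K N" "nested N A"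
    using module_overE[OF yz(1)] .
  have M: "?M \<subseteq> V - K" using is_module_module_over[of V A K] by (simp add: is_module_def)
  have closed: "t \<in> N" if "x \<in> N" "t \<in> ?M" "A x t" for x t
    using that N(3) M unfolding is_module_def by blast
  have extend: "nbhd_le ?M A s t" if "s \<in> N" "nbhd_le N A s t" for s t
  proof (rule nbhd_leI)
    fix x assume x: "x \<in> ?M" "A x s"
    then have "A s x" using sym[of x s] that(1) N(2) M by blast
    then show "A x t" using closed[OF that(1) x(1)] nbhd_leD[OF that(2) _ x(2)] by blast
  qed
  have "z \<in> N" using closed N(1) yz by blast
  then have "nbhd_le N A y z \<or> nbhd_le N A z y" using N(1,4) yz(3) by (simp add: nested_def)
  then show "nbhd_le ?M A y z \<or> nbhd_le ?M A z y" using extend N(1) \<open>z \<in> N\<close> by blast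
qed

context vertex_deletion
begin

lemma clique_if_many_simplicial:
  assumes K: "K \<subseteq> V - {v}"
    and many: "2 * k + 3 \<le> card (class_reps (simplicial_verts (attached V A K) A) A)"
    and uz: "u \<in> K" "z \<in> K"
  shows "B z u"
proof -
  define L where "L = class_reps (simplicial_verts (attached V A K) A) A"
  have L: "2 * k + 3 \<le> card L" "L \<subseteq> attached V A K"
    using many order_trans[OF class_reps_subset simplicial_verts_subset] by (auto simp: L_def)
  obtain a where a: "a \<in> L - {v} - X"
    by (rule ex_unaffected[of "L - {v}"])
      (use L in \<open>simp add: card_Diff_singleton_if less_diff_conv\<close>)
  obtain b where b: "b \<in> L - {v} - {a} - X"
    by (rule ex_unaffected[of "L - {v} - {a}"]) (use L in \<open>auto simp: card_Diff_singleton_if\<close>)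
  have unaffected: "a \<in> V - {v} - X" "b \<in> V - {v} - X"
    using a b L by (auto simp: attached_def)
  have adj: "B x y" "B y x" if "y \<in> K" "x \<in> {a, b}" for x y
  proof -
    have "A y x" using that a b L by (auto simp: attached_def)
    moreover have "x \<in> V - {v} - X" "y \<in> V - {v}" using that unaffected K by auto
    ultimately show "B x y" "B y x" using unaffected_adj commute[of x y] by auto
  qed
  have "\<not> A a b" using class_reps_eqI[of a _ A b] a b unaffected commute by (auto simp: L_def)
  then have "\<not> B b a" using unaffected_adj unaffected by blast
  moreover have "{b, u, a, z} \<subseteq> V - {v}" using uz K unaffected by blast
  ultimately show ?thesis using nested_chord[OF nested_B, of b u a z] adj uz by blast
qed

lemma editable_if_module:
  assumes M: "is_module V A K M" "nested M A" "v \<in> M" "2 * k + 2 \<le> card M"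
    and K: "K \<subseteq> V" "\<And>u z. u \<in> K \<Longrightarrow> z \<in> K \<Longrightarrow> B u z"
  shows "editable V A k"
proof -
  have M_sub: "M \<subseteq> V - K" using M(1) by (simp add: is_module_def)
  have M_adj: "A z y \<longleftrightarrow> y \<in> K" if "z \<in> M" "y \<in> V - M" for z y
    using M(1) that by (simp add: is_module_def)
  have sub: "V - M \<subseteq> V - {v}" "K \<subseteq> V - {v}" using M_sub M(3) K(1) by auto
  obtain r where r: "r \<in> M - {v} - X"
    by (rule ex_unaffected[of "M - {v}"]) (use M in simp)
  interpret B': reflexive_graph "V - M" B by (rule B.reflexive_graph_subset[OF sub(1)])
  interpret gluing V M A B "{}" K "{}" "V - M - K"
  proof
    show "nested (V - M) B" by (rule nested_subset[OF nested_B sub(1)])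
    show "nbhd_le (V - M) B z u" if "u \<in> K" "z \<in> V - M - K" "B u z" for u z
    proof -
      have rV: "r \<in> V - {v} - X" using r M_sub by auto
      have "u \<in> V - {v}" "z \<in> V - {v}" "u \<in> V - M"
        using that M_sub M(3) sub by auto
      then have "B r u" "\<not> B r z"
        using M_adj[of r] that r unaffected_adj(1)[OF rV] by auto
      then have "nbhd_le (V - {v}) B z u"
        using nbhd_le_if_private_neighbour[OF nested_B, of r u z] that M(3) sub rV by blast
      then show ?thesis by (rule nbhd_le_subset[OF _ sub(1)])
    qed
    show "A z u" if "z \<in> M" "u \<in> K" for z u
      using M_adj[of z u] that M_sub K(1) by blast
    show "\<not> A z u" if "z \<in> M" "u \<in> V - M - K" for z u
      using M_adj[of z u] that by blast
  qed (use M(2) M_sub K in auto)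
  show ?thesis
    by (rule editable_if_nested_glue[OF M(3) _ nested_glue]) (use M_sub in blast)
qed

lemma editable_if_rule_module:
  assumes "rule_module V A k v"
  shows "editable V A k"
proof -
  obtain x w where K: "v \<in> module_over V A (common_nbhd V A x w)"
    "2 * k + 2 \<le> card (module_over V A (common_nbhd V A x w))"
    "2 * k + 3 \<le> card (class_reps (simplicial_verts (attached V A (common_nbhd V A x w)) A) A)"
    using assms by (auto simp: rule_module_def Let_def)
  have "common_nbhd V A x w \<subseteq> V - {v}"
    using K(1) is_module_module_over by (fastforce simp: common_nbhd_def is_module_def)
  then show ?thesis
    using K clique_if_many_simplicial
    by (intro editable_if_module[OF is_module_module_over nested_module_over]) auto
qed

end


subsection \<open>Combs\<close>

locale comb_graph = reflexive_graph V A for V :: "'a::linorder set" and A +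
  fixes p q :: 'a
  assumes comb: "comb V A p q"
begin

abbreviation "R \<equiv> teeth V A p q"
abbreviation "C \<equiv> shaft V A p q"

lemma handle: "p \<in> V" "q \<in> V" "nbhd_le V A q p"
  and shaft_chain: "c \<in> C \<Longrightarrow> d \<in> C \<Longrightarrow> nbhd_le V A c d \<or> nbhd_le V A d c"
  and tooth_le_handle: "r \<in> R \<Longrightarrow> nbhd_le V A r p"
  and teeth_nested: "r \<in> R \<Longrightarrow> s \<in> R \<Longrightarrow> A r s \<Longrightarrow> nbhd_le V A r s \<or> nbhd_le V A s r"
  and shaft_adj_teeth: "r \<in> R \<Longrightarrow> s \<in> R \<Longrightarrow> A r s \<Longrightarrow> c \<in> C \<Longrightarrow> A r c \<Longrightarrow> A s c"
  using comb unfolding comb_def by blast+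

lemma teeth_agree: "y \<in> V \<Longrightarrow> A y q \<Longrightarrow> y \<notin> C \<Longrightarrow> r \<in> R \<Longrightarrow> s \<in> R \<Longrightarrow> A r y \<Longrightarrow> A s y"
  using comb unfolding comb_def by blast

lemma teethD: "r \<in> R \<Longrightarrow> r \<in> V" "r \<in> R \<Longrightarrow> A r p" "r \<in> R \<Longrightarrow> \<not> A r q"
  by (auto simp: teeth_def)

lemma shaftD: "c \<in> C \<Longrightarrow> c \<in> V" "c \<in> C \<Longrightarrow> nbhd_le V A q c" "c \<in> C \<Longrightarrow> nbhd_le V A c p"
  by (auto simp: shaft_def)

lemma shaft_adj:
  assumes "c \<in> C" "y \<in> V" "A y q"
  shows "A c y" "A y c"
  using nbhd_leD[OF shaftD(2)] shaftD(1) assms sym by blast+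

lemma shaft_adj_shaft: "c \<in> C \<Longrightarrow> d \<in> C \<Longrightarrow> A c d"
  using shaft_adj shaftD(1) handle(2) refl by blast

lemma tooth_notin_shaft: "r \<in> R \<Longrightarrow> r \<notin> C"
  using shaft_adj(1)[of r q] handle(2) refl teethD(3) by blast

lemma tooth_neighbour:
  assumes "s \<in> R" "z \<in> V" "A s z"
  shows "z \<in> R \<or> A z q"
  using nbhd_leD[OF tooth_le_handle[OF assms(1)] assms(2)] sym[of s z] assms
  by (auto simp: teeth_def)

lemma tooth_le_shaft:
  assumes "c \<in> C" "s \<in> R" "A s c"
  shows "nbhd_le V A s c"
proof (rule nbhd_leI)
  fix z assume z: "z \<in> V" "A z s"
  then have "A s z" using sym teethD(1) assms(2) by blast
  then show "A z c"
    using tooth_neighbour[OF assms(2) z(1)] shaft_adj_teeth[OF assms(2)] assms shaft_adj(2) z(1) by blast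
qed

lemma shaft_separated:
  assumes "c \<in> C" "d \<in> C" "\<not> nbhd_le V A c d"
  shows "\<exists>s\<in>R. A s c \<and> \<not> A s d"
proof -
  obtain s where s: "s \<in> V" "A s c" "\<not> A s d" using assms(3) by (auto simp: nbhd_le_def)
  moreover have "A s p" using nbhd_leD[OF shaftD(3)] assms(1) s by blast
  moreover have "\<not> A s q" using shaft_adj(2) assms(2) s by blast
  ultimately show ?thesis by (auto simp: teeth_def)
qed

end

locale comb_segment = comb_graph V A p q for V :: "'a::linorder set" and A p q +
  fixes a b :: 'a
  assumes a_in_shaft: "a \<in> C" and b_in_shaft: "b \<in> C" and b_le_a: "nbhd_le V A b a"
begin

definition spine :: "'a set" where
  "spine = {c \<in> C. nbhd_less V A b c \<and> nbhd_less V A c a}"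

definition branches :: "'a set" where
  "branches = {s \<in> R. A s a \<and> \<not> A s b}"

abbreviation Z :: "'a set" where
  "Z \<equiv> spine \<union> branches"

lemma Z_subset: "Z \<subseteq> V" and spine_subset: "spine \<subseteq> C" and branches_subset: "branches \<subseteq> R"
  by (auto simp: spine_def branches_def shaft_def teeth_def)

lemma adj_b_if_adj_a:
  assumes "y \<in> V - Z" "A y a"
  shows "A y b"
proof -
  have "A y p" using nbhd_leD[OF shaftD(3)[OF a_in_shaft]] assms by blast
  then show ?thesis using assms shaft_adj(2)[OF b_in_shaft] by (auto simp: branches_def teeth_def)
qed

lemma branch_neighbour_adj_q:
  assumes "s \<in> branches" "y \<in> V - Z" "A s y"
  shows "A y q"
proof (rule ccontr)
  assume "\<not> A y q"
  then have y: "y \<in> R" using tooth_neighbour assms branches_subset by blast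
  then have "A y a" using shaft_adj_teeth[OF _ y assms(3) a_in_shaft] assms(1) by (simp add: branches_def)
  then have "A y b" using adj_b_if_adj_a assms(2) by blast
  moreover have "A y s" using sym assms Z_subset by blast
  ultimately show False using shaft_adj_teeth[OF y _ _ b_in_shaft, of s] assms(1) by (simp add: branches_def)
qed

lemma branches_agree:
  assumes "s \<in> branches" "t \<in> branches" "y \<in> V - Z" "A s y"
  shows "A t y"
proof (cases "y \<in> C")
  case False
  then show ?thesis
    using teeth_agree[of y s t] branch_neighbour_adj_q assms branches_subset by blast
next
  case True
  have st: "s \<in> V" "A s a" "\<not> A s b" "t \<in> V" "A t a"
    using assms(1,2) by (auto simp: branches_def teeth_def)
  then have "\<not> nbhd_le V A y b" using assms(4) by (auto dest: nbhd_leD)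
  then have "nbhd_less V A b y" using shaft_chain[OF True b_in_shaft] by (auto simp: nbhd_less_def)
  then have "nbhd_le V A a y"
    using assms(3) True shaft_chain[OF True a_in_shaft] by (auto simp: spine_def nbhd_less_def)
  then show ?thesis using st(4,5) by (rule nbhd_leD)
qed

lemma spine_adj_iff:
  assumes "c \<in> spine" "y \<in> V - Z"
  shows "A c y \<longleftrightarrow> A y b"
proof
  have c: "c \<in> V" "nbhd_le V A b c" "nbhd_le V A c a"
    using assms(1) by (auto simp: spine_def nbhd_less_def shaftD(1))
  show "A c y" if "A y b" using nbhd_leD[OF c(2) _ that] assms(2) c(1) sym by blast
  show "A y b" if "A c y"
    using nbhd_leD[OF c(3), of y] adj_b_if_adj_a assms(2) that c(1) sym by blast
qed

lemma nested_Z: "nested Z A"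
  unfolding nested_def
proof (intro ballI impI)
  fix x y assume xy: "x \<in> Z" "y \<in> Z" "A x y"
  then have "A y x" using sym Z_subset by blast
  moreover have "x \<in> C \<or> x \<in> R" "y \<in> C \<or> y \<in> R"
    using xy spine_subset branches_subset by auto
  ultimately have "nbhd_le V A x y \<or> nbhd_le V A y x"
    using xy(3) shaft_chain[of x y] teeth_nested[of x y] tooth_le_shaft[of x y] tooth_le_shaft[of y x]
    by blast
  then show "nbhd_le Z A x y \<or> nbhd_le Z A y x" using nbhd_le_subset[OF _ Z_subset] by blast
qed

end

text \<open>The unaffected vertices \<open>a\<close>, \<open>b\<close> and \<open>r\<close> keep their neighbourhoods in \<open>B\<close>, which determines
  how the vertices outside the segment are related to each other in \<open>B\<close>.\<close>

locale comb_segment_deletion = vertex_deletion V A v B k + comb_segment V A p q a b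
  for V :: "'a::linorder set" and A v B k p q a b +
  fixes r :: 'a
  assumes v_spine: "v \<in> spine" and r_branch: "r \<in> branches"
    and unaffected: "a \<notin> X" "b \<notin> X" "r \<notin> X"
begin

lemma witnesses: "a \<in> V - {v} - X" "b \<in> V - {v} - X" "r \<in> V - {v} - X"
proof -
  have "a \<noteq> v" "b \<noteq> v" using v_spine by (auto simp: spine_def nbhd_less_def)
  moreover have "r \<noteq> v"
    using v_spine r_branch tooth_notin_shaft spine_subset branches_subset by blast
  ultimately show "a \<in> V - {v} - X" "b \<in> V - {v} - X" "r \<in> V - {v} - X"
    using unaffected a_in_shaft b_in_shaft r_branch shaftD(1) branches_subset teethD(1) by auto
qed

lemma r_separates_a_b: "A r a" "\<not> A r b"
  using r_branch by (auto simp: branches_def)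

lemma B_iff:
  assumes "y \<in> V - {v}"
  shows "B a y \<longleftrightarrow> A y a" "B y a \<longleftrightarrow> A y a" "B b y \<longleftrightarrow> A y b" "B y b \<longleftrightarrow> A y b"
    "B r y \<longleftrightarrow> A r y" "B y r \<longleftrightarrow> A r y"
  using unaffected_adj witnesses assms commute[of y] by auto

definition Up :: "'a set" where "Up = {y \<in> V - Z. A y b \<and> A r y}"
definition Down :: "'a set" where "Down = {y \<in> V - Z. A y b \<and> \<not> A r y}"
definition Away :: "'a set" where "Away = {y \<in> V - Z. \<not> A y b}"

lemma parts_subset: "Up \<subseteq> V - {v}" "Down \<subseteq> V - {v}" "Away \<subseteq> V - {v}" "V - Z \<subseteq> V - {v}"
  using v_spine by (auto simp: Up_def Down_def Away_def)

lemma Up_Up: "u \<in> Up \<Longrightarrow> y \<in> Up \<Longrightarrow> B u y"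
  and Up_Down: "u \<in> Up \<Longrightarrow> d \<in> Down \<Longrightarrow> B u d"
proof -
  show "B u y" if "u \<in> Up" "y \<in> Up"
    using nested_chord[OF nested_B, of r y b u] that parts_subset witnesses r_separates_a_b
    by (auto simp: B_iff Up_def subset_iff)
  show "B u d" if "u \<in> Up" "d \<in> Down"
    using nested_chord[OF nested_B, of r u b d] that parts_subset witnesses r_separates_a_b B.sym[of d u]
    by (auto simp: B_iff Up_def Down_def subset_iff)
qed

lemma Down_Away:
  assumes "d \<in> Down" "y \<in> Away"
  shows "\<not> B d y"
proof
  assume "B d y"
  have "A d a" using nbhd_leD[OF b_le_a] assms(1) by (auto simp: Down_def)
  then have "B y a"
    using nested_chord[OF nested_B, of r a d y] \<open>B d y\<close> assms parts_subset witnesses r_separates_a_b B.sym[of d y]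
    by (auto simp: B_iff Down_def subset_iff)
  then show False
    using adj_b_if_adj_a[of y] assms parts_subset by (auto simp: B_iff Away_def subset_iff)
qed

lemma Away_le_Up:
  assumes "u \<in> Up" "y \<in> Away" "B u y"
  shows "nbhd_le (V - Z) B y u"
proof (rule nbhd_le_subset[OF _ parts_subset(4)])
  show "nbhd_le (V - {v}) B y u"
    using nbhd_le_if_private_neighbour[OF nested_B, of b u y] assms parts_subset witnesses
    by (auto simp: B_iff Up_def Away_def subset_iff)
qed

lemma branch_adj_iff: "s \<in> branches \<Longrightarrow> y \<in> V - Z \<Longrightarrow> A s y \<longleftrightarrow> A r y"
  using branches_agree r_branch by blast

lemma adj_b_if_adj_r: "y \<in> V - Z \<Longrightarrow> A r y \<Longrightarrow> A y b"
  using branch_neighbour_adj_q[OF r_branch] shaft_adj(2)[OF b_in_shaft] by blast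

lemma editable: "editable V A k"
proof -
  interpret B': reflexive_graph "V - Z" B by (rule B.reflexive_graph_subset[OF parts_subset(4)])
  interpret gluing V Z A B spine Up Down Away
  proof
    show "nested (V - Z) B" by (rule nested_subset[OF nested_B parts_subset(4)])
    show "V - Z = Up \<union> Down \<union> Away" by (auto simp: Up_def Down_def Away_def)
    show "A z u" if "z \<in> Z" "u \<in> Up" for z u
      using that spine_adj_iff branch_adj_iff by (auto simp: Up_def)
    show "A z u \<longleftrightarrow> z \<in> spine" if "z \<in> Z" "u \<in> Down" for z u
      using that spine_adj_iff branch_adj_iff by (auto simp: Down_def)
    show "\<not> A z u" if "z \<in> Z" "u \<in> Away" for z u
      using that spine_adj_iff branch_adj_iff adj_b_if_adj_r by (auto simp: Away_def)
    show "A c d" if "c \<in> spine" "d \<in> spine" for c d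
      using that shaft_adj_shaft spine_subset by blast
    show "nbhd_le Z A s c" if "c \<in> spine" "s \<in> Z - spine" "A c s" for c s
      using that tooth_le_shaft[of c s] sym[of c s] Z_subset spine_subset branches_subset
        nbhd_le_subset[OF _ Z_subset] by blast
  qed (use nested_Z Z_subset Up_Up Up_Down Down_Away Away_le_Up in auto)
  show ?thesis using editable_if_nested_glue[OF _ Z_subset nested_glue] v_spine by blast
qed

end

lemma ex_card_le_if_inj_on:
  fixes f :: "'a \<Rightarrow> nat"
  assumes "finite U" "U \<noteq> {}" "inj_on f U" "\<And>u. u \<in> U \<Longrightarrow> 0 < f u"
  obtains u where "u \<in> U" "card U \<le> f u"
proof -
  let ?m = "Max (f ` U)"
  have "f ` U \<subseteq> {1..?m}" using assms by (auto simp: Suc_leI)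
  then have "card (f ` U) \<le> ?m" using card_mono[of "{1..?m}" "f ` U"] by simp
  then have "card U \<le> ?m" using assms(3) by (simp add: card_image)
  moreover have "?m \<in> f ` U" using assms by simp
  ultimately show thesis using that by auto
qed

text \<open>The shaft vertices above \<open>v\<close> are separated from \<open>v\<close> by sets of teeth of different sizes, so one
  of them is separated by many teeth.\<close>

lemma (in comb_graph) ex_shaft_many_teeth:
  assumes v: "v \<in> C" and U: "U \<subseteq> {c \<in> class_reps C (twin V A). nbhd_less V A v c}" "U \<noteq> {}"
  obtains a where "a \<in> U" "card U \<le> card {s \<in> R. A s a \<and> \<not> A s v}"
proof -
  define priv where "priv c = {s \<in> R. A s c \<and> \<not> A s v}" for c
  have finite_priv: "finite (priv c)" for c
    by (rule finite_subset[OF _ finite_verts]) (auto simp: priv_def teeth_def)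
  have UC: "c \<in> C" "nbhd_le V A v c" "\<not> nbhd_le V A c v" if "c \<in> U" for c
    using that U(1) class_reps_subset by (auto simp: nbhd_less_def)
  have less: "card (priv c) < card (priv d)" if cd: "c \<in> U" "d \<in> U" "nbhd_less V A c d" for c d
  proof (rule psubset_card_mono[OF finite_priv])
    obtain s where s: "s \<in> R" "A s d" "\<not> A s c"
      using shaft_separated[OF UC(1) UC(1), of d c] cd by (auto simp: nbhd_less_def)
    then have "\<not> A s v" using nbhd_leD[OF UC(2)[OF cd(1)]] teethD(1) by blast
    then have "s \<in> priv d - priv c" using s by (simp add: priv_def)
    moreover have "priv c \<subseteq> priv d"
      using cd(3) nbhd_leD teethD(1) by (fastforce simp: priv_def nbhd_less_def)
    ultimately show "priv c \<subset> priv d" by blast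
  qed
  have "inj_on (\<lambda>c. card (priv c)) U"
  proof (rule inj_onI)
    fix c d assume cd: "c \<in> U" "d \<in> U" "card (priv c) = card (priv d)"
    then have "twin V A c d"
      using less[of c d] less[of d c] shaft_chain[OF UC(1) UC(1), of c d]
      by (auto simp: twin_def nbhd_less_def)
    moreover have "c \<in> class_reps C (twin V A)" "d \<in> class_reps C (twin V A)" using cd U(1) by auto
    ultimately show "c = d" using class_reps_eqI twin_sym by metis
  qed
  moreover have "0 < card (priv c)" if "c \<in> U" for c
    using shaft_separated[OF UC(1) v UC(3)] that finite_priv by (auto simp: card_gt_0_iff priv_def)
  moreover have "finite U"
    by (rule finite_subset[OF _ finite_verts]) (use UC(1) shaftD(1) in blast)
  ultimately show thesis
    using ex_card_le_if_inj_on[OF _ U(2), of "\<lambda>c. card (priv c)"] that unfolding priv_def by blast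
qed

lemma (in vertex_deletion) editable_if_rule_comb:
  assumes "rule_comb V A k v"
  shows "editable V A k"
proof -
  obtain p q where pq: "comb V A p q" "v \<in> shaft V A p q"
    and up: "4 * k + 1 \<le> card {c \<in> class_reps (shaft V A p q) (twin V A). nbhd_less V A v c}"
    and down: "2 * k + 1 \<le> card {c \<in> class_reps (shaft V A p q) (twin V A). nbhd_less V A c v}"
    using assms by (auto simp: rule_comb_def)
  interpret comb_graph V A p q by unfold_locales (rule pq(1))
  define U where "U = {c \<in> class_reps C (twin V A). nbhd_less V A v c} - X"
  have card_U: "2 * k + 1 \<le> card U"
    using up card_le_card_unaffected[of "{c \<in> class_reps C (twin V A). nbhd_less V A v c}"]
    unfolding U_def by linarith
  then have "U \<noteq> {}" by auto
  then obtain a where top: "a \<in> U" "card U \<le> card {s \<in> R. A s a \<and> \<not> A s v}"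
    using ex_shaft_many_teeth[OF pq(2), of U] unfolding U_def by blast
  obtain r where branch: "r \<in> {s \<in> R. A s a \<and> \<not> A s v} - X"
    using ex_unaffected[of "{s \<in> R. A s a \<and> \<not> A s v}"] top(2) card_U by fastforce
  obtain b where bottom: "b \<in> {c \<in> class_reps C (twin V A). nbhd_less V A c v} - X"
    using ex_unaffected[of "{c \<in> class_reps C (twin V A). nbhd_less V A c v}"] down by fastforce
  have less: "nbhd_less V A b v" "nbhd_less V A v a" using top bottom by (auto simp: U_def)
  interpret comb_segment V A p q a b
  proof
    show "a \<in> C" "b \<in> C" using top bottom class_reps_subset by (auto simp: U_def)
    show "nbhd_le V A b a" using less nbhd_le_trans by (auto simp: nbhd_less_def)
  qed
  interpret comb_segment_deletion V A v B k p q a b r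
  proof
    show "v \<in> spine" using pq(2) less by (simp add: spine_def)
    have "\<not> A r b"
      using branch less(1) nbhd_leD[of V A b v r] teethD(1) by (auto simp: nbhd_less_def)
    then show "r \<in> branches" using branch by (simp add: branches_def)
  qed (use top bottom branch in \<open>auto simp: U_def\<close>)
  show ?thesis by (rule editable)
qed

theorem editable_delete_iff:
  assumes "reflexive_graph V A" "v \<in> V" "deletable V A k v"
  shows "editable (V - {v}) A k \<longleftrightarrow> editable V A k"
proof
  assume "editable (V - {v}) A k"
  then obtain B where "reflexive_graph (V - {v}) B" "nested (V - {v}) B"
    "card (disagreements (V - {v}) A B) \<le> k"
    by (auto simp: editable_def)
  then interpret vertex_deletion V A v B k
    using assms(1,2) by (intro vertex_deletion.intro vertex_deletion_axioms.intro)
  show "editable V A k"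
    using assms(3) editable_if_rule_twin editable_if_rule_module editable_if_rule_comb
    by (auto simp: deletable_def)
qed (rule editable_subset, auto)


section \<open>Laminar families\<close>

definition laminar :: "'a set set \<Rightarrow> bool" where
  "laminar \<F> \<longleftrightarrow> (\<forall>S\<in>\<F>. \<forall>T\<in>\<F>. S \<inter> T = {} \<or> S \<subseteq> T \<or> T \<subseteq> S)"

lemma laminarD: "laminar \<F> \<Longrightarrow> S \<in> \<F> \<Longrightarrow> T \<in> \<F> \<Longrightarrow> S \<inter> T = {} \<or> S \<subseteq> T \<or> T \<subseteq> S"
  by (auto simp: laminar_def)

lemma laminar_image_Diff: "laminar \<F> \<Longrightarrow> laminar ((\<lambda>S. S - {x}) ` \<F> - {{}})"
  unfolding laminar_def by blast

lemma laminar_insert_subset: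
  assumes "laminar \<F>" "S \<in> \<F>" "T \<in> \<F>" "insert x S \<subseteq> insert x T" "insert x S \<in> \<F>"
    and "S \<noteq> {}" "x \<notin> S" "x \<notin> T"
  shows "S = T"
proof -
  have "S \<subseteq> T" using assms by blast
  moreover have "T \<subseteq> S" using laminarD[OF assms(1,5,3)] \<open>S \<subseteq> T\<close> assms(6-8) by blast
  ultimately show ?thesis ..
qed

lemma laminar_insert_unique:
  assumes "laminar \<F>" "S \<in> \<F>" "T \<in> \<F>" "insert x S \<in> \<F>" "insert x T \<in> \<F>"
    and "S \<noteq> {}" "T \<noteq> {}" "x \<notin> S" "x \<notin> T"
  shows "S = T"
proof -
  have "insert x S \<subseteq> insert x T \<or> insert x T \<subseteq> insert x S"
    using laminarD[OF assms(1,4,5)] by blast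
  then show ?thesis
    using laminar_insert_subset[OF assms(1,2,3)] laminar_insert_subset[OF assms(1,3,2)] assms(4-9)
    by metis
qed

lemma card_laminar_le:
  assumes "finite X" "\<F> \<subseteq> Pow X - {{}}" "laminar \<F>"
  shows "card \<F> \<le> 2 * card X"
  using assms
proof (induction X arbitrary: \<F> rule: finite_induct)
  case empty
  then have "\<F> = {}" by auto
  then show ?case by simp
next
  case (insert x X)
  let ?rest = "(\<lambda>S. S - {x}) ` \<F> - {{}}"
  define \<P> where "\<P> = {S \<in> \<F>. x \<notin> S \<and> insert x S \<in> \<F>}"
  have fin: "finite \<F>"
    by (rule finite_subset[OF insert.prems(1)]) (use insert.hyps(1) in simp)
  have "card ?rest \<le> 2 * card X"
    by (rule insert.IH[OF _ laminar_image_Diff[OF insert.prems(2)]]) (use insert.prems(1) in auto)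
  moreover have "card (\<F> - insert {x} \<P>) \<le> card ?rest"
  proof (rule card_inj_on_le[where f = "\<lambda>S. S - {x}"])
    show "inj_on (\<lambda>S. S - {x}) (\<F> - insert {x} \<P>)"
    proof (rule inj_onI)
      fix S T assume ST: "S \<in> \<F> - insert {x} \<P>" "T \<in> \<F> - insert {x} \<P>" "S - {x} = T - {x}"
      then have "S = T \<or> S = insert x T \<and> x \<notin> T \<or> T = insert x S \<and> x \<notin> S" by blast
      then show "S = T" using ST(1,2) by (auto simp: \<P>_def)
    qed
    show "(\<lambda>S. S - {x}) ` (\<F> - insert {x} \<P>) \<subseteq> ?rest" using insert.prems(1) by blast
  qed (use fin in simp)
  moreover have "card (insert {x} \<P>) \<le> 2"
  proof -
    have "S = T" if "S \<in> \<P>" "T \<in> \<P>" for S T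
      using laminar_insert_unique[OF insert.prems(2), of S T x] that insert.prems(1)
      by (auto simp: \<P>_def)
    then have "card \<P> \<le> 1" using fin by (simp add: card_le_Suc0_iff_eq \<P>_def)
    then show ?thesis using fin by (simp add: card_insert_if \<P>_def)
  qed
  then have "card \<F> \<le> card (\<F> - insert {x} \<P>) + 2"
    by (rule card_le_card_Diff[rotated]) (use fin in \<open>simp add: \<P>_def\<close>)
  ultimately show ?case using insert.hyps by simp
qed

lemma card_UN_le_mult:
  assumes "finite I" "card I \<le> m" "\<And>i. i \<in> I \<Longrightarrow> card (A i) \<le> n"
  shows "card (\<Union>i\<in>I. A i) \<le> m * n"
proof -
  have "card (\<Union>i\<in>I. A i) \<le> (\<Sum>i\<in>I. card (A i))" by (rule card_UN_le[OF assms(1)])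
  also have "\<dots> \<le> card I * n" using sum_bounded_above[of I "\<lambda>i. card (A i)" n] assms(3) by simp
  also have "\<dots> \<le> m * n" by (rule mult_le_mono1[OF assms(2)])
  finally show ?thesis .
qed

lemma card_fibres_le:
  assumes "finite W" "\<And>w. w \<in> W \<Longrightarrow> card {u \<in> W. f u = f w} \<le> m"
  shows "card W \<le> card (f ` W) * m"
proof -
  have "card (\<Union>y\<in>f ` W. {u \<in> W. f u = y}) \<le> card (f ` W) * m"
    by (rule card_UN_le_mult) (use assms in auto)
  moreover have "(\<Union>y\<in>f ` W. {u \<in> W. f u = y}) = W" by auto
  ultimately show ?thesis by simp
qed


section \<open>The forest of a nested graph\<close>

text \<open>Inclusion of closed neighbourhoods is a forest preorder with the roots on top.\<close>

locale nested_graph = reflexive_graph V B for V :: "'a::linorder set" and B +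
  assumes nested: "nested V B"
begin

abbreviation below (infix "\<sqsubseteq>" 50) where "u \<sqsubseteq> v \<equiv> nbhd_le V B u v"
abbreviation strictly_below (infix "\<sqsubset>" 50) where "u \<sqsubset> v \<equiv> nbhd_less V B u v"

lemmas below_trans = nbhd_le_trans[of V B]

lemma adj_iff_comparable: "u \<in> V \<Longrightarrow> v \<in> V \<Longrightarrow> B u v \<longleftrightarrow> u \<sqsubseteq> v \<or> v \<sqsubseteq> u"
  using nested adj_if_nbhd_le[of u v] adj_if_nbhd_le[of v u] commute[of u v]
  by (auto simp: nested_def)

lemma comparable_if_common_lower_bound:
  assumes "x \<in> V" "u \<in> V" "v \<in> V" "x \<sqsubseteq> u" "x \<sqsubseteq> v"
  shows "u \<sqsubseteq> v \<or> v \<sqsubseteq> u"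
proof -
  have "B u x" using assms adj_iff_comparable by blast
  then have "B u v" using nbhd_leD[OF assms(5)] assms(2) by blast
  then show ?thesis using adj_iff_comparable assms by blast
qed

lemma ex_incomparable_below:
  assumes "u \<in> V" "v \<in> V" "u \<sqsubset> v"
  obtains z where "z \<in> V" "z \<sqsubseteq> v" "\<not> z \<sqsubseteq> u" "\<not> u \<sqsubseteq> z"
proof -
  obtain z where z: "z \<in> V" "B z v" "\<not> B z u"
    using assms(3) by (auto simp: nbhd_less_def nbhd_le_def)
  then have "\<not> z \<sqsubseteq> u" "\<not> u \<sqsubseteq> z" using adj_iff_comparable assms by blast+
  moreover have "z \<sqsubseteq> v"
    using z adj_iff_comparable[of z v] assms calculation below_trans[of u v z]
    by (auto simp: nbhd_less_def)
  ultimately show thesis using that z(1) by blast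
qed

lemma
  assumes "S \<subseteq> V" "S \<noteq> {}"
  shows ex_maximal: "\<exists>m\<in>S. \<forall>z\<in>S. m \<sqsubseteq> z \<longrightarrow> z \<sqsubseteq> m"
    and ex_minimal: "\<exists>m\<in>S. \<forall>z\<in>S. z \<sqsubseteq> m \<longrightarrow> m \<sqsubseteq> z"
proof -
  have order: "finite S" "asymp_on S (\<sqsubset>)" "transp_on S (\<sqsubset>)"
    using finite_subset[OF assms(1) finite_verts] nbhd_less_trans
    by (auto simp: asymp_on_def transp_on_def) (simp_all add: nbhd_less_def)
  show "\<exists>m\<in>S. \<forall>z\<in>S. m \<sqsubseteq> z \<longrightarrow> z \<sqsubseteq> m"
    using Finite_Set.bex_max_element[OF order assms(2)] nbhd_le_refl unfolding nbhd_less_def by metis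
  show "\<exists>m\<in>S. \<forall>z\<in>S. z \<sqsubseteq> m \<longrightarrow> m \<sqsubseteq> z"
    using Finite_Set.bex_min_element[OF order assms(2)] nbhd_le_refl unfolding nbhd_less_def by metis
qed

lemma laminar_below:
  assumes "I \<subseteq> V" "W \<subseteq> V"
  shows "laminar ((\<lambda>v. {x \<in> I. x \<sqsubseteq> v}) ` W)"
proof -
  have "{x \<in> I. x \<sqsubseteq> u} \<inter> {x \<in> I. x \<sqsubseteq> v} = {} \<or> {x \<in> I. x \<sqsubseteq> u} \<subseteq> {x \<in> I. x \<sqsubseteq> v} \<or>
      {x \<in> I. x \<sqsubseteq> v} \<subseteq> {x \<in> I. x \<sqsubseteq> u}" if "u \<in> W" "v \<in> W" for u v
    using comparable_if_common_lower_bound[of _ u v] below_trans that assms by blast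
  then show ?thesis by (auto simp: laminar_def)
qed

lemma ex_increasing_enumeration:
  assumes R: "R \<subseteq> V" "\<And>c d. c \<in> R \<Longrightarrow> d \<in> R \<Longrightarrow> c \<noteq> d \<Longrightarrow> c \<sqsubset> d \<or> d \<sqsubset> c"
  obtains f where "bij_betw f {..<card R} R" "\<And>i j. i < j \<Longrightarrow> j < card R \<Longrightarrow> f i \<sqsubset> f j"
proof -
  define height where "height c = card {z \<in> V. z \<sqsubseteq> c}" for c
  have mono: "height c < height d" if "c \<in> R" "d \<in> R" "c \<sqsubset> d" for c d
    unfolding height_def
  proof (rule psubset_card_mono)
    have "c \<sqsubseteq> d" "\<not> d \<sqsubseteq> c" "d \<in> V" using that R(1) by (auto simp: nbhd_less_def)
    then have "d \<in> {z \<in> V. z \<sqsubseteq> d} - {z \<in> V. z \<sqsubseteq> c}" by (simp add: nbhd_le_refl)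
    moreover have "{z \<in> V. z \<sqsubseteq> c} \<subseteq> {z \<in> V. z \<sqsubseteq> d}" using below_trans[OF _ \<open>c \<sqsubseteq> d\<close>] by blast
    ultimately show "{z \<in> V. z \<sqsubseteq> c} \<subset> {z \<in> V. z \<sqsubseteq> d}" by blast
  qed (use finite_verts in simp)
  have inj: "inj_on height R" using mono R(2) by (metis inj_onI less_irrefl)
  have "finite (height ` R)" using finite_subset[OF R(1) finite_verts] by simp
  then obtain h where h: "bij_betw h {..<card R} (height ` R)" "strict_mono_on {..<card R} h"
    using ex_bij_betw_strict_mono_card card_image[OF inj] by metis
  let ?f = "the_inv_into R height \<circ> h"
  have bij: "bij_betw ?f {..<card R} R"
    by (rule bij_betw_trans[OF h(1) bij_betw_the_inv_into[OF inj_on_imp_bij_betw[OF inj]]])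
  have height_f: "height (?f i) = h i" if "i < card R" for i
    using that f_the_inv_into_f[OF inj] bij_betwE[OF h(1)] by simp
  have "?f i \<sqsubset> ?f j" if "i < j" "j < card R" for i j
  proof -
    have "?f i \<in> R" "?f j \<in> R" using bij that by (auto simp: bij_betw_def)
    moreover have "height (?f i) < height (?f j)"
      using strict_mono_onD[OF h(2)] that height_f by simp
    ultimately show ?thesis using R(2)[of "?f i" "?f j"] mono[of "?f j" "?f i"] by fastforce
  qed
  then show thesis using that bij by blast
qed

definition down_closed :: "'a set \<Rightarrow> bool" where
  "down_closed W \<longleftrightarrow> (\<forall>w\<in>W. \<forall>y\<in>V. y \<sqsubseteq> w \<longrightarrow> y \<in> W)"

lemma down_closedD: "down_closed W \<Longrightarrow> w \<in> W \<Longrightarrow> y \<in> V \<Longrightarrow> y \<sqsubseteq> w \<Longrightarrow> y \<in> W"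
  by (auto simp: down_closed_def)

definition leaves :: "'a set \<Rightarrow> 'a set" where
  "leaves W = class_reps {r \<in> W. \<forall>y\<in>V. y \<sqsubseteq> r \<longrightarrow> r \<sqsubseteq> y} (twin V B)"

lemma leaves_subset: "leaves W \<subseteq> W"
  using class_reps_subset by (fastforce simp: leaves_def)

lemma leaf_minimal: "r \<in> leaves W \<Longrightarrow> y \<in> V \<Longrightarrow> y \<sqsubseteq> r \<Longrightarrow> r \<sqsubseteq> y"
  using class_reps_subset by (fastforce simp: leaves_def)

lemma leaves_independent:
  assumes "W \<subseteq> V" "r \<in> leaves W" "s \<in> leaves W" "r \<sqsubseteq> s"
  shows "r = s"
proof -
  have "s \<sqsubseteq> r" using leaf_minimal[OF assms(3) _ assms(4)] leaves_subset assms by blast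
  then have "twin V B r s" "twin V B s r" using assms(4) by (simp_all add: twin_def)
  then show ?thesis using class_reps_eqI assms(2,3) unfolding leaves_def by blast
qed

lemma ex_leaf_below:
  assumes W: "W \<subseteq> V" "down_closed W" and v: "v \<in> W"
  obtains r where "r \<in> leaves W" "r \<sqsubseteq> v"
proof -
  let ?minimal = "{r \<in> W. \<forall>y\<in>V. y \<sqsubseteq> r \<longrightarrow> r \<sqsubseteq> y}"
  have "v \<in> {y \<in> V. y \<sqsubseteq> v}" using v W(1) by (auto intro: nbhd_le_refl)
  then obtain m where m: "m \<in> V" "m \<sqsubseteq> v" "\<And>y. y \<in> V \<Longrightarrow> y \<sqsubseteq> v \<Longrightarrow> y \<sqsubseteq> m \<Longrightarrow> m \<sqsubseteq> y"
    using ex_minimal[of "{y \<in> V. y \<sqsubseteq> v}"] by auto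
  then have "m \<in> ?minimal" using down_closedD[OF W(2) v] below_trans[OF _ m(2)] by simp
  moreover have "finite ?minimal" using finite_subset[OF W(1) finite_verts] by simp
  ultimately obtain r where "r \<in> leaves W" "twin V B r m"
    using ex_class_rep[OF _ twin_equivalence(1,3), of ?minimal m V B] unfolding leaves_def by auto
  then show thesis using that below_trans[OF _ m(2)] by (auto simp: twin_def)
qed

lemma below_if_same_leaves:
  assumes W: "W \<subseteq> V" "down_closed W" and uw: "u \<in> W" "w \<in> W"
    and same: "{r \<in> leaves W. r \<sqsubseteq> u} = {r \<in> leaves W. r \<sqsubseteq> w}"
  shows "u \<sqsubseteq> w"
proof (rule ccontr)
  assume "\<not> u \<sqsubseteq> w"
  obtain r where r: "r \<in> leaves W" "r \<sqsubseteq> u" using ex_leaf_below[OF W uw(1)] .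
  then have "r \<sqsubseteq> w" using same by blast
  then have "w \<sqsubset> u"
    using comparable_if_common_lower_bound[of r u w] r leaves_subset uw W(1) \<open>\<not> u \<sqsubseteq> w\<close>
    by (auto simp: nbhd_less_def)
  then obtain z where z: "z \<in> V" "z \<sqsubseteq> u" "\<not> z \<sqsubseteq> w" "\<not> w \<sqsubseteq> z"
    using ex_incomparable_below[of w u] uw W(1) by blast
  then obtain s where s: "s \<in> leaves W" "s \<sqsubseteq> z"
    using ex_leaf_below[OF W] down_closedD[OF W(2) uw(1)] by blast
  then have "s \<sqsubseteq> w" using same z(2) below_trans by blast
  then show False
    using comparable_if_common_lower_bound[of s z w] s leaves_subset uw W(1) z by blast
qed

end


section \<open>Size of irreducible yes-instances\<close>

locale irreducible_edition = nested_graph V B + A: reflexive_graph V A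
  for V :: "'a::linorder set" and A B +
  fixes k :: nat
  assumes card_affected: "card (affected V A B) \<le> 2 * k"
    and irreducible: "v \<in> V \<Longrightarrow> \<not> deletable V A k v"
begin

abbreviation X :: "'a set" where
  "X \<equiv> affected V A B"

lemma X_subset: "X \<subseteq> V"
  by (rule affected_subset)

lemma A_iff_comparable:
  assumes "u \<in> V - X" "w \<in> V"
  shows "A u w \<longleftrightarrow> u \<sqsubseteq> w \<or> w \<sqsubseteq> u" "A w u \<longleftrightarrow> u \<sqsubseteq> w \<or> w \<sqsubseteq> u"
  using unaffectedD[OF assms] adj_iff_comparable[of u w] A.commute[of u w] assms by blast+

lemma nbhd_le_A_iff:
  assumes "u \<in> V - X" "v \<in> V - X"
  shows "nbhd_le V A u v \<longleftrightarrow> u \<sqsubseteq> v"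
proof -
  have "A z u \<longleftrightarrow> B z u" "A z v \<longleftrightarrow> B z v" if "z \<in> V" for z
    using A_iff_comparable(2)[OF assms(1) that] A_iff_comparable(2)[OF assms(2) that]
      adj_iff_comparable[OF that, of u] adj_iff_comparable[OF that, of v] assms by auto
  then show ?thesis by (simp add: nbhd_le_def)
qed

lemma card_twin_class_le:
  assumes "u \<in> V - X"
  shows "card {w \<in> V - X. twin V B w u} \<le> 2 * k + 1"
proof -
  let ?twins = "{w \<in> V. w \<noteq> u \<and> twin V A w u}"
  have "card ?twins \<le> 2 * k"
    using irreducible[of u] assms by (simp add: deletable_def rule_twin_def)
  moreover have "card {w \<in> V - X. twin V B w u} \<le> card (insert u ?twins)"
    by (rule card_mono) (use finite_verts nbhd_le_A_iff assms in \<open>auto simp: twin_def\<close>)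
  moreover have "card (insert u ?twins) \<le> card ?twins + 1"
    using finite_verts by (simp add: card_insert_if)
  ultimately show ?thesis by linarith
qed

lemma card_le_card_image:
  assumes W: "W \<subseteq> V - X" and f: "\<And>u w. u \<in> W \<Longrightarrow> w \<in> W \<Longrightarrow> f u = f w \<Longrightarrow> u \<sqsubseteq> w"
  shows "card W \<le> card (f ` W) * (2 * k + 1)"
proof (rule card_fibres_le)
  show "finite W" using finite_subset[OF _ finite_verts] W by blast
  fix w assume w: "w \<in> W"
  have "card {u \<in> W. f u = f w} \<le> card {u \<in> V - X. twin V B u w}"
    by (rule card_mono) (use finite_verts W f w in \<open>auto simp: twin_def\<close>)
  also have "\<dots> \<le> 2 * k + 1" using card_twin_class_le w W by blast
  finally show "card {u \<in> W. f u = f w} \<le> 2 * k + 1" .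
qed

lemma card_le_card_leaves:
  assumes W: "W \<subseteq> V - X" "down_closed W"
  shows "card W \<le> 2 * card (leaves W) * (2 * k + 1)"
proof -
  let ?f = "\<lambda>v. {r \<in> leaves W. r \<sqsubseteq> v}"
  have WV: "W \<subseteq> V" using W(1) by blast
  have "card W \<le> card (?f ` W) * (2 * k + 1)"
    by (rule card_le_card_image[OF W(1) below_if_same_leaves[OF WV W(2)]])
  also have "\<dots> \<le> 2 * card (leaves W) * (2 * k + 1)"
  proof (rule mult_le_mono1[OF card_laminar_le])
    show "finite (leaves W)"
      using finite_subset[OF _ finite_verts] leaves_subset WV by blast
    show "?f ` W \<subseteq> Pow (leaves W) - {{}}" using ex_leaf_below[OF WV W(2)] by blast
    show "laminar (?f ` W)" using laminar_below leaves_subset WV by blast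
  qed
  finally show ?thesis .
qed


subsection \<open>Modules of unaffected vertices\<close>

lemma common_nbhd_iff:
  assumes "x \<in> V - X" "w \<in> V - X"
  shows "z \<in> common_nbhd V A x w \<longleftrightarrow> z \<in> V \<and> (x \<sqsubseteq> z \<or> z \<sqsubseteq> x) \<and> (w \<sqsubseteq> z \<or> z \<sqsubseteq> w)"
  using A_iff_comparable(2) assms by (auto simp: common_nbhd_def)

lemma is_module_A_iff:
  assumes "M \<subseteq> V - X"
  shows "is_module V A K M \<longleftrightarrow>
    M \<subseteq> V - K \<and> (\<forall>z\<in>M. \<forall>y\<in>V - M. (z \<sqsubseteq> y \<or> y \<sqsubseteq> z) \<longleftrightarrow> y \<in> K)"
  using A_iff_comparable(1) assms unfolding is_module_def by (simp add: subset_iff)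

lemma nested_unaffected:
  assumes "N \<subseteq> V - X"
  shows "nested N A"
  unfolding nested_def
proof (intro ballI impI)
  fix z y assume zy: "z \<in> N" "y \<in> N" "A z y"
  then have "z \<in> V - X" "y \<in> V - X" using assms by auto
  then have "nbhd_le V A z y \<or> nbhd_le V A y z"
    using A_iff_comparable(1) nbhd_le_A_iff zy(3) by blast
  then show "nbhd_le N A z y \<or> nbhd_le N A y z"
    using nbhd_le_subset[of V A _ _ N] assms by blast
qed

lemma is_module_component:
  assumes M: "M \<subseteq> V - X" "is_module V A K M"
    and u: "u \<in> M" "\<And>z. z \<in> M \<Longrightarrow> u \<sqsubseteq> z \<Longrightarrow> z \<sqsubseteq> u"
  defines "N \<equiv> {z \<in> V - K. A z u}"
  shows "is_module V A K N" "nested N A"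
proof -
  have M_sub: "M \<subseteq> V - K" and M_iff: "\<forall>z\<in>M. \<forall>y\<in>V - M. (z \<sqsubseteq> y \<or> y \<sqsubseteq> z) \<longleftrightarrow> y \<in> K"
    using M is_module_A_iff by blast+
  have uX: "u \<in> V - X" using u(1) M(1) by blast
  have N: "z \<in> M" "z \<sqsubseteq> u" if "z \<in> N" for z
  proof -
    have "z \<in> V - K" "u \<sqsubseteq> z \<or> z \<sqsubseteq> u" using that A_iff_comparable(2)[OF uX] by (auto simp: N_def)
    then show "z \<in> M" using M_iff u(1) by blast
    then show "z \<sqsubseteq> u" using \<open>u \<sqsubseteq> z \<or> z \<sqsubseteq> u\<close> u(2) by blast
  qed
  have "A z y \<longleftrightarrow> y \<in> K" if "z \<in> N" "y \<in> V - N" for z y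
  proof (cases "y \<in> M")
    case True
    have "\<not> (u \<sqsubseteq> y \<or> y \<sqsubseteq> u)"
      using that(2) True M_sub A_iff_comparable(2)[OF uX, of y] by (auto simp: N_def)
    then have "\<not> (z \<sqsubseteq> y \<or> y \<sqsubseteq> z)"
      using N(2)[OF that(1)] below_trans[of y z u] comparable_if_common_lower_bound[of z u y]
        that uX N(1)[OF that(1)] M_sub by blast
    then show ?thesis using A_iff_comparable(1)[of z y] N(1)[OF that(1)] M(1) True M_sub by blast
  next
    case False
    then show ?thesis using M(2) N(1)[OF that(1)] that(2) by (simp add: is_module_def)
  qed
  then show "is_module V A K N" by (auto simp: is_module_def N_def)
  show "nested N A" by (rule nested_unaffected) (use N(1) M(1) in blast)
qed

lemma module_subset_module_over:
  assumes "M \<subseteq> V - X" "is_module V A K M"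
  shows "M \<subseteq> module_over V A K"
proof
  fix y assume y: "y \<in> M"
  have MV: "M \<subseteq> V - K" using assms(2) by (simp add: is_module_def)
  have "y \<in> {u \<in> M. y \<sqsubseteq> u}" using y nbhd_le_refl by simp
  moreover have "{u \<in> M. y \<sqsubseteq> u} \<subseteq> V" using MV by blast
  ultimately obtain u where u: "u \<in> M" "y \<sqsubseteq> u" "\<And>z. z \<in> M \<Longrightarrow> y \<sqsubseteq> z \<Longrightarrow> u \<sqsubseteq> z \<Longrightarrow> z \<sqsubseteq> u"
    using ex_maximal[of "{u \<in> M. y \<sqsubseteq> u}"] by auto
  have "z \<sqsubseteq> u" if "z \<in> M" "u \<sqsubseteq> z" for z
    using u(3)[OF that(1) below_trans[OF u(2) that(2)] that(2)] .
  then have "is_module V A K {z \<in> V - K. A z u}" "nested {z \<in> V - K. A z u} A"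
    using is_module_component[OF assms u(1)] by blast+
  moreover have "A y u" using A_iff_comparable(2)[of u y] u(1,2) assms(1) y by blast
  ultimately show "y \<in> module_over V A K"
    using y u(1) MV unfolding module_over_def by blast
qed

lemma simplicial_if_minimal:
  assumes r: "r \<in> V - X" "\<And>y. y \<in> V \<Longrightarrow> y \<sqsubseteq> r \<Longrightarrow> r \<sqsubseteq> y" "r \<in> attached V A K"
    and unaffected: "\<And>z. z \<in> V - K \<Longrightarrow> r \<sqsubseteq> z \<Longrightarrow> z \<notin> X"
  shows "r \<in> simplicial_verts (attached V A K) A"
  unfolding simplicial_verts_def
proof (intro CollectI conjI ballI impI)
  fix z y assume zy: "z \<in> attached V A K" "y \<in> attached V A K" "A z r" "A y r"
  then have mem: "z \<in> V - K" "y \<in> V - K" by (auto simp: attached_def)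
  have "r \<sqsubseteq> z" "r \<sqsubseteq> y" using A_iff_comparable(2)[OF r(1)] r(2) zy mem by blast+
  then have "z \<sqsubseteq> y \<or> y \<sqsubseteq> z" "z \<in> V - X"
    using comparable_if_common_lower_bound[of r z y] r(1) mem unaffected by auto
  then show "A z y" using A_iff_comparable(1) mem by blast
qed (rule r(3))

lemma card_simplicial_reps_le:
  assumes xw: "x \<in> V" "w \<in> V" and K: "K = common_nbhd V A x w"
    and M: "M \<subseteq> V - X" "is_module V A K M" "2 * k + 1 < card M"
  shows "card (class_reps (simplicial_verts (attached V A K) A) A) \<le> 2 * k + 2"
proof -
  have M_sub: "M \<subseteq> module_over V A K" by (rule module_subset_module_over[OF M(1,2)])
  have sub: "module_over V A K \<subseteq> V"
    using is_module_module_over[of V A K] by (auto simp: is_module_def)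
  then have "2 * k + 2 \<le> card (module_over V A K)"
    using M(3) card_mono[OF finite_subset[OF sub finite_verts] M_sub] by linarith
  moreover obtain v where "v \<in> M" using M(3) by fastforce
  then have "v \<in> module_over V A K" "\<not> rule_module V A k v"
    using M_sub sub irreducible by (auto simp: deletable_def)
  ultimately have "\<not> 2 * k + 3 \<le> card (class_reps (simplicial_verts (attached V A K) A) A)"
    using xw unfolding rule_module_def K Let_def by blast
  then show ?thesis by linarith
qed

lemma card_leaves_le_card_simplicial_reps:
  assumes W: "W \<subseteq> V - X" "W \<subseteq> V - K" and K: "K \<subseteq> V"
    and comparable: "\<And>r z. r \<in> W \<Longrightarrow> z \<in> K \<Longrightarrow> r \<sqsubseteq> z \<or> z \<sqsubseteq> r"
    and unaffected: "\<And>r z. r \<in> W \<Longrightarrow> z \<in> V - K \<Longrightarrow> r \<sqsubseteq> z \<Longrightarrow> z \<notin> X"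
  shows "card (leaves W) \<le> card (class_reps (simplicial_verts (attached V A K) A) A)"
proof (rule card_independent_le_class_reps[OF _ A.simplicial_equivalence[OF attached_subset]])
  have W_attached: "W \<subseteq> attached V A K"
    using W K comparable A_iff_comparable(2) unfolding attached_def by blast
  show "leaves W \<subseteq> simplicial_verts (attached V A K) A"
  proof
    fix r assume r: "r \<in> leaves W"
    then have rW: "r \<in> W" using leaves_subset by blast
    show "r \<in> simplicial_verts (attached V A K) A"
      by (rule simplicial_if_minimal)
        (use rW W(1) W_attached unaffected[OF rW] leaf_minimal[OF r] in blast)+
  qed
  show "r = s" if "r \<in> leaves W" "s \<in> leaves W" "A r s" for r s
  proof -
    have "r \<in> V - X" "s \<in> V" "W \<subseteq> V" using that leaves_subset W(1) by blast+
    then show ?thesis using A_iff_comparable(1) that leaves_independent[of W] by metis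
  qed
  show "finite (simplicial_verts (attached V A K) A)"
    by (meson attached_subset finite_subset finite_verts simplicial_verts_subset)
qed

text \<open>Were the module and the down-closed set both large, the leaves of the latter would make the
  vertices of the former deletable.\<close>

lemma card_down_closed_le:
  assumes xw: "x \<in> V" "w \<in> V" and K: "K = common_nbhd V A x w"
    and M: "M \<subseteq> V - X" "is_module V A K M" "2 * k + 1 < card M"
    and W: "W \<subseteq> V - X" "W \<subseteq> V - K" "down_closed W"
    and comparable: "\<And>r z. r \<in> W \<Longrightarrow> z \<in> K \<Longrightarrow> r \<sqsubseteq> z \<or> z \<sqsubseteq> r"
    and unaffected: "\<And>r z. r \<in> W \<Longrightarrow> z \<in> V - K \<Longrightarrow> r \<sqsubseteq> z \<Longrightarrow> z \<notin> X"
  shows "card W \<le> (4 * k + 4) * (2 * k + 1)"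
proof -
  have "card (leaves W) \<le> card (class_reps (simplicial_verts (attached V A K) A) A)"
    by (rule card_leaves_le_card_simplicial_reps[OF W(1,2) _ comparable unaffected])
      (auto simp: K common_nbhd_def)
  also have "\<dots> \<le> 2 * k + 2" by (rule card_simplicial_reps_le[OF xw K M])
  finally have "card (leaves W) \<le> 2 * k + 2" .
  then have "2 * card (leaves W) * (2 * k + 1) \<le> (4 * k + 4) * (2 * k + 1)"
    by (intro mult_le_mono1) linarith
  then show ?thesis using card_le_card_leaves[OF W(1,3)] by linarith
qed


subsection \<open>Unmarked vertices\<close>

text \<open>A vertex is marked if some affected vertex lies weakly below it. The unmarked vertices with
  a given set \<open>Q\<close> of marked ancestors form a union of complete subtrees hanging off the chain \<open>Q\<close>.\<close>

definition affected_below :: "'a \<Rightarrow> 'a set" where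
  "affected_below v = {x \<in> X. x \<sqsubseteq> v}"

definition marked_above :: "'a \<Rightarrow> 'a set" where
  "marked_above v = {u \<in> V. v \<sqsubseteq> u \<and> affected_below u \<noteq> {}}"

definition hanging :: "'a set \<Rightarrow> 'a set" where
  "hanging Q = {v \<in> V. affected_below v = {} \<and> marked_above v = Q}"

definition upset :: "'a \<Rightarrow> 'a set" where
  "upset a = {y \<in> V. a \<sqsubseteq> y}"

lemma affected_below_mono: "u \<sqsubseteq> v \<Longrightarrow> affected_below u \<subseteq> affected_below v"
  using below_trans by (auto simp: affected_below_def)

lemma affected_below_self: "x \<in> X \<Longrightarrow> x \<in> affected_below x"
  by (simp add: affected_below_def nbhd_le_refl)

lemma affected_below_subset: "affected_below v \<subseteq> X"
  by (auto simp: affected_below_def)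

lemma upset_eq_if_twin: "twin V B a b \<Longrightarrow> upset a = upset b"
  using below_trans[of a b] below_trans[of b a] by (auto simp: twin_def upset_def)

lemma card_affected_below_le: "card (affected_below ` V - {{}}) \<le> 4 * k"
proof -
  have "card (affected_below ` V - {{}}) \<le> 2 * card X"
  proof (rule card_laminar_le)
    show "finite X" by (rule finite_subset[OF X_subset finite_verts])
    show "affected_below ` V - {{}} \<subseteq> Pow X - {{}}" using affected_below_subset by auto
    have "laminar (affected_below ` V)"
      using laminar_below[OF X_subset order_refl] by (simp add: affected_below_def[abs_def])
    then show "laminar (affected_below ` V - {{}})" unfolding laminar_def by blast
  qed
  then show ?thesis using card_affected by simp
qed

lemma hanging_subset: "hanging Q \<subseteq> V - X"
  using affected_below_self by (auto simp: hanging_def)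

lemma finite_hanging: "finite (hanging Q)"
  using finite_verts by (simp add: hanging_def)

lemma hanging_below: "v \<in> hanging Q \<Longrightarrow> q \<in> Q \<Longrightarrow> v \<sqsubseteq> q"
  by (auto simp: hanging_def marked_above_def)

lemma hanging_disjoint: "hanging Q \<inter> Q = {}"
  by (auto simp: hanging_def marked_above_def)

lemma subset_if_mem_hanging: "v \<in> hanging Q \<Longrightarrow> Q \<subseteq> V"
  by (auto simp: hanging_def marked_above_def)

lemma hanging_down_closed: "down_closed (hanging Q)"
  unfolding down_closed_def
proof (intro ballI impI)
  fix v y assume v: "v \<in> hanging Q" and y: "y \<in> V" "y \<sqsubseteq> v"
  have y_unmarked: "affected_below y = {}" "v \<in> V"
    using affected_below_mono[OF y(2)] v by (auto simp: hanging_def)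
  have "v \<sqsubseteq> u" if "u \<in> V" "y \<sqsubseteq> u" "affected_below u \<noteq> {}" for u
    using comparable_if_common_lower_bound[OF y(1) \<open>v \<in> V\<close> that(1) y(2) that(2)]
      affected_below_mono[of u v] that(3) v by (auto simp: hanging_def)
  then have "marked_above y = marked_above v"
    using below_trans[OF y(2)] by (auto simp: marked_above_def)
  then show "y \<in> hanging Q" using v y(1) y_unmarked by (simp add: hanging_def)
qed

lemma hanging_neighbour:
  assumes v: "v \<in> hanging Q" and y: "y \<in> V" "v \<sqsubseteq> y \<or> y \<sqsubseteq> v"
  shows "y \<in> hanging Q \<union> Q"
proof (cases "v \<sqsubseteq> y")
  case False
  then show ?thesis using down_closedD[OF hanging_down_closed v y(1)] y(2) by blast
next
  case True
  show ?thesis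
  proof (cases "affected_below y = {}")
    case True
    then have "y \<in> hanging (marked_above y)" using y(1) by (simp add: hanging_def)
    then have "v \<in> hanging (marked_above y)"
      using down_closedD[OF hanging_down_closed] v \<open>v \<sqsubseteq> y\<close> by (auto simp: hanging_def)
    then show ?thesis using v True y(1) by (simp add: hanging_def)
  next
    case False
    then show ?thesis using v \<open>v \<sqsubseteq> y\<close> y(1) by (auto simp: hanging_def marked_above_def)
  qed
qed

lemma is_module_hanging: "is_module V A Q (hanging Q)"
  unfolding is_module_A_iff[OF hanging_subset]
proof (intro conjI ballI iffI)
  show "hanging Q \<subseteq> V - Q" using hanging_disjoint hanging_subset by blast
  fix z y assume zy: "z \<in> hanging Q" "y \<in> V - hanging Q"
  show "y \<in> Q" if "z \<sqsubseteq> y \<or> y \<sqsubseteq> z" using hanging_neighbour[OF zy(1)] zy(2) that by blast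
  show "z \<sqsubseteq> y \<or> y \<sqsubseteq> z" if "y \<in> Q" using hanging_below[OF zy(1) that] ..
qed

definition core :: "'a set \<Rightarrow> 'a set" where
  "core Q = {u \<in> hanging Q. \<forall>z\<in>hanging Q. u \<sqsubseteq> z \<or> z \<sqsubseteq> u}"

lemma core_subset: "core Q \<subseteq> hanging Q"
  by (auto simp: core_def)

lemma core_comparable: "u \<in> core Q \<Longrightarrow> z \<in> hanging Q \<Longrightarrow> u \<sqsubseteq> z \<or> z \<sqsubseteq> u"
  by (simp add: core_def)

lemma core_twins:
  assumes "u \<in> core Q" "w \<in> core Q"
  shows "u \<sqsubseteq> w"
proof (rule ccontr)
  assume not_le: "\<not> u \<sqsubseteq> w"
  have uw: "u \<in> hanging Q" "w \<in> hanging Q" "u \<in> V" "w \<in> V"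
    using assms by (auto simp: core_def hanging_def)
  then have "w \<sqsubset> u" using assms not_le by (auto simp: core_def nbhd_less_def)
  then obtain z where z: "z \<in> V" "z \<sqsubseteq> u" "\<not> z \<sqsubseteq> w" "\<not> w \<sqsubseteq> z"
    using ex_incomparable_below uw by blast
  then have "z \<in> hanging Q" using down_closedD[OF hanging_down_closed uw(1)] by blast
  then show False using z assms(2) by (auto simp: core_def)
qed

lemma card_core_le: "card (core Q) \<le> 2 * k + 1"
proof (cases "core Q = {}")
  case False
  then obtain u where u: "u \<in> core Q" by blast
  have "card (core Q) \<le> card {w \<in> V - X. twin V B w u}"
    using core_twins u core_subset[of Q] hanging_subset[of Q] finite_verts
    by (intro card_mono) (auto simp: twin_def)
  also have "\<dots> \<le> 2 * k + 1"
    using card_twin_class_le u core_subset hanging_subset by blast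
  finally show ?thesis .
qed simp

lemma down_closed_noncore: "down_closed (hanging Q - core Q)"
  unfolding down_closed_def
proof (intro ballI impI)
  fix z y assume z: "z \<in> hanging Q - core Q" and y: "y \<in> V" "y \<sqsubseteq> z"
  then have yQ: "y \<in> hanging Q" using down_closedD[OF hanging_down_closed] by blast
  have "z \<in> core Q" if "y \<in> core Q"
    unfolding core_def
  proof (intro CollectI conjI ballI)
    fix t assume t: "t \<in> hanging Q"
    then have "y \<sqsubseteq> t \<or> t \<sqsubseteq> y" using that by (simp add: core_def)
    then show "z \<sqsubseteq> t \<or> t \<sqsubseteq> z"
      using comparable_if_common_lower_bound[of y z t] below_trans[of t y z] y z t hanging_subset
      by blast
  qed (use z in blast)
  then show "y \<in> hanging Q - core Q" using z yQ by blast
qed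

lemma ex_incomparable_roots:
  assumes "hanging Q \<noteq> core Q"
  obtains x w where "x \<in> hanging Q - core Q" "w \<in> hanging Q - core Q" "\<not> x \<sqsubseteq> w" "\<not> w \<sqsubseteq> x"
    "\<And>z. z \<in> hanging Q - core Q \<Longrightarrow> x \<sqsubseteq> z \<Longrightarrow> z \<sqsubseteq> x" "\<And>z. z \<in> hanging Q - core Q \<Longrightarrow> w \<sqsubseteq> z \<Longrightarrow> z \<sqsubseteq> w"
proof -
  let ?N = "hanging Q - core Q"
  have NV: "?N \<subseteq> V" and "?N \<noteq> {}" using hanging_subset assms by (auto simp: core_def)
  then obtain x where x: "x \<in> ?N" "\<And>z. z \<in> ?N \<Longrightarrow> x \<sqsubseteq> z \<Longrightarrow> z \<sqsubseteq> x"
    using ex_maximal[of ?N] by blast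
  then obtain w0 where w0: "w0 \<in> ?N" "\<not> x \<sqsubseteq> w0" "\<not> w0 \<sqsubseteq> x"
    by (auto simp: core_def)
  have "{w \<in> ?N. w0 \<sqsubseteq> w} \<subseteq> V" "w0 \<in> {w \<in> ?N. w0 \<sqsubseteq> w}" using NV w0(1) nbhd_le_refl by auto
  then obtain w where w: "w \<in> ?N" "w0 \<sqsubseteq> w" "\<And>z. z \<in> ?N \<Longrightarrow> w0 \<sqsubseteq> z \<Longrightarrow> w \<sqsubseteq> z \<Longrightarrow> z \<sqsubseteq> w"
    using ex_maximal[of "{w \<in> ?N. w0 \<sqsubseteq> w}"] by auto
  have "z \<sqsubseteq> w" if "z \<in> ?N" "w \<sqsubseteq> z" for z
    using w(3)[OF that(1) below_trans[OF w(2) that(2)] that(2)] .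
  moreover have "\<not> w \<sqsubseteq> x" using below_trans[OF w(2)] w0(3) by blast
  moreover have "\<not> x \<sqsubseteq> w" using x(2)[OF w(1)] \<open>\<not> w \<sqsubseteq> x\<close> by blast
  ultimately show thesis using that[OF x(1) w(1)] x(2) by blast
qed

lemma is_module_noncore: "is_module V A (Q \<union> core Q) (hanging Q - core Q)"
proof -
  have sub: "hanging Q - core Q \<subseteq> V - X" using hanging_subset by blast
  show ?thesis
    unfolding is_module_A_iff[OF sub]
  proof (intro conjI ballI iffI)
    show "hanging Q - core Q \<subseteq> V - (Q \<union> core Q)" using hanging_disjoint hanging_subset by blast
    fix z y assume zy: "z \<in> hanging Q - core Q" "y \<in> V - (hanging Q - core Q)"
    show "y \<in> Q \<union> core Q" if "z \<sqsubseteq> y \<or> y \<sqsubseteq> z" using hanging_neighbour[of z Q y] zy that by blast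
    show "z \<sqsubseteq> y \<or> y \<sqsubseteq> z" if "y \<in> Q \<union> core Q"
      using that hanging_below[of z Q y] core_comparable[of y Q z] zy(1) by blast
  qed
qed

lemma common_nbhd_incomparable_roots:
  assumes Q: "Q \<subseteq> V" and xw: "x \<in> hanging Q - core Q" "w \<in> hanging Q - core Q" "\<not> x \<sqsubseteq> w" "\<not> w \<sqsubseteq> x"
    and maximal: "\<And>z. z \<in> hanging Q - core Q \<Longrightarrow> x \<sqsubseteq> z \<Longrightarrow> z \<sqsubseteq> x"
      "\<And>z. z \<in> hanging Q - core Q \<Longrightarrow> w \<sqsubseteq> z \<Longrightarrow> z \<sqsubseteq> w"
  shows "Q \<union> core Q = common_nbhd V A x w"
proof -
  have xwX: "x \<in> V - X" "w \<in> V - X" using xw hanging_subset by blast+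
  have "z \<in> Q \<union> core Q \<longleftrightarrow> (x \<sqsubseteq> z \<or> z \<sqsubseteq> x) \<and> (w \<sqsubseteq> z \<or> z \<sqsubseteq> w)" if z: "z \<in> V" for z
  proof
    assume "z \<in> Q \<union> core Q"
    then show "(x \<sqsubseteq> z \<or> z \<sqsubseteq> x) \<and> (w \<sqsubseteq> z \<or> z \<sqsubseteq> w)"
      using xw(1,2) hanging_below by (auto simp: core_def)
  next
    assume c: "(x \<sqsubseteq> z \<or> z \<sqsubseteq> x) \<and> (w \<sqsubseteq> z \<or> z \<sqsubseteq> w)"
    show "z \<in> Q \<union> core Q"
    proof (rule ccontr)
      assume "z \<notin> Q \<union> core Q"
      then have "z \<in> hanging Q - core Q" using hanging_neighbour[of x Q z] c xw(1) z by blast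
      then have "z \<sqsubseteq> x" "z \<sqsubseteq> w" using c maximal by blast+
      then show False using comparable_if_common_lower_bound[of z x w] xw(3,4) xwX z by blast
    qed
  qed
  moreover have "Q \<union> core Q \<subseteq> V" using Q hanging_subset by (auto simp: core_def)
  ultimately show ?thesis using common_nbhd_iff[OF xwX] by blast
qed

lemma card_noncore_le: "card (hanging Q - core Q) \<le> (4 * k + 4) * (2 * k + 1)"
proof (cases "hanging Q = core Q")
  case False
  let ?N = "hanging Q - core Q"
  obtain x w where xw: "x \<in> ?N" "w \<in> ?N" "\<not> x \<sqsubseteq> w" "\<not> w \<sqsubseteq> x"
    and maximal: "\<And>z. z \<in> ?N \<Longrightarrow> x \<sqsubseteq> z \<Longrightarrow> z \<sqsubseteq> x" "\<And>z. z \<in> ?N \<Longrightarrow> w \<sqsubseteq> z \<Longrightarrow> z \<sqsubseteq> w"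
    using ex_incomparable_roots[OF False] by metis
  have Q: "Q \<subseteq> V" using subset_if_mem_hanging xw(1) by blast
  have NX: "?N \<subseteq> V - X" using hanging_subset by blast
  have module: "is_module V A (Q \<union> core Q) ?N" by (rule is_module_noncore)
  have nbhd: "z \<in> ?N" if "r \<in> ?N" "z \<in> V - (Q \<union> core Q)" "r \<sqsubseteq> z" for r z
    using hanging_neighbour[of r Q z] that by blast
  show ?thesis
  proof (cases "2 * k + 1 < card ?N")
    case True
    show ?thesis
    proof (rule card_down_closed_le[OF _ _ common_nbhd_incomparable_roots[OF Q xw maximal]
          NX module True NX])
      show "?N \<subseteq> V - (Q \<union> core Q)" using module by (simp add: is_module_def)
      show "r \<sqsubseteq> z \<or> z \<sqsubseteq> r" if "r \<in> ?N" "z \<in> Q \<union> core Q" for r z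
        using that hanging_below by (auto simp: core_def)
      show "z \<notin> X" if "r \<in> ?N" "z \<in> V - (Q \<union> core Q)" "r \<sqsubseteq> z" for r z
        using nbhd[OF that] NX by blast
    qed (use down_closed_noncore xw NX in auto)
  next
    case False
    then have "card ?N \<le> 1 * (2 * k + 1)" by simp
    also have "\<dots> \<le> (4 * k + 4) * (2 * k + 1)" by (rule mult_le_mono1) simp
    finally show ?thesis .
  qed
qed simp

lemma card_hanging_le: "card (hanging Q) \<le> (4 * k + 5) * (2 * k + 1)"
proof -
  have "card (hanging Q) \<le> card (hanging Q - core Q) + (2 * k + 1)"
    by (rule card_le_card_Diff[OF finite_subset[OF core_subset finite_hanging] card_core_le])
  then show ?thesis using card_noncore_le[of Q] by (simp add: algebra_simps)
qed


subsection \<open>Segments of unaffected vertices\<close>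

definition segment :: "'a set \<Rightarrow> 'a set" where
  "segment S = {v \<in> V - X. affected_below v = S}"

definition segment_reps :: "'a set \<Rightarrow> 'a set" where
  "segment_reps S = class_reps (segment S) (twin V B)"

lemma segment_reps_subset: "segment_reps S \<subseteq> segment S"
  unfolding segment_reps_def by (rule class_reps_subset)

lemma finite_segment: "finite (segment S)"
  using finite_verts by (simp add: segment_def)

lemma segmentD:
  assumes "c \<in> segment S"
  shows "c \<in> V" "c \<in> V - X" "affected_below c = S"
  using assms by (auto simp: segment_def)

lemma segment_comparable:
  assumes "S \<noteq> {}" "c \<in> segment S" "d \<in> segment S"
  shows "c \<sqsubseteq> d \<or> d \<sqsubseteq> c"
proof -
  obtain x where "x \<in> X" "x \<sqsubseteq> c" "x \<sqsubseteq> d"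
    using assms segmentD(3) unfolding affected_below_def by blast
  then show ?thesis
    using comparable_if_common_lower_bound[of x c d] X_subset segmentD(1) assms by blast
qed

lemma segment_between:
  assumes "p \<in> segment S" "q \<in> segment S" "q0 \<in> segment S" "\<not> q \<sqsubseteq> q0"
    and y: "y \<in> V" "q \<sqsubseteq> y" "y \<sqsubseteq> p"
  shows "y \<in> segment S"
proof -
  have S: "affected_below y = S"
    using affected_below_mono[OF y(2)] affected_below_mono[OF y(3)] segmentD(3) assms(1,2) by auto
  have "y \<notin> X"
  proof
    assume "y \<in> X"
    then have "y \<in> affected_below q0"
      using affected_below_self S segmentD(3)[OF assms(3)] by blast
    then show False using below_trans[OF y(2)] assms(4) by (auto simp: affected_below_def)
  qed
  then show ?thesis using S y(1) by (simp add: segment_def)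
qed

context
  fixes S p q q0
  assumes S: "S \<noteq> {}" and segment: "p \<in> segment S" "q \<in> segment S" "q0 \<in> segment S"
    and order: "q0 \<sqsubset> q" "q \<sqsubset> p"
begin

lemma unaffected_pq: "p \<in> V - X" "q \<in> V - X" "q0 \<in> V - X"
  using segment segmentD(2) by blast+

lemma teeth_iff: "r \<in> teeth V A p q \<longleftrightarrow> r \<in> V \<and> r \<sqsubseteq> p \<and> \<not> r \<sqsubseteq> q \<and> \<not> q \<sqsubseteq> r"
  using A_iff_comparable(2)[OF unaffected_pq(1), of r] A_iff_comparable(2)[OF unaffected_pq(2), of r]
    below_trans[of q p r] order(2)
  by (auto simp: teeth_def nbhd_less_def)

lemma teeth_unmarked:
  assumes "r \<in> teeth V A p q"
  shows "affected_below r = {}"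
proof (rule ccontr)
  assume "affected_below r \<noteq> {}"
  then obtain x where x: "x \<in> X" "x \<sqsubseteq> r" by (auto simp: affected_below_def)
  have "x \<in> affected_below p"
    using x assms below_trans[of x r p] by (simp add: teeth_iff affected_below_def)
  then have "x \<sqsubseteq> q" using segmentD(3) segment by (auto simp: affected_below_def)
  then show False
    using comparable_if_common_lower_bound[of x r q] x X_subset assms unaffected_pq teeth_iff by blast
qed

lemma teeth_unaffected: "r \<in> teeth V A p q \<Longrightarrow> r \<in> V - X"
  using teeth_unmarked affected_below_self teeth_iff by blast

lemma shaft_above:
  assumes "c \<in> shaft V A p q"
  shows "q \<sqsubseteq> c"
proof (rule ccontr)
  assume not_le: "\<not> q \<sqsubseteq> c"
  have c: "c \<in> V" "nbhd_le V A q c" using assms by (auto simp: shaft_def)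
  have "A q c" using A.adj_if_nbhd_le c(2) unaffected_pq by blast
  then have "c \<sqsubset> q"
    using A_iff_comparable(1) unaffected_pq c(1) not_le by (auto simp: nbhd_less_def)
  have comparable: "z \<sqsubseteq> c \<or> c \<sqsubseteq> z" if "z \<in> V - X" "z \<sqsubseteq> q" for z
    using nbhd_leD[OF c(2), of z] A_iff_comparable(1)[OF that(1)] unaffected_pq c(1) that by blast
  obtain z where z: "z \<in> V" "z \<sqsubseteq> q" "\<not> z \<sqsubseteq> c" "\<not> c \<sqsubseteq> z"
    using ex_incomparable_below[OF c(1) _ \<open>c \<sqsubset> q\<close>] unaffected_pq by blast
  then have "z \<in> affected_below q" using comparable by (auto simp: affected_below_def)
  then have "z \<sqsubseteq> q0" using segmentD(3) segment by (auto simp: affected_below_def)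
  moreover have "q0 \<sqsubseteq> c \<or> c \<sqsubseteq> q0"
    using comparable[OF unaffected_pq(3)] order(1) by (simp add: nbhd_less_def)
  ultimately have "c \<sqsubseteq> q0" using z(3) below_trans by blast
  obtain t where t: "t \<in> V" "t \<sqsubseteq> q" "\<not> t \<sqsubseteq> q0" "\<not> q0 \<sqsubseteq> t"
    using ex_incomparable_below[OF _ _ order(1)] unaffected_pq by blast
  then have "t \<notin> affected_below q" using segmentD(3) segment by (auto simp: affected_below_def)
  then have "t \<sqsubseteq> c \<or> c \<sqsubseteq> t" using comparable t by (auto simp: affected_below_def)
  then show False
    using t below_trans[OF _ \<open>c \<sqsubseteq> q0\<close>] comparable_if_common_lower_bound[of c t q0] \<open>c \<sqsubseteq> q0\<close> c(1)
      unaffected_pq by blast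
qed

lemma shaft_eq: "shaft V A p q = {c \<in> segment S. q \<sqsubseteq> c \<and> c \<sqsubset> p}"
proof (intro set_eqI iffI)
  fix c assume shaft: "c \<in> shaft V A p q"
  then obtain r where c: "c \<in> V" "nbhd_le V A c p" and r: "r \<in> teeth V A p q" "\<not> A r c"
    by (auto simp: shaft_def)
  have "\<not> r \<sqsubseteq> c" using A_iff_comparable(1)[OF teeth_unaffected[OF r(1)] c(1)] r(2) by blast
  then have "\<not> p \<sqsubseteq> c" using r(1) below_trans teeth_iff by blast
  moreover have "A c p" using A.adj_if_nbhd_le[OF c] .
  ultimately have "c \<sqsubset> p"
    using A_iff_comparable(2)[OF unaffected_pq(1) c(1)] by (auto simp: nbhd_less_def)
  moreover have "q \<sqsubseteq> c" by (rule shaft_above[OF shaft])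
  ultimately show "c \<in> {c \<in> segment S. q \<sqsubseteq> c \<and> c \<sqsubset> p}"
    using segment_between[OF segment, of c] c(1) order(1) by (auto simp: nbhd_less_def)
next
  fix c assume c: "c \<in> {c \<in> segment S. q \<sqsubseteq> c \<and> c \<sqsubset> p}"
  then have cX: "c \<in> V - X" and le: "q \<sqsubseteq> c" "c \<sqsubset> p" using segmentD(2) by auto
  obtain r where r: "r \<in> V" "r \<sqsubseteq> p" "\<not> r \<sqsubseteq> c" "\<not> c \<sqsubseteq> r"
    using ex_incomparable_below[OF _ _ le(2)] cX unaffected_pq by blast
  have "\<not> r \<sqsubseteq> q" using r(3) le(1) below_trans by blast
  moreover have "\<not> q \<sqsubseteq> r"
    using comparable_if_common_lower_bound[of q r c] r le(1) cX unaffected_pq by blast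
  moreover have "\<not> A r c" using A_iff_comparable(2)[OF cX r(1)] r by blast
  ultimately show "c \<in> shaft V A p q"
    using r nbhd_le_A_iff cX unaffected_pq le teeth_iff by (auto simp: shaft_def nbhd_less_def)
qed

lemma shaft_or_teeth_agree:
  assumes y: "y \<in> V" "A y q" "y \<notin> shaft V A p q"
  shows "(\<forall>r\<in>teeth V A p q. A r y) \<or> (\<forall>r\<in>teeth V A p q. \<not> A r y)"
proof -
  have A_tooth: "A r y \<longleftrightarrow> r \<sqsubseteq> y \<or> y \<sqsubseteq> r" if "r \<in> teeth V A p q" for r
    using A_iff_comparable(1)[OF teeth_unaffected[OF that] y(1)] .
  consider "p \<sqsubseteq> y" | "y \<sqsubseteq> q" | "q \<sqsubseteq> y" "\<not> p \<sqsubseteq> y"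
    using A_iff_comparable(2)[OF unaffected_pq(2)] y by blast
  then show ?thesis
  proof cases
    case 1
    then show ?thesis using A_tooth below_trans teeth_iff by blast
  next
    case 2
    have "\<not> A r y" if "r \<in> teeth V A p q" for r
      using that A_tooth[OF that] below_trans[of r y q] 2 y(1) unaffected_pq
        comparable_if_common_lower_bound[of y r q] teeth_iff by blast
    then show ?thesis by blast
  next
    case 3
    then have "y \<sqsubset> p"
      using comparable_if_common_lower_bound[of q y p] y(1) unaffected_pq order(2)
      by (auto simp: nbhd_less_def)
    then have "y \<in> shaft V A p q"
      using segment_between[OF segment, of y] y(1) 3 order(1) by (auto simp: shaft_eq nbhd_less_def)
    then show ?thesis using y(3) by blast
  qed
qed

lemma comb_if_segment: "comb V A p q"
  unfolding comb_def
proof (intro conjI ballI impI)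
  show "p \<in> V" "q \<in> V" using unaffected_pq by auto
  show "nbhd_le V A q p" using nbhd_le_A_iff unaffected_pq order(2) by (simp add: nbhd_less_def)
  show "nbhd_le V A c d \<or> nbhd_le V A d c" if "c \<in> shaft V A p q" "d \<in> shaft V A p q" for c d
    using that segment_comparable[OF S, of c d] nbhd_le_A_iff[OF segmentD(2) segmentD(2), of c S d S]
      nbhd_le_A_iff[OF segmentD(2) segmentD(2), of d S c S] by (auto simp: shaft_eq)
  show "nbhd_le V A r p" if "r \<in> teeth V A p q" for r
    using that teeth_iff nbhd_le_A_iff[OF teeth_unaffected unaffected_pq(1)] by blast
  fix r s assume rs: "r \<in> teeth V A p q" "s \<in> teeth V A p q" "A r s"
  then have rX: "r \<in> V - X" "s \<in> V - X" using teeth_unaffected by auto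
  then have comparable: "r \<sqsubseteq> s \<or> s \<sqsubseteq> r" using rs A_iff_comparable(1) by blast
  then show "nbhd_le V A r s \<or> nbhd_le V A s r" using nbhd_le_A_iff rX by blast
  fix c assume c: "c \<in> shaft V A p q" "A r c"
  then have cV: "c \<in> V" "q \<sqsubseteq> c" using segmentD(1) by (auto simp: shaft_eq)
  then have "r \<sqsubseteq> c" using A_iff_comparable(1)[OF rX(1)] c(2) below_trans rs(1) teeth_iff by blast
  then have "s \<sqsubseteq> c \<or> c \<sqsubseteq> s"
    using comparable below_trans comparable_if_common_lower_bound[of r s c] rX cV by blast
  then show "A s c" using A_iff_comparable(1)[OF rX(2) cV(1)] by blast
qed (use shaft_or_teeth_agree in blast)

lemma segment_rep_in_shaft_reps:
  assumes c: "c \<in> segment_reps S" "q \<sqsubseteq> c" "c \<sqsubset> p"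
  shows "c \<in> class_reps (shaft V A p q) (twin V A)"
proof -
  have cS: "c \<in> segment S" using c(1) segment_reps_subset by blast
  have "\<not> twin V A d c" if "d \<in> shaft V A p q" "d < c" for d
  proof
    assume "twin V A d c"
    moreover have "d \<in> segment S" using that(1) shaft_eq by blast
    ultimately have "twin V B d c" using nbhd_le_A_iff segmentD(2) cS by (simp add: twin_def)
    then show False
      using c(1) that(2) \<open>d \<in> segment S\<close> by (auto simp: segment_reps_def class_reps_def)
  qed
  moreover have "c \<in> shaft V A p q" using c(2,3) cS shaft_eq by blast
  ultimately show ?thesis by (simp add: class_reps_def)
qed

end


lemma ex_segment_rep:
  assumes "c \<in> segment S"
  obtains d where "d \<in> segment_reps S" "twin V B d c"
  using ex_class_rep[OF finite_segment twin_equivalence(1,3) assms] unfolding segment_reps_def .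

lemma segment_reps_strict:
  assumes "S \<noteq> {}" "c \<in> segment_reps S" "d \<in> segment_reps S" "c \<noteq> d"
  shows "c \<sqsubset> d \<or> d \<sqsubset> c"
proof -
  have "\<not> twin V B c d"
    using class_reps_eqI[of c "segment S" "twin V B" d] twin_sym[of V B c d] assms(2-4)
    unfolding segment_reps_def by blast
  then show ?thesis
    using segment_comparable[OF assms(1)] assms(2,3) segment_reps_subset
    by (auto simp: twin_def nbhd_less_def)
qed

lemma rule_comb_if_long_segment:
  assumes S: "S \<noteq> {}" and m: "6 * k + 5 \<le> m" and inj: "inj_on f {..<m}"
    and f: "\<And>i. i < m \<Longrightarrow> f i \<in> segment_reps S"
    and less: "\<And>i j. i < j \<Longrightarrow> j < m \<Longrightarrow> f i \<sqsubset> f j"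
  shows "rule_comb V A k (f (2 * k + 2))"
proof -
  have f_segment: "f i \<in> segment S" if "i < m" for i
    using f that segment_reps_subset by blast
  let ?p = "f (m - 1)" and ?q = "f 1" and ?v = "f (2 * k + 2)"
  have chain: "?p \<in> segment S" "?q \<in> segment S" "f 0 \<in> segment S" "f 0 \<sqsubset> ?q" "?q \<sqsubset> ?p"
    using f_segment less m by auto
  let ?R = "class_reps (shaft V A ?p ?q) (twin V A)"
  have reps: "f i \<in> ?R" if i: "1 \<le> i" "i < m - 1" for i
  proof (rule segment_rep_in_shaft_reps[OF S chain])
    show "?q \<sqsubseteq> f i"
      using less[of 1 i] i nbhd_le_refl by (cases "i = 1") (auto simp: nbhd_less_def)
  qed (use i f less in auto)
  have A_less: "nbhd_less V A (f i) (f j)" if "i < j" "j < m" for i j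
    using less[OF that] nbhd_le_A_iff segmentD(2)[OF f_segment] that by (simp add: nbhd_less_def)
  have card_f: "card (f ` {i..<j}) = j - i" if "j \<le> m" for i j
    using card_image[OF inj_on_subset[OF inj], of "{i..<j}"] that by (simp add: subset_eq)
  have fin: "finite ?R"
    by (rule finite_subset[OF class_reps_subset]) (use finite_verts in \<open>simp add: shaft_def\<close>)
  have "card (f ` {2 * k + 3..<m - 1}) \<le> card {c \<in> ?R. nbhd_less V A ?v c}"
    using reps A_less fin by (intro card_mono) auto
  moreover have "card (f ` {1..<2 * k + 2}) \<le> card {c \<in> ?R. nbhd_less V A c ?v}"
    using reps A_less fin m by (intro card_mono) auto
  moreover have "?v \<in> shaft V A ?p ?q"
    using subsetD[OF class_reps_subset reps[of "2 * k + 2"]] m by simp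
  moreover have "?p \<in> V" "?q \<in> V" using chain segmentD(1) by blast+
  ultimately show ?thesis
    using comb_if_segment[OF S chain] card_f[of "m - 1"] card_f[of "2 * k + 2"] m
    unfolding rule_comb_def by (intro bexI[of _ ?p] bexI[of _ ?q]) auto
qed

lemma card_segment_reps_le:
  assumes S: "S \<noteq> {}"
  shows "card (segment_reps S) \<le> 6 * k + 4"
proof (rule ccontr)
  let ?m = "card (segment_reps S)"
  assume "\<not> ?m \<le> 6 * k + 4"
  then have m: "6 * k + 5 \<le> ?m" by simp
  have sub: "segment_reps S \<subseteq> V" using segment_reps_subset segmentD(1) by blast
  then obtain f where bij: "bij_betw f {..<?m} (segment_reps S)"
    and less: "\<And>i j. i < j \<Longrightarrow> j < ?m \<Longrightarrow> f i \<sqsubset> f j"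
    using ex_increasing_enumeration segment_reps_strict[OF S] by metis
  have f: "f i \<in> segment_reps S" if "i < ?m" for i
    using that bij_betwE[OF bij] by blast
  have "rule_comb V A k (f (2 * k + 2))"
    by (rule rule_comb_if_long_segment[OF S m bij_betw_imp_inj_on[OF bij] f less])
  moreover have "f (2 * k + 2) \<in> V" using f m sub by auto
  ultimately show False using irreducible by (simp add: deletable_def)
qed

lemma card_segment_le:
  assumes "S \<noteq> {}"
  shows "card (segment S) \<le> (6 * k + 4) * (2 * k + 1)"
proof -
  have "\<forall>c\<in>segment S. \<exists>d. d \<in> segment_reps S \<and> twin V B d c" using ex_segment_rep by metis
  then obtain rep where rep: "rep c \<in> segment_reps S" "twin V B (rep c) c" if "c \<in> segment S" for c
    by metis
  have "card (segment S) \<le> card (rep ` segment S) * (2 * k + 1)"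
  proof (rule card_le_card_image)
    show "segment S \<subseteq> V - X" using segmentD(2) by blast
    show "u \<sqsubseteq> w" if "u \<in> segment S" "w \<in> segment S" "rep u = rep w" for u w
      using rep(2)[OF that(1)] rep(2)[OF that(2)] that(3) below_trans by (auto simp: twin_def)
  qed
  also have "\<dots> \<le> (6 * k + 4) * (2 * k + 1)"
  proof (rule mult_le_mono1)
    have "card (rep ` segment S) \<le> card (segment_reps S)"
      using rep(1) finite_subset[OF segment_reps_subset finite_segment] by (intro card_mono) auto
    then show "card (rep ` segment S) \<le> 6 * k + 4" using card_segment_reps_le[OF assms] by linarith
  qed
  finally show ?thesis .
qed


subsection \<open>Vertices hanging off a segment\<close>

definition lowest :: "'a set \<Rightarrow> 'a \<Rightarrow> bool" where
  "lowest S a \<longleftrightarrow> (\<forall>c\<in>segment S. a \<sqsubseteq> c)"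

definition bottom_branches :: "'a set \<Rightarrow> 'a set" where
  "bottom_branches S = (\<Union>a\<in>{a \<in> segment S. lowest S a}. hanging (upset a))"

definition side_branches :: "'a set \<Rightarrow> 'a set" where
  "side_branches S = (\<Union>a\<in>{a \<in> segment S. \<not> lowest S a}. hanging (upset a))"

lemma card_bottom_branches_le: "card (bottom_branches S) \<le> (4 * k + 5) * (2 * k + 1)"
proof (cases "bottom_branches S = {}")
  case False
  then obtain a where a: "a \<in> segment S" "lowest S a" by (auto simp: bottom_branches_def)
  have "upset b = upset a" if "b \<in> segment S" "lowest S b" for b
    using that a by (intro upset_eq_if_twin) (simp add: twin_def lowest_def)
  then have "bottom_branches S \<subseteq> hanging (upset a)" by (auto simp: bottom_branches_def)
  then have "card (bottom_branches S) \<le> card (hanging (upset a))"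
    by (rule card_mono[OF finite_hanging])
  also have "\<dots> \<le> (4 * k + 5) * (2 * k + 1)" by (rule card_hanging_le)
  finally show ?thesis .
qed simp

lemma common_nbhd_upset:
  assumes S: "S \<noteq> {}" and a: "a \<in> segment S" and w: "w \<in> segment S" "\<not> a \<sqsubseteq> w"
    and x: "x \<in> hanging (upset a)"
  shows "upset a = common_nbhd V A x w"
proof -
  have xX: "x \<in> V - X" and wX: "w \<in> V - X" using x hanging_subset w(1) segmentD(2) by blast+
  have "w \<sqsubseteq> a" using segment_comparable[OF S a w(1)] w(2) by blast
  have "z \<in> upset a \<longleftrightarrow> (x \<sqsubseteq> z \<or> z \<sqsubseteq> x) \<and> (w \<sqsubseteq> z \<or> z \<sqsubseteq> w)" if z: "z \<in> V" for z
  proof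
    assume "z \<in> upset a"
    then show "(x \<sqsubseteq> z \<or> z \<sqsubseteq> x) \<and> (w \<sqsubseteq> z \<or> z \<sqsubseteq> w)"
      using hanging_below[OF x] below_trans[OF \<open>w \<sqsubseteq> a\<close>] by (auto simp: upset_def)
  next
    assume c: "(x \<sqsubseteq> z \<or> z \<sqsubseteq> x) \<and> (w \<sqsubseteq> z \<or> z \<sqsubseteq> w)"
    have "z \<notin> hanging (upset a)"
    proof
      assume zQ: "z \<in> hanging (upset a)"
      have "\<not> w \<sqsubseteq> z"
        using affected_below_mono[of w z] zQ segmentD(3)[OF w(1)] S by (auto simp: hanging_def)
      moreover have "\<not> z \<sqsubseteq> w"
      proof
        assume "z \<sqsubseteq> w"
        then have "w \<in> upset a"
          using zQ wX segmentD(3)[OF w(1)] S by (auto simp: hanging_def marked_above_def)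
        then show False using w(2) by (simp add: upset_def)
      qed
      ultimately show False using c by blast
    qed
    then show "z \<in> upset a" using hanging_neighbour[OF x z] c by blast
  qed
  then show ?thesis using common_nbhd_iff[OF xX wX] by (auto simp: upset_def)
qed

lemma unaffected_above_side_branch:
  assumes a: "a \<in> segment S" and b: "b \<in> segment S" "\<not> lowest S b" "b \<sqsubseteq> a"
    and r: "r \<in> hanging (upset b)" and z: "z \<in> V - upset a" "r \<sqsubseteq> z"
  shows "z \<notin> X"
proof
  assume zX: "z \<in> X"
  have "z \<in> upset b"
    using r z affected_below_self[OF zX] by (auto simp: hanging_def marked_above_def)
  then have bz: "b \<sqsubseteq> z" by (simp add: upset_def)
  then have "z \<sqsubseteq> a"
    using comparable_if_common_lower_bound[of b z a] b(1,3) a z(1) segmentD(1)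
    by (auto simp: upset_def)
  moreover obtain c where "c \<in> segment S" "\<not> b \<sqsubseteq> c" using b(2) by (auto simp: lowest_def)
  ultimately have "z \<in> segment S" using segment_between[OF a b(1)] bz z(1) by blast
  then show False using zX segmentD(2) by blast
qed

lemma card_side_branches_below_le:
  assumes S: "S \<noteq> {}" and a: "a \<in> segment S" "\<not> lowest S a"
    and large: "2 * k + 1 < card (hanging (upset a))"
  shows "card (\<Union>b\<in>{b \<in> segment S. \<not> lowest S b \<and> b \<sqsubseteq> a}. hanging (upset b))
    \<le> (4 * k + 4) * (2 * k + 1)" (is "card ?W \<le> _")
proof -
  obtain w where w: "w \<in> segment S" "\<not> a \<sqsubseteq> w" using a by (auto simp: lowest_def)
  obtain x where x: "x \<in> hanging (upset a)" using large by fastforce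
  show ?thesis
  proof (rule card_down_closed_le[OF _ _ common_nbhd_upset[OF S a(1) w x]
        hanging_subset is_module_hanging large])
    show "x \<in> V" "w \<in> V" using x w segmentD(1) hanging_subset by auto
    show "?W \<subseteq> V - X" using hanging_subset by blast
    show "down_closed ?W"
      using down_closedD[OF hanging_down_closed] unfolding down_closed_def by blast
    have W: "\<exists>b\<in>segment S. \<not> lowest S b \<and> b \<sqsubseteq> a \<and> r \<in> hanging (upset b)" if "r \<in> ?W" for r
      using that by blast
    show "r \<sqsubseteq> z \<or> z \<sqsubseteq> r" if "r \<in> ?W" "z \<in> upset a" for r z
      using W[OF that(1)] that(2) hanging_below below_trans by (fastforce simp: upset_def)
    show "?W \<subseteq> V - upset a"
    proof -
      have "affected_below z \<noteq> {}" if "z \<in> upset a" for z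
        using that affected_below_mono[of a z] segmentD(3)[OF a(1)] S by (auto simp: upset_def)
      then show ?thesis using W hanging_subset by (fastforce simp: hanging_def)
    qed
    show "z \<notin> X" if "r \<in> ?W" "z \<in> V - upset a" "r \<sqsubseteq> z" for r z
      using W[OF that(1)] unaffected_above_side_branch[OF a(1)] that(2,3) by blast
  qed
qed

lemma card_small_branches_le:
  assumes "S \<noteq> {}"
  shows "card (\<Union>a\<in>{a \<in> segment S. card (hanging (upset a)) \<le> 2 * k + 1}. hanging (upset a))
    \<le> (6 * k + 4) * (2 * k + 1)" (is "card ?small \<le> _")
proof -
  let ?R = "{a \<in> segment_reps S. card (hanging (upset a)) \<le> 2 * k + 1}"
  have finR: "finite ?R" using finite_subset[OF segment_reps_subset finite_segment] by simp
  have "?small \<subseteq> (\<Union>a\<in>?R. hanging (upset a))"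
  proof
    fix v assume "v \<in> ?small"
    then obtain a where a: "a \<in> segment S" "card (hanging (upset a)) \<le> 2 * k + 1"
      "v \<in> hanging (upset a)"
      by blast
    obtain d where "d \<in> segment_reps S" "twin V B d a" using ex_segment_rep[OF a(1)] .
    then show "v \<in> (\<Union>a\<in>?R. hanging (upset a))" using upset_eq_if_twin[of d a] a by auto
  qed
  then have "card ?small \<le> card (\<Union>a\<in>?R. hanging (upset a))"
    using finR finite_hanging by (intro card_mono) auto
  also have "\<dots> \<le> (6 * k + 4) * (2 * k + 1)"
  proof (rule card_UN_le_mult[OF finR])
    have "card ?R \<le> card (segment_reps S)"
      using finite_subset[OF segment_reps_subset finite_segment] by (intro card_mono) auto
    then show "card ?R \<le> 6 * k + 4" using card_segment_reps_le[OF assms] by linarith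
  qed simp
  finally show ?thesis .
qed

lemma card_side_branches_le:
  assumes S: "S \<noteq> {}"
  shows "card (side_branches S) \<le> (10 * k + 8) * (2 * k + 1)"
proof -
  let ?small = "\<Union>a\<in>{a \<in> segment S. card (hanging (upset a)) \<le> 2 * k + 1}. hanging (upset a)"
  let ?large = "{a \<in> segment S. \<not> lowest S a \<and> 2 * k + 1 < card (hanging (upset a))}"
  obtain W where W: "side_branches S \<subseteq> ?small \<union> W" "card W \<le> (4 * k + 4) * (2 * k + 1)" "finite W"
  proof (cases "?large = {}")
    case True
    then have "side_branches S \<subseteq> ?small \<union> {}" by (fastforce simp: side_branches_def)
    then show ?thesis using that[of "{}"] by simp
  next
    case False
    then obtain a where a: "a \<in> ?large" "\<And>z. z \<in> ?large \<Longrightarrow> a \<sqsubseteq> z \<Longrightarrow> z \<sqsubseteq> a"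
      using ex_maximal[of ?large] segmentD(1) by blast
    let ?W = "\<Union>b\<in>{b \<in> segment S. \<not> lowest S b \<and> b \<sqsubseteq> a}. hanging (upset b)"
    have "b \<sqsubseteq> a" if "b \<in> ?large" for b
      using that a segment_comparable[OF S] by blast
    then have "side_branches S \<subseteq> ?small \<union> ?W"
      by (fastforce simp: side_branches_def)
    moreover have "finite ?W" using finite_segment finite_hanging by auto
    moreover have "card ?W \<le> (4 * k + 4) * (2 * k + 1)"
      by (rule card_side_branches_below_le[OF S]) (use a(1) in auto)
    ultimately show ?thesis using that by blast
  qed
  have "card (side_branches S) \<le> card (?small \<union> W)"
    using W finite_segment finite_hanging by (intro card_mono) auto
  also have "\<dots> \<le> card ?small + card W" by (rule card_Un_le)
  also have "\<dots> \<le> (6 * k + 4) * (2 * k + 1) + (4 * k + 4) * (2 * k + 1)"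
    by (rule add_mono[OF card_small_branches_le[OF S] W(2)])
  also have "\<dots> = (10 * k + 8) * (2 * k + 1)" by (simp add: algebra_simps)
  finally show ?thesis .
qed

lemma ex_lowest_marked:
  assumes v: "v \<in> V" "affected_below v = {}" "marked_above v \<noteq> {}"
  obtains a where "a \<in> V" "affected_below a \<noteq> {}" "v \<in> hanging (upset a)"
proof -
  have sub: "marked_above v \<subseteq> V" by (auto simp: marked_above_def)
  obtain a where a: "a \<in> marked_above v" "\<And>z. z \<in> marked_above v \<Longrightarrow> z \<sqsubseteq> a \<Longrightarrow> a \<sqsubseteq> z"
    using ex_minimal[OF sub v(3)] by blast
  then have aV: "a \<in> V" "v \<sqsubseteq> a" "affected_below a \<noteq> {}" by (auto simp: marked_above_def)
  have "a \<sqsubseteq> y" if "y \<in> marked_above v" for y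
    using a(2)[OF that] that comparable_if_common_lower_bound[of v a y] v(1) aV
    by (auto simp: marked_above_def)
  moreover have "y \<in> marked_above v" if "y \<in> V" "a \<sqsubseteq> y" for y
    using that aV below_trans[OF aV(2) that(2)] affected_below_mono[OF that(2)]
    by (auto simp: marked_above_def)
  ultimately have "marked_above v = upset a" using sub by (auto simp: upset_def)
  then show thesis using that aV v by (simp add: hanging_def)
qed

lemma verts_subset_cover:
  "V \<subseteq> X \<union> hanging {} \<union> (\<Union>a\<in>X. hanging (upset a)) \<union>
     (\<Union>S\<in>affected_below ` V - {{}}. segment S \<union> bottom_branches S \<union> side_branches S)"
proof
  fix v assume v: "v \<in> V"
  let ?cover = "\<Union>S\<in>affected_below ` V - {{}}. segment S \<union> bottom_branches S \<union> side_branches S"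
  consider "v \<in> X" | "v \<notin> X" "affected_below v \<noteq> {}" | "affected_below v = {}" "marked_above v = {}"
    | "affected_below v = {}" "marked_above v \<noteq> {}" by blast
  then show "v \<in> X \<union> hanging {} \<union> (\<Union>a\<in>X. hanging (upset a)) \<union> ?cover"
  proof cases
    case 2
    then have "v \<in> segment (affected_below v)" using v by (simp add: segment_def)
    then show ?thesis using v 2(2) by blast
  next
    case 3
    then show ?thesis using v by (simp add: hanging_def)
  next
    case 4
    then obtain a where a: "a \<in> V" "affected_below a \<noteq> {}" "v \<in> hanging (upset a)"
      using ex_lowest_marked v by metis
    show ?thesis
    proof (cases "a \<in> X")
      case False
      then have "a \<in> segment (affected_below a)" using a(1) by (simp add: segment_def)
      then have "v \<in> bottom_branches (affected_below a) \<union> side_branches (affected_below a)"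
        using a(3) by (auto simp: bottom_branches_def side_branches_def)
      then show ?thesis using a(1,2) by blast
    qed (use a(3) in blast)
  qed simp
qed

lemma card_segment_with_branches_le:
  assumes "S \<noteq> {}"
  shows "card (segment S \<union> bottom_branches S \<union> side_branches S) \<le> (20 * k + 17) * (2 * k + 1)"
proof -
  have "card (segment S \<union> bottom_branches S \<union> side_branches S)
      \<le> card (segment S) + card (bottom_branches S) + card (side_branches S)"
    using card_Un_le by (meson add_le_mono1 order_trans)
  also have "\<dots> \<le> (6 * k + 4) * (2 * k + 1) + (4 * k + 5) * (2 * k + 1) + (10 * k + 8) * (2 * k + 1)"
    by (intro add_mono card_segment_le card_bottom_branches_le card_side_branches_le assms)
  also have "\<dots> = (20 * k + 17) * (2 * k + 1)" by (simp add: algebra_simps)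
  finally show ?thesis .
qed

theorem card_verts_le: "card V \<le> 176 * (k + 1) ^ 3"
proof -
  let ?X' = "\<Union>a\<in>X. hanging (upset a)"
  let ?S = "\<Union>S\<in>affected_below ` V - {{}}. segment S \<union> bottom_branches S \<union> side_branches S"
  have finX: "finite X" by (rule finite_subset[OF X_subset finite_verts])
  have "finite (X \<union> hanging {} \<union> ?X' \<union> ?S)"
    using finX finite_verts finite_hanging finite_segment
    by (auto simp: bottom_branches_def side_branches_def)
  then have "card V \<le> card (X \<union> hanging {} \<union> ?X' \<union> ?S)"
    using verts_subset_cover by (rule card_mono)
  also have "\<dots> \<le> card X + card (hanging {}) + card ?X' + card ?S"
    using card_Un_le by (meson add_le_mono1 order_trans)
  also have "\<dots> \<le> 2 * k + (4 * k + 5) * (2 * k + 1) + 2 * k * ((4 * k + 5) * (2 * k + 1)) +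
      4 * k * ((20 * k + 17) * (2 * k + 1))"
    using card_affected card_hanging_le card_segment_with_branches_le card_affected_below_le finX
      finite_verts by (intro add_mono card_UN_le_mult) auto
  also have "\<dots> \<le> 176 * (k + 1) ^ 3"
    by (simp add: power3_eq_cube algebra_simps)
  finally show ?thesis .
qed

end

corollary card_le_if_irreducible:
  assumes "reflexive_graph V A" "\<And>v. v \<in> V \<Longrightarrow> \<not> deletable V A k v" "editable V A k"
  shows "card V \<le> 176 * (k + 1) ^ 3"
proof -
  obtain B where B: "reflexive_graph V B" "nested V B" "card (disagreements V A B) \<le> k"
    using assms(3) by (auto simp: editable_def)
  have "card (affected V A B) \<le> 2 * k"
    using card_affected_le[OF reflexive_graph.finite_verts[OF assms(1)] B(3)] .
  then interpret irreducible_edition V A B k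
    using assms(1,2) B
    by (intro irreducible_edition.intro nested_graph.intro nested_graph_axioms.intro
        irreducible_edition_axioms.intro)
  show ?thesis by (rule card_verts_le)
qed


section \<open>Trivially perfect graphs are nested\<close>

definition closed_adj :: "'a ugraph \<Rightarrow> 'a adjacency" where
  "closed_adj G u v \<longleftrightarrow> u = v \<or> {u, v} \<in> edges G"

lemma closed_adj_commute: "closed_adj G u v \<longleftrightarrow> closed_adj G v u"
  by (auto simp: closed_adj_def insert_commute)

lemma reflexive_graph_closed_adj: "finite V \<Longrightarrow> reflexive_graph V (closed_adj G)"
  by unfold_locales (auto simp: closed_adj_def insert_commute)

lemma singleton_notin_edges: "edges G \<subseteq> vertex_pairs V \<Longrightarrow> {u} \<notin> edges G"
  by (auto simp: vertex_pairs_def)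

lemma not_nested_if_contains_induced:
  assumes "contains_induced H Q"
    and Q: "verts Q = {0, 1, 2, 3 :: nat}" "{{0, 1}, {1, 2}, {2, 3}} \<subseteq> edges Q"
      "{0, 2} \<notin> edges Q" "{1, 3} \<notin> edges Q"
  shows "\<not> nested (verts H) (closed_adj H)"
proof
  assume nest: "nested (verts H) (closed_adj H)"
  obtain S f where S: "S \<subseteq> verts H" and f: "bij_betw f S {0, 1, 2, 3 :: nat}"
    and iso: "\<And>u v. u \<in> S \<Longrightarrow> v \<in> S \<Longrightarrow> {u, v} \<in> edges H \<longleftrightarrow> {f u, f v} \<in> edges Q"
    using assms(1) Q(1) by (auto simp: contains_induced_def isomorphic_def induced_subgraph_def)
  let ?g = "the_inv_into S f"
  have g: "?g i \<in> S" "f (?g i) = i" if "i \<in> {0, 1, 2, 3}" for i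
    using that bij_betwE[OF bij_betw_the_inv_into[OF f]] f_the_inv_into_f_bij_betw[OF f] by auto
  have adj: "closed_adj H (?g i) (?g j) \<longleftrightarrow> i = j \<or> {i, j} \<in> edges Q"
    if "i \<in> {0, 1, 2, 3}" "j \<in> {0, 1, 2, 3}" for i j
    using iso[OF g(1) g(1)] g(2) that unfolding closed_adj_def by metis
  have "{?g 0, ?g 1, ?g 2, ?g 3} \<subseteq> verts H" using g(1) S by auto
  then have "closed_adj H (?g 3) (?g 1)"
    using nested_chord[OF nest, of "?g 0" "?g 1" "?g 2" "?g 3"] adj[of 1 2] adj[of 0 1] adj[of 0 2]
      adj[of 3 2] Q(2,3) by (simp add: insert_commute)
  then show False using adj[of 3 1] Q(4) by (simp add: insert_commute)
qed

lemma contains_induced_if_not_nested: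
  assumes pairs: "edges H \<subseteq> vertex_pairs (verts H)"
    and not_nested: "\<not> nested (verts H) (closed_adj H)"
  shows "contains_induced H P4 \<or> contains_induced H C4"
proof -
  obtain a b c d where abcd: "a \<in> verts H" "b \<in> verts H" "c \<in> verts H" "d \<in> verts H"
    and adj: "closed_adj H b c" "closed_adj H a b" "\<not> closed_adj H a c"
      "closed_adj H d c" "\<not> closed_adj H d b"
    using not_nested unfolding nested_def nbhd_le_def by blast
  have distinct: "a \<noteq> b" "a \<noteq> c" "a \<noteq> d" "b \<noteq> c" "b \<noteq> d" "c \<noteq> d"
    using adj by (auto simp: closed_adj_def insert_commute)
  have edges: "{a, b} \<in> edges H" "{b, a} \<in> edges H" "{b, c} \<in> edges H" "{c, b} \<in> edges H"
    "{c, d} \<in> edges H" "{d, c} \<in> edges H" "{a, c} \<notin> edges H" "{c, a} \<notin> edges H"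
    "{b, d} \<notin> edges H" "{d, b} \<notin> edges H"
    using adj distinct by (auto simp: closed_adj_def insert_commute)
  have da: "{d, a} \<in> edges H \<longleftrightarrow> {a, d} \<in> edges H" by (simp add: insert_commute)
  define f :: "'a \<Rightarrow> nat" where
    "f x = (if x = a then 0 else if x = b then 1 else if x = c then 2 else 3)" for x
  let ?S = "{a, b, c, d}"
  have f: "f a = 0" "f b = 1" "f c = 2" "f d = 3" using distinct by (auto simp: f_def)
  have bij: "bij_betw f ?S {0, 1, 2, 3}" using f by (auto simp: bij_betw_def inj_on_def)
  have "isomorphic (induced_subgraph H ?S) (if {a, d} \<in> edges H then C4 else P4)"
    unfolding isomorphic_def induced_subgraph_def C4_def P4_def
    by (rule exI[of _ f]) (use bij f edges da singleton_notin_edges[OF pairs]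
        in \<open>simp add: doubleton_eq_iff\<close>)
  moreover have "?S \<subseteq> verts H" using abcd by simp
  ultimately show ?thesis unfolding contains_induced_def by (metis (full_types))
qed

theorem trivially_perfect_iff_nested:
  assumes "edges H \<subseteq> vertex_pairs (verts H)"
  shows "trivially_perfect H \<longleftrightarrow> nested (verts H) (closed_adj H)"
proof
  assume "trivially_perfect H"
  then show "nested (verts H) (closed_adj H)"
    using contains_induced_if_not_nested[OF assms] by (auto simp: trivially_perfect_def)
next
  assume "nested (verts H) (closed_adj H)"
  then show "trivially_perfect H"
    using not_nested_if_contains_induced[of H P4] not_nested_if_contains_induced[of H C4]
    by (auto simp: trivially_perfect_def P4_def C4_def doubleton_eq_iff)
qed

context
  fixes G :: "'a ugraph"
  assumes G: "simple_graph G"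
begin

lemma trivially_perfect_edit_iff:
  assumes "F \<subseteq> vertex_pairs (verts G)"
  shows "trivially_perfect (edit G F) \<longleftrightarrow> nested (verts G) (closed_adj (edit G F))"
  using trivially_perfect_iff_nested[of "edit G F"] G assms
  by (auto simp: edit_def simple_graph_def)

lemma editable_if_yes_instance:
  assumes "yes_instance G k"
  shows "editable (verts G) (closed_adj G) k"
proof -
  obtain F where F: "F \<subseteq> vertex_pairs (verts G)" "card F \<le> k" "trivially_perfect (edit G F)"
    using assms by (auto simp: yes_instance_def is_edition_def)
  have fin: "finite (verts G)" using G by (simp add: simple_graph_def)
  have "finite F"
    by (rule finite_subset[of _ "Pow (verts G)"]) (use F(1) fin in \<open>auto simp: vertex_pairs_def\<close>)
  moreover have "disagreements (verts G) (closed_adj G) (closed_adj (edit G F)) \<subseteq> F"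
    by (auto simp: disagreements_def closed_adj_def edit_def)
  ultimately have "card (disagreements (verts G) (closed_adj G) (closed_adj (edit G F))) \<le> k"
    using F(2) card_mono le_trans by blast
  then show ?thesis
    using F trivially_perfect_edit_iff reflexive_graph_closed_adj[OF fin]
    by (auto simp: editable_def)
qed

lemma yes_instance_if_editable:
  assumes "editable (verts G) (closed_adj G) k"
  shows "yes_instance G k"
proof -
  let ?V = "verts G"
  obtain B where B: "reflexive_graph ?V B" "nested ?V B" "card (disagreements ?V (closed_adj G) B) \<le> k"
    using assms by (auto simp: editable_def)
  interpret B: reflexive_graph ?V B by (rule B(1))
  let ?F = "disagreements ?V (closed_adj G) B"
  have F: "?F \<subseteq> vertex_pairs ?V"
  proof
    fix e assume "e \<in> ?F"
    then obtain u v where uv: "u \<in> ?V" "v \<in> ?V" "e = {u, v}" "closed_adj G u v \<noteq> B u v"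
      by (auto simp: disagreements_def)
    then have "u \<noteq> v" using B.refl by (auto simp: closed_adj_def)
    then show "e \<in> vertex_pairs ?V" using uv by (auto simp: vertex_pairs_def)
  qed
  have F_iff: "{u, v} \<in> ?F \<longleftrightarrow> closed_adj G u v \<noteq> B u v" if "u \<in> ?V" "v \<in> ?V" for u v
    using that closed_adj_commute[of G u v] B.commute[of u v]
    by (auto simp: disagreements_def doubleton_eq_iff)
  have "closed_adj (edit G ?F) u v \<longleftrightarrow> B u v" if "u \<in> ?V" "v \<in> ?V" for u v
    using F_iff[OF that] B.refl that by (auto simp: closed_adj_def edit_def)
  then have "nested ?V (closed_adj (edit G ?F))"
    using B(2) by (simp add: nested_def nbhd_le_def)
  then have "is_edition G k ?F"
    using trivially_perfect_edit_iff F B(3) by (simp add: is_edition_def)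
  then show ?thesis by (auto simp: yes_instance_def)
qed

theorem yes_instance_iff_editable: "yes_instance G k \<longleftrightarrow> editable (verts G) (closed_adj G) k"
  using editable_if_yes_instance yes_instance_if_editable by blast

end


section \<open>Running times of programs\<close>

notation Assign ("(_ ::= _)" [100, 61] 61)
notation Seq (infixr ";;" 60)

lemma set_reg_simps [simp]: "reg (set_reg x v s) = (reg s)(x := v)" "arr (set_reg x v s) = arr s"
  by (simp_all add: set_reg_def)

lemma set_arr_simps [simp]:
  "reg (set_arr a i j v s) = reg s"
  "arr (set_arr a i j v s) = (arr s)(a := (arr s a)(i := (arr s a i)(j := v)))"
  by (simp_all add: set_arr_def)

definition runs :: "com \<Rightarrow> state \<Rightarrow> nat \<Rightarrow> (state \<Rightarrow> bool) \<Rightarrow> bool" where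
  "runs c s T Q \<longleftrightarrow> (\<exists>t s'. exec c s t s' \<and> t \<le> T \<and> Q s')"

lemma runs_mono: "runs c s T Q \<Longrightarrow> T \<le> U \<Longrightarrow> (\<And>s'. Q s' \<Longrightarrow> R s') \<Longrightarrow> runs c s U R"
  unfolding runs_def by (meson order_trans)

lemma runs_Skip: "Q s \<Longrightarrow> 1 \<le> T \<Longrightarrow> runs Skip s T Q"
  unfolding runs_def using exec_Skip by blast

lemma runs_Assign: "Q (set_reg x (aval a s) s) \<Longrightarrow> runs (x ::= a) s 1 Q"
  unfolding runs_def using exec_Assign by blast

lemma runs_Store: "Q (set_arr A (aval a s) (aval b s) (aval e s) s) \<Longrightarrow> runs (Store A a b e) s 1 Q"
  unfolding runs_def using exec_Store by blast

lemma runs_Seq: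
  assumes "runs c s T R" "\<And>s'. R s' \<Longrightarrow> runs d s' U Q"
  shows "runs (c ;; d) s (T + U) Q"
  using assms unfolding runs_def by (meson add_mono exec_Seq)

lemma runs_Cond:
  assumes "bval b s \<Longrightarrow> runs c s T Q" "\<not> bval b s \<Longrightarrow> runs d s T Q"
  shows "runs (Cond b c d) s (T + 1) Q"
  using assms unfolding runs_def
  by (cases "bval b s") (meson add_le_mono1 exec_CondTrue exec_CondFalse)+

lemma runs_WhileFalse: "\<not> bval b s \<Longrightarrow> Q s \<Longrightarrow> runs (While b c) s 1 Q"
  unfolding runs_def using exec_WhileFalse by blast

lemma runs_WhileTrue:
  assumes "bval b s" "runs c s T R" "\<And>s'. R s' \<Longrightarrow> runs (While b c) s' U Q"
  shows "runs (While b c) s (T + U + 1) Q"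
  using assms unfolding runs_def by (meson add_le_mono add_le_mono1 exec_WhileTrue)

definition For :: "vname \<Rightarrow> aexp \<Rightarrow> com \<Rightarrow> com" where
  "For x b c = x ::= Const 0 ;; While (Lt (Var x) b) (c ;; x ::= Add (Var x) (Const 1))"

lemma runs_counting_While:
  fixes x b c
  defines "body \<equiv> c ;; x ::= Add (Var x) (Const 1)"
  assumes step: "\<And>i s. i < N \<Longrightarrow> I i s \<Longrightarrow> reg s x = i \<Longrightarrow>
      runs c s T (\<lambda>s'. reg s' x = i \<and> I (Suc i) (set_reg x (Suc i) s'))"
    and bound: "\<And>i s. I i s \<Longrightarrow> reg s x = i \<Longrightarrow> aval b s = N"
    and init: "i \<le> N" "reg s x = i" "I i s"
  shows "runs (While (Lt (Var x) b) body) s ((N - i) * (T + 2) + 1) (\<lambda>s'. reg s' x = N \<and> I N s')"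
  using init
proof (induction "N - i" arbitrary: i s)
  case 0
  then show ?case using bound[of i s] by (intro runs_mono[OF runs_WhileFalse]) auto
next
  case (Suc m)
  let ?J = "\<lambda>i s. reg s x = i \<and> I i s"
  have "runs body s (T + 1) (?J (Suc i))"
    unfolding body_def
  proof (rule runs_Seq[OF step])
    show "runs (x ::= Add (Var x) (Const 1)) s' 1 (?J (Suc i))"
      if "reg s' x = i \<and> I (Suc i) (set_reg x (Suc i) s')" for s'
      by (rule runs_Assign) (use that in simp)
  qed (use Suc.hyps(2) Suc.prems in auto)
  then have "runs (While (Lt (Var x) b) body) s (T + 1 + ((N - Suc i) * (T + 2) + 1) + 1) (?J N)"
  proof (rule runs_WhileTrue[rotated])
    show "bval (Lt (Var x) b) s" using bound[of i s] Suc.hyps(2) Suc.prems by simp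
    show "runs (While (Lt (Var x) b) body) s' ((N - Suc i) * (T + 2) + 1) (?J N)"
      if "?J (Suc i) s'" for s'
      by (rule Suc.hyps(1)) (use Suc.hyps(2) that in auto)
  qed
  moreover have "N - i = Suc (N - Suc i)" using Suc.hyps(2) by simp
  ultimately show ?case by (elim runs_mono) simp_all
qed

lemma runs_For:
  assumes init: "I 0 (set_reg x 0 s)"
    and step: "\<And>i s. i < N \<Longrightarrow> I i s \<Longrightarrow> reg s x = i \<Longrightarrow>
      runs c s T (\<lambda>s'. reg s' x = i \<and> I (Suc i) (set_reg x (Suc i) s'))"
    and bound: "\<And>i s. I i s \<Longrightarrow> reg s x = i \<Longrightarrow> aval b s = N"
  shows "runs (For x b c) s (N * (T + 2) + 2) (\<lambda>s'. reg s' x = N \<and> I N s')"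
proof -
  have "runs (For x b c) s (1 + ((N - 0) * (T + 2) + 1)) (\<lambda>s'. reg s' x = N \<and> I N s')"
    unfolding For_def
  proof (rule runs_Seq)
    show "runs (x ::= Const 0) s 1 (\<lambda>s'. reg s' x = 0 \<and> I 0 s')"
      by (rule runs_Assign) (use init in simp)
    show "runs (While (Lt (Var x) b) (c ;; x ::= Add (Var x) (Const 1))) s' ((N - 0) * (T + 2) + 1)
        (\<lambda>s'. reg s' x = N \<and> I N s')" if "reg s' x = 0 \<and> I 0 s'" for s'
      by (rule runs_counting_While[OF step bound]) (use that in auto)
  qed
  then show ?thesis by (rule runs_mono) auto
qed

definition unchanged_outside :: "vname set \<Rightarrow> state \<Rightarrow> state \<Rightarrow> bool" where
  "unchanged_outside X s s' \<longleftrightarrow> arr s' = arr s \<and> (\<forall>x. x \<notin> X \<longrightarrow> reg s' x = reg s x)"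

lemma unchanged_outside_refl: "unchanged_outside X s s"
  by (simp add: unchanged_outside_def)

lemma unchanged_outside_trans:
  "unchanged_outside X s s' \<Longrightarrow> unchanged_outside X s' s'' \<Longrightarrow> unchanged_outside X s s''"
  by (simp add: unchanged_outside_def)

lemma unchanged_outside_mono: "unchanged_outside X s s' \<Longrightarrow> X \<subseteq> Y \<Longrightarrow> unchanged_outside Y s s'"
  by (auto simp: unchanged_outside_def)

lemma unchanged_outside_set_reg:
  "x \<in> X \<Longrightarrow> unchanged_outside X s (set_reg x v s') \<longleftrightarrow> unchanged_outside X s s'"
  by (auto simp: unchanged_outside_def)

lemma poly_mono_nat: "x \<le> y \<Longrightarrow> poly (p :: nat poly) x \<le> poly p y"
  by (induction p) (auto intro!: mult_le_mono)


section \<open>Properties that are checked in polynomial time\<close>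

text \<open>The quantifier at nesting depth \<open>d\<close> stores its variable in the register \<open>var d\<close> and counts in
  \<open>cnt d\<close>; a check at depth \<open>d\<close> may overwrite the registers of depth at least \<open>d\<close> only.\<close>

definition var :: "nat \<Rightarrow> vname" where "var i = replicate (Suc i) (CHR ''v'')"
definition cnt :: "nat \<Rightarrow> vname" where "cnt i = replicate (Suc i) (CHR ''c'')"

definition scratch :: "nat \<Rightarrow> vname set" where
  "scratch d = insert ''res'' (var ` {d..} \<union> cnt ` {d..})"

lemma var_cnt_eq_iff [simp]:
  "var i = var j \<longleftrightarrow> i = j" "cnt i = cnt j \<longleftrightarrow> i = j" "var i \<noteq> cnt j" "cnt j \<noteq> var i"
  by (auto simp: var_def cnt_def)

lemma var_cnt_neq_Cons [simp]:
  "c \<noteq> CHR ''v'' \<Longrightarrow> var i \<noteq> c # cs" "c \<noteq> CHR ''v'' \<Longrightarrow> c # cs \<noteq> var i"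
  "c \<noteq> CHR ''c'' \<Longrightarrow> cnt i \<noteq> c # cs" "c \<noteq> CHR ''c'' \<Longrightarrow> c # cs \<noteq> cnt i"
  by (auto simp: var_def cnt_def)

lemma mem_scratch [simp]:
  "''res'' \<in> scratch d" "var i \<in> scratch d \<longleftrightarrow> d \<le> i" "cnt i \<in> scratch d \<longleftrightarrow> d \<le> i"
  "c \<noteq> CHR ''v'' \<Longrightarrow> c \<noteq> CHR ''c'' \<Longrightarrow> c \<noteq> CHR ''r'' \<Longrightarrow> c # cs \<notin> scratch d"
  by (auto simp: scratch_def)

lemma scratch_Suc_subset: "scratch (Suc d) \<subseteq> scratch d"
  by (auto simp: scratch_def)

abbreviation mem_verts :: "state \<Rightarrow> nat set" where
  "mem_verts s \<equiv> {..<reg s ''n''}"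

definition mem_adj :: "state \<Rightarrow> nat adjacency" where
  "mem_adj s i j \<longleftrightarrow> i = j \<or> arr s ''adj'' i j = 1"

type_synonym query = "nat set \<Rightarrow> nat adjacency \<Rightarrow> nat \<Rightarrow> nat list \<Rightarrow> bool"

definition holds :: "nat \<Rightarrow> query \<Rightarrow> state \<Rightarrow> bool" where
  "holds d P s \<longleftrightarrow> P (mem_verts s) (mem_adj s) (reg s ''k'') (map (\<lambda>i. reg s (var i)) [0..<d])"

definition decides :: "nat \<Rightarrow> com \<Rightarrow> nat poly \<Rightarrow> query \<Rightarrow> bool" where
  "decides d c p P \<longleftrightarrow> (\<forall>s. runs c s (poly p (reg s ''n''))
     (\<lambda>s'. unchanged_outside (scratch d) s s' \<and> reg s' ''res'' = of_bool (holds d P s)))"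

definition checkable :: "nat \<Rightarrow> query \<Rightarrow> bool" where
  "checkable d P \<longleftrightarrow> (\<exists>c p. decides d c p P)"

lemma holds_unchanged:
  assumes "unchanged_outside (scratch d) s s'"
  shows "holds d P s' \<longleftrightarrow> holds d P s"
proof -
  have vals: "map (\<lambda>i. reg s' (var i)) [0..<d] = map (\<lambda>i. reg s (var i)) [0..<d]"
    using assms by (simp add: unchanged_outside_def)
  have "mem_adj s' = mem_adj s" "reg s' ''n'' = reg s ''n''" "reg s' ''k'' = reg s ''k''"
    using assms by (simp_all add: unchanged_outside_def mem_adj_def[abs_def])
  then show ?thesis by (simp only: holds_def vals)
qed

definition test :: "bexp \<Rightarrow> com" where
  "test b = Cond b (''res'' ::= Const 1) (''res'' ::= Const 0)"

lemma runs_test: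
  "runs (test b) s 2 (\<lambda>s'. unchanged_outside (scratch d) s s' \<and> reg s' ''res'' = of_bool (bval b s))"
proof -
  have "runs (test b) s (1 + 1)
      (\<lambda>s'. unchanged_outside (scratch d) s s' \<and> reg s' ''res'' = of_bool (bval b s))"
    unfolding test_def
    by (rule runs_Cond; rule runs_Assign)
      (simp_all add: unchanged_outside_set_reg unchanged_outside_refl)
  then show ?thesis by (simp add: numeral_2_eq_2)
qed

lemma checkable_cong:
  assumes "checkable d P" "\<And>V A k xs. finite V \<Longrightarrow> length xs = d \<Longrightarrow> P V A k xs \<longleftrightarrow> Q V A k xs"
  shows "checkable d Q"
  using assms by (simp add: checkable_def decides_def holds_def)

lemma checkable_if_test:
  assumes "\<And>s. bval b s \<longleftrightarrow> holds d P s"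
  shows "checkable d P"
proof -
  have "decides d (test b) [:2:] P"
    using runs_test[of b _ d] assms by (simp add: decides_def)
  then show ?thesis unfolding checkable_def by blast
qed

text \<open>The only terms in the checked conditions are variables.\<close>

definition selects :: "nat \<Rightarrow> (nat list \<Rightarrow> nat) \<Rightarrow> bool" where
  "selects d u \<longleftrightarrow> (\<exists>i<d. \<forall>xs. length xs = d \<longrightarrow> u xs = xs ! i)"

lemma selects_nth: "i < d \<Longrightarrow> selects d (\<lambda>xs. xs ! i)"
  by (auto simp: selects_def)

lemma selects_take: "selects d u \<Longrightarrow> d \<le> e \<Longrightarrow> selects e (\<lambda>xs. u (take d xs))"
  unfolding selects_def by (fastforce intro: less_le_trans)

named_theorems checkable

lemma checkable_adj [checkable]:
  assumes "selects d u" "selects d v"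
  shows "checkable d (\<lambda>V A k xs. A (u xs) (v xs))"
proof -
  obtain i j where "i < d" "\<forall>xs. length xs = d \<longrightarrow> u xs = xs ! i"
    "j < d" "\<forall>xs. length xs = d \<longrightarrow> v xs = xs ! j"
    using assms unfolding selects_def by blast
  then show ?thesis
    by (intro checkable_if_test[of "Neg (Conj (Neg (Eq (Var (var i)) (Var (var j))))
      (Neg (Eq (Read ''adj'' (Var (var i)) (Var (var j))) (Const 1))))"])
      (simp add: holds_def mem_adj_def)
qed

lemma checkable_less [checkable]:
  assumes "selects d u" "selects d v"
  shows "checkable d (\<lambda>V A k xs. u xs < v xs)"
proof -
  obtain i j where "i < d" "\<forall>xs. length xs = d \<longrightarrow> u xs = xs ! i"
    "j < d" "\<forall>xs. length xs = d \<longrightarrow> v xs = xs ! j"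
    using assms unfolding selects_def by blast
  then show ?thesis
    by (intro checkable_if_test[of "Lt (Var (var i)) (Var (var j))"]) (simp add: holds_def)
qed

lemma checkable_eq [checkable]:
  assumes "selects d u" "selects d v"
  shows "checkable d (\<lambda>V A k xs. u xs = v xs)"
proof -
  obtain i j where "i < d" "\<forall>xs. length xs = d \<longrightarrow> u xs = xs ! i"
    "j < d" "\<forall>xs. length xs = d \<longrightarrow> v xs = xs ! j"
    using assms unfolding selects_def by blast
  then show ?thesis
    by (intro checkable_if_test[of "Eq (Var (var i)) (Var (var j))"]) (simp add: holds_def)
qed

lemma checkable_mem_verts [checkable]:
  assumes "selects d u"
  shows "checkable d (\<lambda>V A k xs. u xs \<in> V)"
proof -
  obtain i where "i < d" "\<forall>xs. length xs = d \<longrightarrow> u xs = xs ! i"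
    using assms unfolding selects_def by blast
  then show ?thesis
    by (intro checkable_if_test[of "Lt (Var (var i)) (Var ''n'')"]) (simp add: holds_def)
qed

lemma checkable_not [checkable]:
  assumes "checkable d P"
  shows "checkable d (\<lambda>V A k xs. \<not> P V A k xs)"
proof -
  obtain c p where c: "decides d c p P" using assms by (auto simp: checkable_def)
  have "decides d (c ;; ''res'' ::= Sub (Const 1) (Var ''res'')) (p + 1) (\<lambda>V A k xs. \<not> P V A k xs)"
    unfolding decides_def poly_add poly_1
  proof (intro allI runs_Seq[OF c[unfolded decides_def, rule_format]] runs_Assign)
  qed (auto simp: unchanged_outside_set_reg holds_def)
  then show ?thesis by (auto simp: checkable_def)
qed

lemma checkable_conj [checkable]:
  assumes "checkable d P" "checkable d Q"
  shows "checkable d (\<lambda>V A k xs. P V A k xs \<and> Q V A k xs)"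
proof -
  obtain b p c q where b: "decides d b p P" and c: "decides d c q Q"
    using assms by (auto simp: checkable_def)
  let ?PQ = "\<lambda>V A k xs. P V A k xs \<and> Q V A k xs"
  have "decides d (b ;; Cond (Eq (Var ''res'') (Const 0)) Skip c) (p + (q + 1 + 1)) ?PQ"
    unfolding decides_def poly_add poly_1
  proof (intro allI runs_Seq[OF b[unfolded decides_def, rule_format]] runs_Cond)
    fix s s' assume s': "unchanged_outside (scratch d) s s' \<and> reg s' ''res'' = of_bool (holds d P s)"
    show "runs Skip s' (poly q (reg s ''n'') + 1) (\<lambda>s''. unchanged_outside (scratch d) s s'' \<and>
        reg s'' ''res'' = of_bool (holds d ?PQ s))"
      if "bval (Eq (Var ''res'') (Const 0)) s'"
      using that s' by (intro runs_Skip) (auto simp: holds_def)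
    have "reg s' ''n'' = reg s ''n''" using s' by (auto simp: unchanged_outside_def)
    then have "runs c s' (poly q (reg s ''n'')) (\<lambda>s''. unchanged_outside (scratch d) s' s'' \<and>
        reg s'' ''res'' = of_bool (holds d Q s))"
      using c[unfolded decides_def, rule_format, of s'] holds_unchanged[of d s s' Q] s' by simp
    then show "runs c s' (poly q (reg s ''n'') + 1) (\<lambda>s''. unchanged_outside (scratch d) s s'' \<and>
        reg s'' ''res'' = of_bool (holds d ?PQ s))"
      if "\<not> bval (Eq (Var ''res'') (Const 0)) s'"
      using that s' by (elim runs_mono) (auto simp: holds_def intro: unchanged_outside_trans)
  qed
  then show ?thesis by (auto simp: checkable_def)
qed

lemma checkable_disj [checkable]:
  assumes "checkable d P" "checkable d Q"
  shows "checkable d (\<lambda>V A k xs. P V A k xs \<or> Q V A k xs)"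
proof -
  have "checkable d (\<lambda>V A k xs. \<not> (\<not> P V A k xs \<and> \<not> Q V A k xs))"
    by (intro checkable_not checkable_conj assms)
  then show ?thesis by simp
qed

lemma checkable_imp [checkable]:
  assumes "checkable d P" "checkable d Q"
  shows "checkable d (\<lambda>V A k xs. P V A k xs \<longrightarrow> Q V A k xs)"
  unfolding imp_conv_disj by (intro checkable_disj checkable_not assms)

lemma checkable_iff [checkable]:
  assumes "checkable d P" "checkable d Q"
  shows "checkable d (\<lambda>V A k xs. P V A k xs \<longleftrightarrow> Q V A k xs)"
  unfolding iff_conv_conj_imp by (intro checkable_conj checkable_imp assms)

definition threshold :: "nat \<Rightarrow> nat \<Rightarrow> aexp" where
  "threshold a b = (Add (Var ''k'') ^^ a) (Const b)"

lemma aval_threshold [simp]: "aval (threshold a b) s = a * reg s ''k'' + b"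
  unfolding threshold_def by (induction a) auto

lemma holds_Suc:
  "holds (Suc d) (\<lambda>V A k xs. Q V A k (take d xs) (xs ! d)) s \<longleftrightarrow>
   holds d (\<lambda>V A k xs. Q V A k xs (reg s (var d))) s"
  by (simp add: holds_def nth_append)

lemma runs_count_step:
  assumes "decides (Suc d) c p (\<lambda>V A k xs. Q V A k (take d xs) (xs ! d))"
  shows "runs (c ;; cnt d ::= Add (Var (cnt d)) (Var ''res'')) s (poly p (reg s ''n'') + 1)
    (\<lambda>s'. unchanged_outside (scratch d) s s' \<and> reg s' (var d) = reg s (var d) \<and>
       reg s' (cnt d) = reg s (cnt d) + of_bool (holds d (\<lambda>V A k xs. Q V A k xs (reg s (var d))) s))"
    (is "runs _ _ _ ?Q")
proof (rule runs_Seq[OF assms[unfolded decides_def, rule_format]], rule runs_Assign)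
  fix s' assume s': "unchanged_outside (scratch (Suc d)) s s' \<and>
    reg s' ''res'' = of_bool (holds (Suc d) (\<lambda>V A k xs. Q V A k (take d xs) (xs ! d)) s)"
  then have "unchanged_outside (scratch d) s s'"
    using unchanged_outside_mono[OF _ scratch_Suc_subset] by blast
  moreover have "reg s' (var d) = reg s (var d)" "reg s' (cnt d) = reg s (cnt d)"
    using s' by (auto simp: unchanged_outside_def)
  ultimately show "?Q (set_reg (cnt d) (aval (Add (Var (cnt d)) (Var ''res'')) s') s')"
    using s' by (simp add: unchanged_outside_set_reg holds_Suc)
qed

lemma card_Collect_less_Suc:
  "card {y. y < Suc i \<and> P y} = card {y. y < i \<and> P y} + of_bool (P i)"
proof -
  have "{y. y < Suc i \<and> P y} = (if P i then insert i {y. y < i \<and> P y} else {y. y < i \<and> P y})"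
    by (auto simp: less_Suc_eq)
  then show ?thesis by simp
qed

definition count :: "nat \<Rightarrow> com \<Rightarrow> com" where
  "count d c = cnt d ::= Const 0 ;;
     For (var d) (Var ''n'') (c ;; cnt d ::= Add (Var (cnt d)) (Var ''res''))"

lemma runs_count:
  assumes c: "decides (Suc d) c p (\<lambda>V A k xs. Q V A k (take d xs) (xs ! d))"
  shows "runs (count d c) s (1 + (reg s ''n'' * (poly p (reg s ''n'') + 1 + 2) + 2))
    (\<lambda>s'. unchanged_outside (scratch d) s s' \<and>
       reg s' (cnt d) = card {y \<in> mem_verts s. holds d (\<lambda>V A k xs. Q V A k xs y) s})"
  unfolding count_def
proof (rule runs_Seq[OF runs_Assign[where Q = "\<lambda>s'. s' = _"]])
  let ?n = "reg s ''n''" and ?H = "\<lambda>y. holds d (\<lambda>V A k xs. Q V A k xs y) s"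
  let ?body = "c ;; cnt d ::= Add (Var (cnt d)) (Var ''res'')"
  define I where "I i s' \<longleftrightarrow> unchanged_outside (scratch d) s s' \<and>
    reg s' (cnt d) = card {y \<in> {..<i}. ?H y}" for i s'
  fix s0 assume s0: "s0 = set_reg (cnt d) (aval (Const 0) s) s"
  have "runs (For (var d) (Var ''n'') ?body) s0 (?n * (poly p ?n + 1 + 2) + 2)
      (\<lambda>s'. reg s' (var d) = ?n \<and> I ?n s')"
  proof (rule runs_For)
    show "I 0 (set_reg (var d) 0 s0)"
      by (simp add: I_def s0 unchanged_outside_set_reg unchanged_outside_refl)
    show n: "aval (Var ''n'') s1 = ?n" if "I i s1" for i s1
      using that by (simp add: I_def unchanged_outside_def)
    fix i s1 assume I: "I i s1" and i: "reg s1 (var d) = i"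
    have "holds d (\<lambda>V A k xs. Q V A k xs i) s1 \<longleftrightarrow> ?H i"
      using I holds_unchanged by (simp add: I_def)
    then show "runs ?body s1 (poly p ?n + 1)
        (\<lambda>s'. reg s' (var d) = i \<and> I (Suc i) (set_reg (var d) (Suc i) s'))"
      using runs_count_step[OF c, of s1] n[OF I] I i
      by (elim runs_mono) (auto simp: I_def unchanged_outside_set_reg
          card_Collect_less_Suc intro: unchanged_outside_trans)
  qed
  then show "runs (For (var d) (Var ''n'') ?body) s0 (?n * (poly p ?n + 1 + 2) + 2)
      (\<lambda>s'. unchanged_outside (scratch d) s s' \<and> reg s' (cnt d) = card {y \<in> mem_verts s. ?H y})"
    by (rule runs_mono) (auto simp: I_def)
qed (rule refl)

lemma checkable_card_verts:
  assumes "checkable (Suc d) (\<lambda>V A k xs. Q V A k (take d xs) (xs ! d))"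
  shows "checkable d (\<lambda>V A k xs. a * k + b \<le> card {y \<in> V. Q V A k xs y})"
proof -
  obtain c p where c: "decides (Suc d) c p (\<lambda>V A k xs. Q V A k (take d xs) (xs ! d))"
    using assms by (auto simp: checkable_def)
  let ?P = "\<lambda>V A k xs. a * k + b \<le> card {y \<in> V. Q V A k xs y}"
  have "decides d (count d c ;; test (Neg (Lt (Var (cnt d)) (threshold a b))))
      (1 + ([:0, 1:] * (p + 1 + 2) + 2) + 2) ?P"
    unfolding decides_def
  proof
    fix s
    let ?Q = "\<lambda>s'. unchanged_outside (scratch d) s s' \<and> reg s' ''res'' = of_bool (holds d ?P s)"
    let ?T = "1 + (reg s ''n'' * (poly p (reg s ''n'') + 1 + 2) + 2)"
    have "runs (count d c ;; test (Neg (Lt (Var (cnt d)) (threshold a b)))) s (?T + 2) ?Q"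
    proof (rule runs_Seq[OF runs_count[OF c]])
      fix s1 assume s1: "unchanged_outside (scratch d) s s1 \<and>
        reg s1 (cnt d) = card {y \<in> mem_verts s. holds d (\<lambda>V A k xs. Q V A k xs y) s}"
      then have bval: "bval (Neg (Lt (Var (cnt d)) (threshold a b))) s1 \<longleftrightarrow> holds d ?P s"
        by (simp add: holds_def unchanged_outside_def not_less)
      show "runs (test (Neg (Lt (Var (cnt d)) (threshold a b)))) s1 2 ?Q"
        by (rule runs_mono[OF runs_test[where d = d]])
          (use s1 bval in \<open>auto intro: unchanged_outside_trans\<close>)
    qed
    then show "runs (count d c ;; test (Neg (Lt (Var (cnt d)) (threshold a b)))) s
        (poly (1 + ([:0, 1:] * (p + 1 + 2) + 2) + 2) (reg s ''n'')) ?Q"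
      by simp
  qed
  then show ?thesis unfolding checkable_def by blast
qed

definition checkable_set ::
  "nat \<Rightarrow> (nat set \<Rightarrow> nat adjacency \<Rightarrow> nat \<Rightarrow> nat list \<Rightarrow> nat set) \<Rightarrow> bool" where
  "checkable_set d W \<longleftrightarrow> (\<forall>V A k xs. W V A k xs \<subseteq> V) \<and>
     (\<forall>e u. d \<le> e \<longrightarrow> selects e u \<longrightarrow> checkable e (\<lambda>V A k xs. u xs \<in> W V A k (take d xs)))"

lemma checkable_setI:
  assumes "\<And>V A k xs. W V A k xs \<subseteq> V"
    and "\<And>e u. d \<le> e \<Longrightarrow> selects e u \<Longrightarrow> checkable e (\<lambda>V A k xs. u xs \<in> W V A k (take d xs))"
  shows "checkable_set d W"
  using assms by (simp add: checkable_set_def)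

lemma checkable_setD:
  assumes "checkable_set d W"
  shows "W V A k xs \<subseteq> V"
    and "d \<le> e \<Longrightarrow> selects e u \<Longrightarrow> checkable e (\<lambda>V A k xs. u xs \<in> W V A k (take d xs))"
  using assms by (simp_all add: checkable_set_def)

lemma checkable_mem [checkable]:
  assumes "checkable_set d W" "selects d u"
  shows "checkable d (\<lambda>V A k xs. u xs \<in> W V A k xs)"
  by (rule checkable_cong[OF checkable_setD(2)[OF assms(1) order_refl assms(2)]]) simp

lemma checkable_set_verts [checkable]: "checkable_set d (\<lambda>V A k xs. V)"
  by (intro checkable_setI checkable_mem_verts) simp_all

lemma checkable_set_take [checkable]:
  assumes "checkable_set d W" "d \<le> e"
  shows "checkable_set e (\<lambda>V A k xs. W V A k (take d xs))"
proof (rule checkable_setI)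
  show "checkable e' (\<lambda>V A k xs. u xs \<in> W V A k (take d (take e xs)))"
    if "e \<le> e'" "selects e' u" for e' u
    using checkable_setD(2)[OF assms(1), of e' u] that assms(2) by (simp add: min_absorb1)
qed (rule checkable_setD(1)[OF assms(1)])

lemma checkable_set_Collect [checkable]:
  assumes "checkable_set d W"
    and "\<And>e u. d \<le> e \<Longrightarrow> selects e u \<Longrightarrow> checkable e (\<lambda>V A k xs. Q V A k (take d xs) (u xs))"
  shows "checkable_set d (\<lambda>V A k xs. {y \<in> W V A k xs. Q V A k xs y})"
proof (rule checkable_setI)
  show "{y \<in> W V A k xs. Q V A k xs y} \<subseteq> V" for V A k xs
    using checkable_setD(1)[OF assms(1)] by blast
  show "checkable e (\<lambda>V A k xs. u xs \<in> {y \<in> W V A k (take d xs). Q V A k (take d xs) y})"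
    if "d \<le> e" "selects e u" for e u
    unfolding mem_Collect_eq by (intro checkable_conj checkable_setD(2)[OF assms(1)] assms(2) that)
qed

lemma checkable_set_Diff [checkable]:
  assumes "checkable_set d W" "checkable_set d K"
  shows "checkable_set d (\<lambda>V A k xs. W V A k xs - K V A k xs)"
  unfolding set_diff_eq mem_Collect_eq
  by (rule checkable_set_Collect[OF assms(1)]) (intro checkable_not checkable_setD(2)[OF assms(2)])

lemma checkable_card [checkable]:
  assumes "checkable_set d W"
  shows "checkable d (\<lambda>V A k xs. a * k + b \<le> card (W V A k xs))"
proof -
  have "{y \<in> V. y \<in> W V A k xs} = W V A k xs" for V A k xs
    using checkable_setD(1)[OF assms] by blast
  moreover have "checkable d (\<lambda>V A k xs. a * k + b \<le> card {y \<in> V. y \<in> W V A k xs})"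
    by (intro checkable_card_verts checkable_setD(2)[OF assms] selects_nth) simp_all
  ultimately show ?thesis by simp
qed

lemma checkable_Bex [checkable]:
  assumes "checkable_set d W" "checkable (Suc d) (\<lambda>V A k xs. Q V A k (take d xs) (xs ! d))"
  shows "checkable d (\<lambda>V A k xs. \<exists>y\<in>W V A k xs. Q V A k xs y)"
proof (rule checkable_cong)
  show "checkable d (\<lambda>V A k xs. 0 * k + 1 \<le> card {y \<in> V. y \<in> W V A k xs \<and> Q V A k xs y})"
    by (intro checkable_card_verts checkable_conj assms(2) checkable_setD(2)[OF assms(1)] selects_nth)
      simp_all
  show "0 * k + 1 \<le> card {y \<in> V. y \<in> W V A k xs \<and> Q V A k xs y} \<longleftrightarrow> (\<exists>y\<in>W V A k xs. Q V A k xs y)"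
    if "finite V" for V A k xs
    using that checkable_setD(1)[OF assms(1), of V A k xs] by (auto simp: Suc_le_eq card_gt_0_iff)
qed

lemma checkable_Ball [checkable]:
  assumes "checkable_set d W" "checkable (Suc d) (\<lambda>V A k xs. Q V A k (take d xs) (xs ! d))"
  shows "checkable d (\<lambda>V A k xs. \<forall>y\<in>W V A k xs. Q V A k xs y)"
proof -
  have "checkable d (\<lambda>V A k xs. \<not> (\<exists>y\<in>W V A k xs. \<not> Q V A k xs y))"
    by (intro checkable_not checkable_Bex assms)
  then show ?thesis by simp
qed

lemma checkable_nbhd_le [checkable]:
  assumes "checkable_set d W" "selects d u" "selects d v"
  shows "checkable d (\<lambda>V A k xs. nbhd_le (W V A k xs) A (u xs) (v xs))"
  unfolding nbhd_le_def
  by (intro checkable selects_nth selects_take assms) simp_all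

lemma checkable_nbhd_less [checkable]:
  assumes "checkable_set d W" "selects d u" "selects d v"
  shows "checkable d (\<lambda>V A k xs. nbhd_less (W V A k xs) A (u xs) (v xs))"
  unfolding nbhd_less_def by (intro checkable assms)

lemma checkable_twin [checkable]:
  assumes "checkable_set d W" "selects d u" "selects d v"
  shows "checkable d (\<lambda>V A k xs. twin (W V A k xs) A (u xs) (v xs))"
  unfolding twin_def by (intro checkable assms)

lemma checkable_nested [checkable]:
  assumes "checkable_set d W"
  shows "checkable d (\<lambda>V A k xs. nested (W V A k xs) A)"
  unfolding nested_def
  by (intro checkable selects_nth selects_take assms) simp_all

lemma checkable_set_common_nbhd [checkable]:
  assumes "selects d x" "selects d w"
  shows "checkable_set d (\<lambda>V A k xs. common_nbhd V A (x xs) (w xs))"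
  unfolding common_nbhd_def
  by (intro checkable selects_nth selects_take assms) simp_all

lemma checkable_set_attached [checkable]:
  assumes "checkable_set d K"
  shows "checkable_set d (\<lambda>V A k xs. attached V A (K V A k xs))"
  unfolding attached_def
  by (intro checkable selects_nth selects_take assms) simp_all

lemma checkable_set_simplicial_verts [checkable]:
  assumes "checkable_set d W"
  shows "checkable_set d (\<lambda>V A k xs. simplicial_verts (W V A k xs) A)"
  unfolding simplicial_verts_def
  by (intro checkable selects_nth selects_take assms) simp_all

lemma checkable_is_module [checkable]:
  assumes "checkable_set d K" "checkable_set d M"
  shows "checkable d (\<lambda>V A k xs. is_module V A (K V A k xs) (M V A k xs))"
  unfolding is_module_def subset_eq Diff_iff
  by (intro checkable selects_nth selects_take assms) simp_all

lemma checkable_set_module_over [checkable]: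
  assumes "checkable_set d K"
  shows "checkable_set d (\<lambda>V A k xs. module_over V A (K V A k xs))"
proof -
  have "module_over V A K = {y \<in> V - K. \<exists>u\<in>V - K. A y u \<and>
      is_module V A K {z \<in> V - K. A z u} \<and> nested {z \<in> V - K. A z u} A}"
    for V :: "nat set" and A K by (auto simp: module_over_def)
  then show ?thesis
    by (simp only:) (intro checkable selects_nth selects_take assms; simp)
qed

lemma checkable_set_class_reps [checkable]:
  assumes "checkable_set d W"
    and "\<And>e u v. d \<le> e \<Longrightarrow> selects e u \<Longrightarrow> selects e v \<Longrightarrow>
      checkable e (\<lambda>V A k xs. E V A k (take d xs) (u xs) (v xs))"
  shows "checkable_set d (\<lambda>V A k xs. class_reps (W V A k xs) (E V A k xs))"
  unfolding class_reps_def
  by (intro checkable selects_nth selects_take assms)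
    (auto intro!: assms(2) selects_nth selects_take)

lemma checkable_set_teeth [checkable]:
  assumes "selects d p" "selects d q"
  shows "checkable_set d (\<lambda>V A k xs. teeth V A (p xs) (q xs))"
  unfolding teeth_def by (intro checkable selects_nth selects_take assms) simp_all

lemma checkable_set_shaft [checkable]:
  assumes "selects d p" "selects d q"
  shows "checkable_set d (\<lambda>V A k xs. shaft V A (p xs) (q xs))"
  unfolding shaft_def by (intro checkable selects_nth selects_take assms) simp_all

lemma checkable_comb [checkable]:
  assumes "selects d p" "selects d q"
  shows "checkable d (\<lambda>V A k xs. comb V A (p xs) (q xs))"
  unfolding comb_def by (intro checkable selects_nth selects_take assms) simp_all

lemma checkable_rule_twin [checkable]:
  assumes "selects d v"
  shows "checkable d (\<lambda>V A k xs. rule_twin V A k (v xs))"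
  unfolding rule_twin_def by (intro checkable selects_nth selects_take assms) simp_all

lemma checkable_rule_module [checkable]:
  assumes "selects d v"
  shows "checkable d (\<lambda>V A k xs. rule_module V A k (v xs))"
  unfolding rule_module_def Let_def by (intro checkable selects_nth selects_take assms) simp_all

lemma checkable_rule_comb [checkable]:
  assumes "selects d v"
  shows "checkable d (\<lambda>V A k xs. rule_comb V A k (v xs))"
  unfolding rule_comb_def by (intro checkable selects_nth selects_take assms) simp_all

lemma checkable_deletable: "checkable 1 (\<lambda>V A k xs. deletable V A k (xs ! 0))"
  unfolding deletable_def by (intro checkable selects_nth) simp_all


section \<open>The kernelization program\<close>

definition valid :: "state \<Rightarrow> bool" where
  "valid s \<longleftrightarrow> (\<forall>i<reg s ''n''. \<forall>j<reg s ''n''. arr s ''adj'' i j \<le> 1 \<and>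
     arr s ''adj'' i j = arr s ''adj'' j i \<and> arr s ''adj'' i i = 0)"

definition solvable :: "state \<Rightarrow> bool" where
  "solvable s \<longleftrightarrow> editable (mem_verts s) (mem_adj s) (reg s ''k'')"

definition removable :: "state \<Rightarrow> nat \<Rightarrow> bool" where
  "removable s v \<longleftrightarrow> deletable (mem_verts s) (mem_adj s) (reg s ''k'') v"

definition reduced :: "state \<Rightarrow> bool" where
  "reduced s \<longleftrightarrow> (\<forall>v<reg s ''n''. \<not> removable s v)"

lemma reflexive_graph_mem: "valid s \<Longrightarrow> reflexive_graph (mem_verts s) (mem_adj s)"
  by unfold_locales (auto simp: valid_def mem_adj_def)

lemma instance_unchanged:
  assumes "unchanged_outside X s s'" "''n'' \<notin> X" "''k'' \<notin> X"
  shows "valid s' \<longleftrightarrow> valid s" "solvable s' \<longleftrightarrow> solvable s" "removable s' = removable s"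
    "reduced s' \<longleftrightarrow> reduced s"
  using assms
  by (simp_all add: unchanged_outside_def valid_def solvable_def removable_def[abs_def] reduced_def
      mem_adj_def[abs_def])

definition move_last :: "nat \<Rightarrow> nat \<Rightarrow> nat \<Rightarrow> nat" where
  "move_last n v i = (if i = v then n - 1 else i)"

lemma bij_betw_move_last:
  assumes "v < n"
  shows "bij_betw (move_last n v) {..<n - 1} ({..<n} - {v})"
proof (rule bij_betw_byWitness[where f' = "\<lambda>j. if j = n - 1 then v else j"])
qed (use assms in \<open>auto simp: move_last_def\<close>)

lemma instance_delete:
  assumes s: "valid s" "v < reg s ''n''" "removable s v"
    and s': "reg s' ''n'' = reg s ''n'' - 1" "reg s' ''k'' = reg s ''k''"
    and adj: "\<And>i j. i < reg s' ''n'' \<Longrightarrow> j < reg s' ''n'' \<Longrightarrow>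
      arr s' ''adj'' i j = arr s ''adj'' (move_last (reg s ''n'') v i) (move_last (reg s ''n'') v j)"
  shows "valid s'" "solvable s' \<longleftrightarrow> solvable s"
proof -
  let ?n = "reg s ''n''" and ?\<sigma> = "move_last (reg s ''n'') v"
  have bij: "bij_betw ?\<sigma> (mem_verts s') (mem_verts s - {v})"
    using bij_betw_move_last[OF s(2)] s'(1) by simp
  have less: "?\<sigma> i < ?n" if "i < reg s' ''n''" for i
    using bij_betwE[OF bij] that by auto
  show "valid s'"
    unfolding valid_def
  proof (intro allI impI)
    fix i j assume ij: "i < reg s' ''n''" "j < reg s' ''n''"
    show "arr s' ''adj'' i j \<le> 1 \<and> arr s' ''adj'' i j = arr s' ''adj'' j i \<and> arr s' ''adj'' i i = 0"
      unfolding adj[OF ij] adj[OF ij(2,1)] adj[OF ij(1,1)]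
      using s(1) less[OF ij(1)] less[OF ij(2)] unfolding valid_def by blast
  qed
  have "mem_adj s' i j \<longleftrightarrow> mem_adj s (?\<sigma> i) (?\<sigma> j)" if "i \<in> mem_verts s'" "j \<in> mem_verts s'" for i j
    using inj_on_eq_iff[OF bij_betw_imp_inj_on[OF bij] that] that adj by (simp add: mem_adj_def)
  then have "solvable s' \<longleftrightarrow> editable (mem_verts s - {v}) (mem_adj s) (reg s ''k'')"
    unfolding solvable_def s'(2) by (rule editable_cong_bij[OF bij])
  also have "\<dots> \<longleftrightarrow> solvable s"
    using editable_delete_iff[OF reflexive_graph_mem[OF s(1)]] s(2,3)
    by (simp add: solvable_def removable_def)
  finally show "solvable s' \<longleftrightarrow> solvable s" .
qed

lemma runs_For_Store:
  assumes init: "M 0 = arr s A"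
    and bound: "\<And>i s'. reg s' = (reg s)(x := i) \<Longrightarrow> aval c s' = N"
    and step: "\<And>i s'. i < N \<Longrightarrow> reg s' = (reg s)(x := i) \<Longrightarrow> arr s' A = M i \<Longrightarrow>
      (M i)(aval a s' := (M i (aval a s'))(aval b s' := aval e s')) = M (Suc i)"
  shows "runs (For x c (Store A a b e)) s (N * (1 + 2) + 2)
    (\<lambda>s'. reg s' = (reg s)(x := N) \<and> arr s' A = M N)"
proof -
  let ?I = "\<lambda>i (s' :: state). reg s' = (reg s)(x := i) \<and> arr s' A = M i"
  have "runs (For x c (Store A a b e)) s (N * (1 + 2) + 2) (\<lambda>s'. reg s' x = N \<and> ?I N s')"
  proof (rule runs_For)
    fix i and s1 :: state assume "?I i s1"
    show "runs (Store A a b e) s1 1 (\<lambda>s'. reg s' x = i \<and> ?I (Suc i) (set_reg x (Suc i) s'))"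
      if "i < N" using step[of i s1] that \<open>?I i s1\<close> by (intro runs_Store) simp
    show "aval c s1 = N" by (rule bound) (use \<open>?I i s1\<close> in blast)
  qed (simp add: init)
  then show ?thesis by (rule runs_mono) auto
qed

definition overwrite_row :: com where
  "overwrite_row = For ''i'' (Var ''n'')
     (Store ''adj'' (Var ''u'') (Var ''i'') (Read ''adj'' (Sub (Var ''n'') (Const 1)) (Var ''i'')))"

definition overwrite_column :: com where
  "overwrite_column = For ''i'' (Var ''n'')
     (Store ''adj'' (Var ''i'') (Var ''u'') (Read ''adj'' (Var ''i'') (Sub (Var ''n'') (Const 1))))"

text \<open>The last vertex takes the place of the deleted vertex, which is number \<open>u - 1\<close>.\<close>

definition delete_vertex :: com where
  "delete_vertex = ''u'' ::= Sub (Var ''u'') (Const 1) ;; overwrite_row ;; overwrite_column ;;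
     ''n'' ::= Sub (Var ''n'') (Const 1)"

abbreviation delete_time :: "nat poly" where
  "delete_time \<equiv> 1 + ([:0, 1:] * (1 + 2) + 2 + ([:0, 1:] * (1 + 2) + 2 + 1))"

lemma runs_delete_vertex:
  fixes s
  defines "n \<equiv> reg s ''n''" and "v \<equiv> reg s ''u'' - 1"
  shows "runs delete_vertex s (poly delete_time n)
     (\<lambda>s'. (\<forall>x. x \<notin> {''u'', ''i'', ''n''} \<longrightarrow> reg s' x = reg s x) \<and> reg s' ''n'' = n - 1 \<and>
        (\<forall>i<n. \<forall>j<n. arr s' ''adj'' i j = arr s ''adj'' (move_last n v i) (move_last n v j)))"
    (is "runs _ _ _ ?Q")
proof -
  let ?M = "arr s ''adj''"
  define rows where "rows m r c = (if r = v \<and> c < m then ?M (n - 1) c else ?M r c)" for m r c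
  define cols where "cols m r c = (if c = v \<and> r < m then rows n r (n - 1) else rows n r c)"
    for m r c
  have "runs delete_vertex s (1 + (n * (1 + 2) + 2 + (n * (1 + 2) + 2 + 1))) ?Q"
    unfolding delete_vertex_def
  proof (rule runs_Seq)
    show "runs (''u'' ::= Sub (Var ''u'') (Const 1)) s 1
        (\<lambda>s'. reg s' = (reg s)(''u'' := v) \<and> arr s' = arr s)"
      by (rule runs_Assign) (simp add: v_def)
    fix s1 :: state assume s1: "reg s1 = (reg s)(''u'' := v) \<and> arr s1 = arr s"
    show "runs (overwrite_row ;; overwrite_column ;; ''n'' ::= Sub (Var ''n'') (Const 1)) s1
        (n * (1 + 2) + 2 + (n * (1 + 2) + 2 + 1)) ?Q"
      unfolding overwrite_row_def
    proof (rule runs_Seq[OF runs_For_Store[of rows]])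
      fix s2 :: state assume s2: "reg s2 = (reg s1)(''i'' := n) \<and> arr s2 ''adj'' = rows n"
      show "runs (overwrite_column ;; ''n'' ::= Sub (Var ''n'') (Const 1)) s2
          (n * (1 + 2) + 2 + 1) ?Q"
        unfolding overwrite_column_def
      proof (rule runs_Seq[OF runs_For_Store[of cols]])
        fix s3 :: state assume "reg s3 = (reg s2)(''i'' := n) \<and> arr s3 ''adj'' = cols n"
        then show "runs (''n'' ::= Sub (Var ''n'') (Const 1)) s3 1 ?Q"
          using s1 s2 by (intro runs_Assign)
            (auto simp: n_def[symmetric] cols_def rows_def move_last_def)
      qed (use s1 s2 in \<open>auto simp: n_def[symmetric] cols_def fun_eq_iff\<close>)
    qed (use s1 in \<open>auto simp: n_def[symmetric] rows_def fun_eq_iff\<close>)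
  qed
  then show ?thesis by (elim runs_mono) simp_all
qed

locale deletability_checker =
  fixes check :: com and p :: "nat poly"
  assumes check: "decides 1 check p (\<lambda>V A k xs. deletable V A k (xs ! 0))"
begin

lemma runs_check:
  "runs check s (poly p (reg s ''n''))
     (\<lambda>s'. unchanged_outside (scratch 1) s s' \<and>
        reg s' ''res'' = of_bool (removable s (reg s (var 0))))"
  using check by (simp add: decides_def holds_def removable_def)

definition record_if_removable :: com where
  "record_if_removable =
     check ;; Cond (Eq (Var ''res'') (Const 1)) (''u'' ::= Add (Var (var 0)) (Const 1)) Skip"

lemma runs_record_if_removable:
  "runs record_if_removable s (poly p (reg s ''n'') + (1 + 1))
     (\<lambda>s'. unchanged_outside (insert ''u'' (scratch 0)) s s' \<and> reg s' (var 0) = reg s (var 0) \<and>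
        reg s' ''u'' = (if removable s (reg s (var 0)) then Suc (reg s (var 0)) else reg s ''u''))"
    (is "runs _ _ _ ?Q")
  unfolding record_if_removable_def
proof (rule runs_Seq[OF runs_check])
  fix s' assume s': "unchanged_outside (scratch 1) s s' \<and>
    reg s' ''res'' = of_bool (removable s (reg s (var 0)))"
  then have "unchanged_outside (insert ''u'' (scratch 0)) s s'"
    using unchanged_outside_mono[of "scratch 1" s s' "insert ''u'' (scratch 0)"]
      scratch_Suc_subset[of 0] by auto
  moreover have "reg s' (var 0) = reg s (var 0)" "reg s' ''u'' = reg s ''u''"
    using s' by (simp_all add: unchanged_outside_def)
  ultimately show "runs (Cond (Eq (Var ''res'') (Const 1)) (''u'' ::= Add (Var (var 0)) (Const 1)) Skip)
      s' (1 + 1) ?Q"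
    using s' by (cases "removable s (reg s (var 0))"; intro runs_Cond runs_Assign runs_Skip)
      (auto simp: unchanged_outside_set_reg)
qed

text \<open>Register \<open>u\<close> receives the successor of a deletable vertex, or zero if there is none.\<close>

definition find_vertex :: com where
  "find_vertex = ''u'' ::= Const 0 ;; For (var 0) (Var ''n'') record_if_removable"

abbreviation find_time :: "nat poly" where
  "find_time \<equiv> 1 + ([:0, 1:] * (p + (1 + 1) + 2) + 2)"

lemma runs_find_vertex:
  "runs find_vertex s (poly find_time (reg s ''n''))
     (\<lambda>s'. unchanged_outside (insert ''u'' (scratch 0)) s s' \<and>
        (reg s' ''u'' = 0 \<and> reduced s \<or> (\<exists>v<reg s ''n''. reg s' ''u'' = Suc v \<and> removable s v)))"
proof -
  let ?n = "reg s ''n''" and ?X = "insert ''u'' (scratch 0)"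
  define I where "I i s' \<longleftrightarrow> unchanged_outside ?X s s' \<and>
      (reg s' ''u'' = 0 \<and> (\<forall>v<i. \<not> removable s v) \<or> (\<exists>v<?n. reg s' ''u'' = Suc v \<and> removable s v))"
    for i s'
  have "runs find_vertex s (1 + (?n * (poly p ?n + (1 + 1) + 2) + 2))
      (\<lambda>s'. reg s' (var 0) = ?n \<and> I ?n s')"
    unfolding find_vertex_def
  proof (rule runs_Seq[OF runs_Assign[where Q = "\<lambda>s'. s' = _"]], rule refl, rule runs_For)
    fix s0 assume "s0 = set_reg ''u'' (aval (Const 0) s) s"
    then show "I 0 (set_reg (var 0) 0 s0)"
      by (simp add: I_def unchanged_outside_set_reg unchanged_outside_refl)
  next
    show n: "aval (Var ''n'') s1 = ?n" if "I i s1" for i s1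
      using that by (simp add: I_def unchanged_outside_def)
    fix i s1 assume i: "i < ?n" "reg s1 (var 0) = i" and I: "I i s1"
    have "removable s1 = removable s"
      using I instance_unchanged(3)[of ?X s s1] by (simp add: I_def)
    then show "runs record_if_removable s1 (poly p ?n + (1 + 1))
        (\<lambda>s'. reg s' (var 0) = i \<and> I (Suc i) (set_reg (var 0) (Suc i) s'))"
      using runs_record_if_removable[of s1] n[OF I] i I
      by (elim runs_mono) (auto simp: I_def unchanged_outside_set_reg less_Suc_eq
          intro: unchanged_outside_trans split: if_splits)
  qed
  then have "runs find_vertex s (poly find_time ?n) (\<lambda>s'. reg s' (var 0) = ?n \<and> I ?n s')" by simp
  then show ?thesis by (rule runs_mono) (auto simp: I_def reduced_def)
qed

definition reduce_step :: com where
  "reduce_step = find_vertex ;; Cond (Eq (Var ''u'') (Const 0)) Skip delete_vertex"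

abbreviation step_time :: "nat poly" where
  "step_time \<equiv> find_time + (delete_time + 1)"

lemma runs_reduce_step:
  assumes valid: "valid s"
  shows "runs reduce_step s (poly step_time (reg s ''n''))
     (\<lambda>s'. valid s' \<and> (solvable s' \<longleftrightarrow> solvable s) \<and>
        (\<forall>x\<in>{''k'', ''m'', ''j''}. reg s' x = reg s x) \<and>
        (reduced s' \<and> reg s' ''n'' = reg s ''n'' \<or> \<not> reduced s \<and> Suc (reg s' ''n'') = reg s ''n''))"
    (is "runs _ _ _ ?Q")
proof -
  let ?n = "reg s ''n''"
  have "runs reduce_step s (poly find_time ?n + (poly delete_time ?n + 1)) ?Q"
    unfolding reduce_step_def
  proof (rule runs_Seq[OF runs_find_vertex runs_Cond])
    fix s1 :: state assume s1: "unchanged_outside (insert ''u'' (scratch 0)) s s1 \<and>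
      (reg s1 ''u'' = 0 \<and> reduced s \<or> (\<exists>v<?n. reg s1 ''u'' = Suc v \<and> removable s v))"
    have same: "valid s1" "solvable s1 \<longleftrightarrow> solvable s" "removable s1 = removable s"
      "reduced s1 \<longleftrightarrow> reduced s"
      using instance_unchanged[of "insert ''u'' (scratch 0)" s s1] s1 valid by auto
    have regs: "reg s1 ''n'' = ?n" "\<forall>x\<in>{''k'', ''m'', ''j''}. reg s1 x = reg s x"
      using s1 by (auto simp: unchanged_outside_def)
    show "runs Skip s1 (poly delete_time ?n) ?Q" if "bval (Eq (Var ''u'') (Const 0)) s1"
      using that s1 same regs by (intro runs_Skip) auto
    assume "\<not> bval (Eq (Var ''u'') (Const 0)) s1"
    then obtain v where v: "v < ?n" "reg s1 ''u'' = Suc v" "removable s v" using s1 by auto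
    show "runs delete_vertex s1 (poly delete_time ?n) ?Q"
      using runs_delete_vertex[of s1] unfolding regs(1)
    proof (rule runs_mono[OF _ order_refl])
      fix s' :: state
      assume s': "(\<forall>x. x \<notin> {''u'', ''i'', ''n''} \<longrightarrow> reg s' x = reg s1 x) \<and> reg s' ''n'' = ?n - 1 \<and>
        (\<forall>i<?n. \<forall>j<?n. arr s' ''adj'' i j =
          arr s1 ''adj'' (move_last ?n (reg s1 ''u'' - 1) i) (move_last ?n (reg s1 ''u'' - 1) j))"
      then have "valid s'" "solvable s' \<longleftrightarrow> solvable s1"
        using v same regs by (intro instance_delete[of s1 v s']; simp)+
      moreover have "\<not> reduced s" using v(1,3) by (auto simp: reduced_def)
      ultimately show "?Q s'" using s' same(2) regs v(1) by auto
    qed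
  qed
  then show ?thesis by simp
qed

definition reduce :: com where
  "reduce = ''m'' ::= Var ''n'' ;; For ''j'' (Var ''m'') reduce_step"

abbreviation reduce_time :: "nat poly" where
  "reduce_time \<equiv> 1 + ([:0, 1:] * (step_time + 2) + 2)"

lemma runs_reduce:
  assumes "valid s"
  shows "runs reduce s (poly reduce_time (reg s ''n''))
     (\<lambda>s'. valid s' \<and> (solvable s' \<longleftrightarrow> solvable s) \<and> reduced s' \<and> reg s' ''k'' = reg s ''k'')"
proof -
  let ?n = "reg s ''n''"
  define I where "I i s' \<longleftrightarrow> valid s' \<and> (solvable s' \<longleftrightarrow> solvable s) \<and> reg s' ''k'' = reg s ''k'' \<and>
    reg s' ''m'' = ?n \<and> reg s' ''n'' \<le> ?n \<and> (reduced s' \<or> reg s' ''n'' + i \<le> ?n)" for i s'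
  have set_reg: "valid (set_reg x c s') = valid s'" "solvable (set_reg x c s') = solvable s'"
    "reduced (set_reg x c s') = reduced s'" if "x \<notin> {''n'', ''k''}" for x c s'
    using instance_unchanged[of "{x}" s' "set_reg x c s'"] that
    by (auto simp: unchanged_outside_set_reg unchanged_outside_refl)
  have "runs reduce s (1 + (?n * (poly step_time ?n + 2) + 2)) (\<lambda>s'. reg s' ''j'' = ?n \<and> I ?n s')"
    unfolding reduce_def
  proof (rule runs_Seq[OF runs_Assign[where Q = "\<lambda>s'. s' = _"]], rule refl, rule runs_For)
    fix s0 assume "s0 = set_reg ''m'' (aval (Var ''n'') s) s"
    then show "I 0 (set_reg ''j'' 0 s0)" using assms by (simp add: I_def set_reg)
  next
    show "aval (Var ''m'') s1 = ?n" if "I i s1" for i s1 using that by (simp add: I_def)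
    fix i s1 assume I: "I i s1" and i: "reg s1 ''j'' = i"
    show "runs reduce_step s1 (poly step_time ?n)
        (\<lambda>s'. reg s' ''j'' = i \<and> I (Suc i) (set_reg ''j'' (Suc i) s'))"
    proof (rule runs_mono[OF runs_reduce_step])
      show "valid s1" using I by (simp add: I_def)
      show "poly step_time (reg s1 ''n'') \<le> poly step_time ?n"
        by (rule poly_mono_nat) (use I in \<open>simp add: I_def\<close>)
    qed (use I i in \<open>auto simp: I_def set_reg\<close>)
  qed
  then have "runs reduce s (poly reduce_time ?n) (\<lambda>s'. reg s' ''j'' = ?n \<and> I ?n s')" by simp
  then show ?thesis by (rule runs_mono) (auto simp: I_def reduced_def)
qed

end

text \<open>Without multiplication, the bound \<open>176 * (k + 1) ^ 3\<close> is computed by counting it out in nested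
  loops.\<close>

definition adds :: "com \<Rightarrow> vname set \<Rightarrow> (nat \<Rightarrow> nat) \<Rightarrow> nat poly \<Rightarrow> bool" where
  "adds c X w p \<longleftrightarrow> (\<forall>s. runs c s (poly p (reg s ''k''))
     (\<lambda>s'. unchanged_outside (insert ''b'' X) s s' \<and> reg s' ''b'' = reg s ''b'' + w (reg s ''k'')))"

lemma adds_For:
  assumes c: "adds c X w p" and x: "x \<notin> insert ''b'' X" "''k'' \<notin> insert x X" "''b'' \<notin> X"
  shows "adds (For x (Add (Var ''k'') (Const 1)) c) (insert x X)
    (\<lambda>k. (k + 1) * w k) ([:1, 1:] * (p + 2) + 2)"
  unfolding adds_def
proof
  fix s :: state
  let ?k = "reg s ''k''" and ?X = "insert ''b'' (insert x X)"
  define I where "I i s' \<longleftrightarrow> unchanged_outside ?X s s' \<and> reg s' ''b'' = reg s ''b'' + i * w ?k"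
    for i :: nat and s' :: state
  have k: "reg s' ''k'' = ?k" if "I i s'" for i s'
    using that x(2) by (auto simp: I_def unchanged_outside_def)
  have "runs (For x (Add (Var ''k'') (Const 1)) c) s ((?k + 1) * (poly p ?k + 2) + 2)
      (\<lambda>s'. reg s' x = ?k + 1 \<and> I (?k + 1) s')"
  proof (rule runs_For)
    show "I 0 (set_reg x 0 s)"
      using x(1) by (auto simp: I_def unchanged_outside_set_reg unchanged_outside_refl)
    fix i s1 assume I: "I i s1" and i: "reg s1 x = i"
    show "aval (Add (Var ''k'') (Const 1)) s1 = ?k + 1" using k[OF I] by simp
    have "runs c s1 (poly p ?k) (\<lambda>s'. unchanged_outside (insert ''b'' X) s1 s' \<and>
        reg s' ''b'' = reg s1 ''b'' + w ?k)"
      using c[unfolded adds_def, rule_format, of s1] k[OF I] by simp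
    then show "runs c s1 (poly p ?k) (\<lambda>s'. reg s' x = i \<and> I (Suc i) (set_reg x (Suc i) s'))"
    proof (rule runs_mono[OF _ order_refl])
      fix s2 assume s2: "unchanged_outside (insert ''b'' X) s1 s2 \<and> reg s2 ''b'' = reg s1 ''b'' + w ?k"
      then have "unchanged_outside ?X s s2"
        using I unchanged_outside_trans[of ?X s s1 s2]
          unchanged_outside_mono[of "insert ''b'' X" s1 s2 ?X]
        by (auto simp: I_def)
      moreover have "reg s2 x = i" using s2 i x(1) by (auto simp: unchanged_outside_def)
      ultimately show "reg s2 x = i \<and> I (Suc i) (set_reg x (Suc i) s2)"
        using s2 I x(1) by (auto simp: I_def unchanged_outside_set_reg)
    qed
  qed
  then show "runs (For x (Add (Var ''k'') (Const 1)) c) s (poly ([:1, 1:] * (p + 2) + 2) ?k)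
    (\<lambda>s'. unchanged_outside ?X s s' \<and> reg s' ''b'' = reg s ''b'' + (?k + 1) * w ?k)"
    by (elim runs_mono) (simp_all add: I_def)
qed

definition count_out :: com where
  "count_out =
     For ''x'' (Add (Var ''k'') (Const 1)) (For ''y'' (Add (Var ''k'') (Const 1))
       (For ''z'' (Add (Var ''k'') (Const 1)) (''b'' ::= Add (Var ''b'') (Const 176))))"

definition count_time :: "nat poly" where
  "count_time = [:1, 1:] * ([:1, 1:] * ([:1, 1:] * (1 + 2) + 2 + 2) + 2 + 2) + 2"

lemma adds_count_out: "adds count_out {''x'', ''y'', ''z''} (\<lambda>k. 176 * (k + 1) ^ 3) count_time"
proof -
  have "adds (''b'' ::= Add (Var ''b'') (Const 176)) {} (\<lambda>_. 176) 1"
    unfolding adds_def poly_1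
    by (intro allI runs_Assign) (simp add: unchanged_outside_set_reg unchanged_outside_refl)
  then have "adds count_out {''x'', ''y'', ''z''} (\<lambda>k. (k + 1) * ((k + 1) * ((k + 1) * 176)))
      count_time"
    unfolding count_out_def count_time_def by (intro adds_For) simp_all
  moreover have "(k + 1) * ((k + 1) * ((k + 1) * 176)) = 176 * (k + 1) ^ 3" for k :: nat
    by (simp only: power3_eq_cube mult_ac)
  ultimately show ?thesis by (simp only:)
qed

definition size_bound :: com where
  "size_bound = ''b'' ::= Const 0 ;; count_out"

abbreviation bound_time :: "nat poly" where
  "bound_time \<equiv> 1 + count_time"

lemma runs_size_bound:
  "runs size_bound s (poly bound_time (reg s ''k''))
     (\<lambda>s'. unchanged_outside {''b'', ''x'', ''y'', ''z''} s s' \<and>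
       reg s' ''b'' = 176 * (reg s ''k'' + 1) ^ 3)"
  unfolding size_bound_def poly_add poly_1
proof (rule runs_Seq)
  show "runs (''b'' ::= Const 0) s 1 (\<lambda>s'. s' = set_reg ''b'' 0 s)"
    by (rule runs_Assign) simp
  show "runs count_out s0 (poly count_time (reg s ''k''))
      (\<lambda>s'. unchanged_outside {''b'', ''x'', ''y'', ''z''} s s' \<and>
        reg s' ''b'' = 176 * (reg s ''k'' + 1) ^ 3)" if "s0 = set_reg ''b'' 0 s" for s0
    using adds_count_out[unfolded adds_def, rule_format, of s0] that
    by (elim runs_mono) (simp_all add: unchanged_outside_def)
qed

primrec write_adj :: "(nat \<Rightarrow> nat \<Rightarrow> nat) \<Rightarrow> (nat \<times> nat) list \<Rightarrow> com" where
  "write_adj M [] = Skip"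
| "write_adj M (e # es) =
     Store ''adj'' (Const (fst e)) (Const (snd e)) (Const (M (fst e) (snd e))) ;; write_adj M es"

lemma runs_write_adj:
  "runs (write_adj M es) s (length es + 1) (\<lambda>s'. reg s' = reg s \<and>
     (\<forall>i j. arr s' ''adj'' i j = (if (i, j) \<in> set es then M i j else arr s ''adj'' i j)))"
proof (induction es arbitrary: s)
  case Nil
  show ?case by (auto intro: runs_Skip)
next
  case (Cons e es)
  let ?store = "Store ''adj'' (Const (fst e)) (Const (snd e)) (Const (M (fst e) (snd e)))"
  have "runs (write_adj M (e # es)) s (1 + (length es + 1)) (\<lambda>s'. reg s' = reg s \<and>
     (\<forall>i j. arr s' ''adj'' i j = (if (i, j) \<in> set (e # es) then M i j else arr s ''adj'' i j)))"
    unfolding write_adj.simps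
  proof (rule runs_Seq)
    show "runs ?store s 1 (\<lambda>s'. s' = set_arr ''adj'' (fst e) (snd e) (M (fst e) (snd e)) s)"
      by (rule runs_Store) simp
    show "runs (write_adj M es) s1 (length es + 1) (\<lambda>s'. reg s' = reg s \<and>
        (\<forall>i j. arr s' ''adj'' i j = (if (i, j) \<in> set (e # es) then M i j else arr s ''adj'' i j)))"
      if "s1 = set_arr ''adj'' (fst e) (snd e) (M (fst e) (snd e)) s" for s1
      using Cons.IH[of s1] by (rule runs_mono) (auto simp: that prod_eq_iff)
  qed
  then show ?case by simp
qed

text \<open>The cycle on four vertices with parameter \<open>0\<close>.\<close>

definition no_instance :: com where
  "no_instance = ''n'' ::= Const 4 ;; ''k'' ::= Const 0 ;;
     write_adj (\<lambda>i j. (i + j) mod 2) (List.product [0..<4] [0..<4])"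

lemma runs_no_instance:
  "runs no_instance s 19 (\<lambda>s'. reg s' ''n'' = 4 \<and> reg s' ''k'' = 0 \<and>
     (\<forall>i<4. \<forall>j<4. arr s' ''adj'' i j = (i + j) mod 2))" (is "runs _ _ _ ?Q")
proof -
  let ?pairs = "List.product [0..<4] [0..<4] :: (nat \<times> nat) list"
  have "runs no_instance s (1 + (1 + (length ?pairs + 1))) ?Q"
    unfolding no_instance_def
  proof (intro runs_Seq)
    show "runs (''n'' ::= Const 4) s 1 (\<lambda>s'. reg s' ''n'' = 4)" by (rule runs_Assign) simp
    show "runs (''k'' ::= Const 0) s1 1 (\<lambda>s'. reg s' ''n'' = 4 \<and> reg s' ''k'' = 0)"
      if "reg s1 ''n'' = 4" for s1
      using that by (intro runs_Assign) simp
    show "runs (write_adj (\<lambda>i j. (i + j) mod 2) ?pairs) s2 (length ?pairs + 1) ?Q"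
      if "reg s2 ''n'' = 4 \<and> reg s2 ''k'' = 0" for s2
      using runs_write_adj by (rule runs_mono) (use that in auto)
  qed
  then show ?thesis by simp
qed

lemma no_instance_unsolvable:
  assumes "reg s ''n'' = 4" "reg s ''k'' = 0" "\<forall>i<4. \<forall>j<4. arr s ''adj'' i j = (i + j) mod 2"
  shows "valid s" "\<not> solvable s"
proof -
  show "valid s" using assms(1,3) by (auto simp: valid_def add.commute)
  show "\<not> solvable s"
  proof
    assume "solvable s"
    then obtain B where "nested {..<4} B" "card (disagreements {..<4} (mem_adj s) B) \<le> 0"
      unfolding solvable_def editable_def assms by blast
    moreover have "finite (disagreements {..<4} (mem_adj s) B)" by (rule finite_disagreements) simp
    ultimately have eq: "\<And>i j. i < 4 \<Longrightarrow> j < 4 \<Longrightarrow> B i j \<longleftrightarrow> mem_adj s i j" and nest: "nested {..<4} B"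
      by (auto simp: disagreements_def)
    have "B 1 2" "B 0 1" "\<not> B 0 2" "B 3 2" "\<not> B 3 1"
      using assms(3) by (auto simp: eq mem_adj_def)
    then show False using nested_chord[OF nest, of 0 1 2 3] by simp
  qed
qed

context deletability_checker
begin

definition kernelize :: com where
  "kernelize = reduce ;; size_bound ;; Cond (Lt (Var ''b'') (Var ''n'')) no_instance Skip"

definition kernel_time :: "nat poly" where
  "kernel_time = reduce_time + (bound_time + (19 + 1))"

lemma card_le_if_reduced:
  assumes "valid s" "reduced s" "solvable s"
  shows "reg s ''n'' \<le> 176 * (reg s ''k'' + 1) ^ 3"
  using card_le_if_irreducible[OF reflexive_graph_mem[OF assms(1)], of "reg s ''k''"] assms(2,3)
  by (simp add: reduced_def solvable_def removable_def)

lemma runs_kernelize: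
  assumes valid: "valid s"
  shows "runs kernelize s (poly kernel_time (reg s ''n'' + reg s ''k''))
     (\<lambda>s'. valid s' \<and> (solvable s' \<longleftrightarrow> solvable s) \<and> reg s' ''k'' \<le> reg s ''k'' \<and>
        reg s' ''n'' \<le> 176 * (reg s ''k'' + 1) ^ 3)" (is "runs _ _ _ ?Q")
proof -
  let ?n = "reg s ''n''" and ?k = "reg s ''k''"
  let ?output = "Cond (Lt (Var ''b'') (Var ''n'')) no_instance Skip"
  have "runs kernelize s (poly reduce_time ?n + (poly bound_time ?k + (19 + 1))) ?Q"
    unfolding kernelize_def
  proof (rule runs_Seq[OF runs_reduce[OF valid]])
    fix s1 assume s1: "valid s1 \<and> (solvable s1 \<longleftrightarrow> solvable s) \<and> reduced s1 \<and> reg s1 ''k'' = ?k"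
    then have k1: "reg s1 ''k'' = ?k" by simp
    show "runs (size_bound ;; ?output) s1 (poly bound_time ?k + (19 + 1)) ?Q"
    proof (rule runs_Seq[OF runs_size_bound[of s1, unfolded k1]])
      fix s2 assume s2: "unchanged_outside {''b'', ''x'', ''y'', ''z''} s1 s2 \<and>
        reg s2 ''b'' = 176 * (?k + 1) ^ 3"
      then have "valid s2" "solvable s2 \<longleftrightarrow> solvable s" "reduced s2"
        using s1 instance_unchanged[of "{''b'', ''x'', ''y'', ''z''}" s1 s2] by auto
      moreover have "reg s2 ''k'' = ?k" using s1 s2 by (simp add: unchanged_outside_def)
      moreover have "runs no_instance s2 19
          (\<lambda>s'. valid s' \<and> \<not> solvable s' \<and> reg s' ''k'' = 0 \<and> reg s' ''n'' = 4)"
        by (rule runs_mono[OF runs_no_instance]) (auto dest: no_instance_unsolvable)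
      ultimately show "runs ?output s2 (19 + 1) ?Q"
        using s1 s2 card_le_if_reduced[of s2]
        by (intro runs_Cond runs_Skip) (auto elim!: runs_mono)
    qed
  qed
  moreover have "poly reduce_time ?n \<le> poly reduce_time (?n + ?k)"
    "poly bound_time ?k \<le> poly bound_time (?n + ?k)"
    by (rule poly_mono_nat; simp)+
  ultimately show ?thesis
    unfolding kernel_time_def
    by (elim runs_mono) (simp_all only: poly_add poly_1 poly_numeral add_mono)
qed

end


section \<open>Instances as inputs and outputs\<close>

lemma valid_input_state:
  assumes "simple_graph G" "enumerates vs G"
  shows "valid (input_state vs G k)"
  using singleton_notin_edges[of G "verts G"] assms
  by (auto simp: simple_graph_def valid_def input_state_def insert_commute)

lemma solvable_input_state:
  assumes G: "simple_graph G" and vs: "enumerates vs G"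
  shows "solvable (input_state vs G k) \<longleftrightarrow> yes_instance G k"
proof -
  let ?s = "input_state vs G k"
  have vs': "distinct vs" "set vs = verts G" using vs by (auto simp: enumerates_def)
  have "bij_betw ((!) vs) (mem_verts ?s) (verts G)"
    using bij_betw_nth[OF vs'(1) refl vs'(2)[symmetric]] by (simp add: input_state_def)
  then have "solvable ?s \<longleftrightarrow> editable (verts G) (closed_adj G) (reg ?s ''k'')"
    unfolding solvable_def
  proof (rule editable_cong_bij)
    show "mem_adj ?s i j \<longleftrightarrow> closed_adj G (vs ! i) (vs ! j)"
      if "i \<in> mem_verts ?s" "j \<in> mem_verts ?s" for i j
      using that vs'(1)
      by (auto simp: mem_adj_def closed_adj_def input_state_def nth_eq_iff_index_eq)
  qed
  then show ?thesis using yes_instance_iff_editable[OF G] by (simp add: input_state_def)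
qed

definition mem_graph :: "state \<Rightarrow> nat ugraph" where
  "mem_graph s = UGraph (mem_verts s)
     {{i, j} |i j. i \<in> mem_verts s \<and> j \<in> mem_verts s \<and> arr s ''adj'' i j = 1}"

lemma edges_mem_graph_iff:
  assumes "valid s" "i < reg s ''n''" "j < reg s ''n''"
  shows "{i, j} \<in> edges (mem_graph s) \<longleftrightarrow> arr s ''adj'' i j = 1"
  using assms by (auto simp: mem_graph_def valid_def doubleton_eq_iff)

lemma simple_graph_mem_graph:
  assumes "valid s"
  shows "simple_graph (mem_graph s)"
proof -
  have "card {i, j} = 2" if "i < reg s ''n''" "arr s ''adj'' i j = 1" for i j
    using assms that by (cases "i = j") (auto simp: valid_def)
  then show ?thesis by (auto simp: simple_graph_def mem_graph_def vertex_pairs_def)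
qed

lemma output_instance_mem_graph:
  assumes "valid s"
  shows "output_instance s (mem_graph s) (reg s ''k'')"
proof -
  have "enumerates [0..<reg s ''n''] (mem_graph s)" by (auto simp: enumerates_def mem_graph_def)
  moreover have "arr s ''adj'' i j = (if {i, j} \<in> edges (mem_graph s) then 1 else 0)"
    if "i < reg s ''n''" "j < reg s ''n''" for i j
    using assms that edges_mem_graph_iff[OF assms that]
    by (auto simp: valid_def le_Suc_eq)
  ultimately show ?thesis
    unfolding output_instance_def using simple_graph_mem_graph[OF assms]
    by (intro conjI refl exI[of _ "[0..<reg s ''n'']"]) auto
qed

lemma yes_instance_mem_graph:
  assumes "valid s"
  shows "yes_instance (mem_graph s) (reg s ''k'') \<longleftrightarrow> solvable s"
proof -
  have "editable (verts (mem_graph s)) (closed_adj (mem_graph s)) (reg s ''k'') \<longleftrightarrow> solvable s"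
    unfolding solvable_def
    by (rule editable_cong_bij[where f = id])
      (use edges_mem_graph_iff[OF assms] in \<open>auto simp: mem_graph_def closed_adj_def mem_adj_def\<close>)
  then show ?thesis using yes_instance_iff_editable[OF simple_graph_mem_graph[OF assms]] by simp
qed

lemma (in deletability_checker) kernelize_correct:
  assumes G: "simple_graph G" and vs: "enumerates vs G"
  shows "\<exists>t s G' k'. exec kernelize (input_state vs G k) t s \<and>
    t \<le> poly kernel_time (card (verts G) + k) \<and> output_instance s G' k' \<and>
    (yes_instance G' k' \<longleftrightarrow> yes_instance G k) \<and> card (verts G') \<le> 176 * (k + 1) ^ 3 \<and> k' \<le> k"
proof -
  let ?s = "input_state vs G k"
  have "length vs = card (verts G)" using vs by (metis distinct_card enumerates_def)
  then have regs: "reg ?s ''n'' = card (verts G)" "reg ?s ''k'' = k"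
    by (simp_all add: input_state_def)
  obtain t s where "exec kernelize ?s t s" "t \<le> poly kernel_time (card (verts G) + k)"
    and s: "valid s" "solvable s \<longleftrightarrow> solvable ?s" "reg s ''k'' \<le> k" "reg s ''n'' \<le> 176 * (k + 1) ^ 3"
    using runs_kernelize[OF valid_input_state[OF G vs, of k]] unfolding runs_def regs by blast
  moreover have "card (verts (mem_graph s)) = reg s ''n''" by (simp add: mem_graph_def)
  ultimately show ?thesis
    using output_instance_mem_graph yes_instance_mem_graph solvable_input_state[OF G vs]
    by (intro exI[of _ t] exI[of _ s] exI[of _ "mem_graph s"] exI[of _ "reg s ''k''"]) simp
qed

lemma computable_id: "computable (\<lambda>k. k)"
  unfolding computable_def
proof (intro exI allI conjI)
  show "exec (''y'' ::= Var ''x'') (set_reg ''x'' x blank) 1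
    (set_reg ''y'' (aval (Var ''x'') (set_reg ''x'' x blank)) (set_reg ''x'' x blank))" for x
    by (rule exec_Assign)
qed simp

lemma mult_cube_Suc_in_bigo: "(\<lambda>k. real (c * (k + 1) ^ 3)) \<in> O(\<lambda>k. real k ^ 3)"
proof (rule bigoI[where c = "8 * real c"])
  show "\<forall>\<^sub>F k in sequentially. norm (real (c * (k + 1) ^ 3)) \<le> 8 * real c * norm (real k ^ 3)"
    using eventually_ge_at_top[of 1]
  proof eventually_elim
    case (elim k)
    then have "(real k + 1) ^ 3 \<le> (2 * real k) ^ 3" by (intro power_mono) auto
    then have "real c * (real k + 1) ^ 3 \<le> real c * (8 * real k ^ 3)"
      by (intro mult_left_mono) (simp_all add: power_mult_distrib)
    then show ?case by (simp add: add.commute mult.left_commute)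
  qed
qed

theorem theorem20:
  "\<exists>(P :: com) (p :: nat poly) (f :: nat \<Rightarrow> nat) (g :: nat \<Rightarrow> nat).
     (\<lambda>k. real (f k)) \<in> O(\<lambda>k. real k ^ 3) \<and>
     computable g \<and>
     (\<forall>(G :: nat ugraph) (vs :: nat list) (k :: nat).
        simple_graph G \<and> enumerates vs G \<longrightarrow>
        (\<exists>t s (G' :: nat ugraph) k'.
           exec P (input_state vs G k) t s \<and>
           t \<le> poly p (card (verts G) + k) \<and>
           output_instance s G' k' \<and>
           (yes_instance G' k' \<longleftrightarrow> yes_instance G k) \<and>
           card (verts G') \<le> f k \<and>
           k' \<le> g k))"
proof -
  obtain check p where "decides 1 check p (\<lambda>V A k xs. deletable V A k (xs ! 0))"
    using checkable_deletable by (auto simp: checkable_def)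
  then interpret deletability_checker check p by unfold_locales
  show ?thesis
    using mult_cube_Suc_in_bigo[of 176] computable_id kernelize_correct
    by (intro exI[of _ kernelize] exI[of _ kernel_time] exI[of _ "\<lambda>k. 176 * (k + 1) ^ 3"]
        exI[of _ "\<lambda>k. k"] conjI allI impI) blast+
qed

end
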